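(* Let $k,w,s,n\in\mathbb Z_{>0}$ and $g\in\{0,1,\ldots,s\}$. Suppose that \[ 0\le n-s(k-1)-g\le s. \] Then \[ P_{\delta_{k,n-s(k-1)-g}^{(w,s)}}(\mathbf t_n;q,t) =t^{\frac{wk(n-1)(n-s(k-1)-2g)}2} P_{\delta_{k,g}^{(w,s)}}(\mathbf t_n;q,t). \]
   Context: Partitions are weakly decreasing sequences of nonnegative integers with finitely many nonzero parts. Exponents on parts denote multiplicities; a part with multiplicity $0$ is omitted. Intermediate generalized staircase partitions: for $w,s\in\mathbb Z_{>0}$ and $0\le g\le s$, $\delta_{1,g}^{(w,s)}=(w^g)$ (with $\delta_{1,0}^{(w,s)}=\varnothing$) and, for $k\ge2$, $\delta_{k,g}^{(w,s)}=\bigl((wk)^g,(w(k-1))^s,(w(k-2))^s,\ldots,w^s\bigr)$. $q,t$ are independent indeterminates. $P_\lambda(x_1,\ldots,x_n;q,t)$ is the monic Macdonald symmetric polynomial (Macdonald's $P$-normalization: the coefficient of the monomial symmetric function $m_\lambda$ is $1$, all other terms are lower in dominance order, and the $P_\lambda$ are orthogonal for $\langle p_\lambda,p_\mu\rangle=\delta_{\lambda\mu}z_\lambda\prod_i\frac{1-q^{\lambda_i}}{1-t^{\lambda_i}}$), specialized to $n$ variables; $P_\varnothing=1$. $\mathbf t_n=(1,t,\ldots,t^{n-1})$. *)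

theory Defs
  imports
    "HOL-Library.Poly_Mapping"
    "HOL-Library.Multiset"
    "HOL-Computational_Algebra.Polynomial"
    "HOL-Computational_Algebra.Fraction_Field"
begin

section \<open>Partitions\<close>

text \<open>A partition is given by the list of its nonzero parts, in weakly decreasing order.\<close>

definition is_partition :: "nat list \<Rightarrow> bool" where
  "is_partition \<nu> \<longleftrightarrow> sorted_wrt (\<ge>) \<nu> \<and> 0 \<notin> set \<nu>"

definition dominated :: "nat list \<Rightarrow> nat list \<Rightarrow> bool" where
  "dominated \<mu> \<nu> \<longleftrightarrow>
     sum_list \<mu> = sum_list \<nu> \<and> (\<forall>j. sum_list (take j \<mu>) \<le> sum_list (take j \<nu>))"

definition z_number :: "nat list \<Rightarrow> nat" where
  "z_number \<rho> = (\<Prod>i\<in>set \<rho>. i ^ count_list \<rho> i * fact (count_list \<rho> i))"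

text \<open>For \<open>k = 1\<close> the second factor is empty and the value is \<open>(w\<^sup>g)\<close>, so the case distinction
  in the usual definition is not needed.\<close>

definition staircase :: "nat \<Rightarrow> nat \<Rightarrow> nat \<Rightarrow> nat \<Rightarrow> nat list" where
  "staircase w s k g =
     replicate g (w * k) @ concat (map (\<lambda>j. replicate s (w * j)) (rev [1..<k]))"


section \<open>Symmetric functions\<close>

text \<open>Formal power series in countably many variables \<open>x\<^sub>0, x\<^sub>1, \<dots>\<close>, given by their
  coefficients; a monomial is its finitely supported exponent sequence. Symmetric functions are
  the finite linear combinations of the \<open>monomial_sym \<nu>\<close> inside this type.\<close>

type_synonym 'a series = "(nat \<Rightarrow>\<^sub>0 nat) \<Rightarrow> 'a"

definition series_one :: "'a::field series" where
  "series_one \<alpha> = (if \<alpha> = 0 then 1 else 0)"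

definition series_mult :: "'a::field series \<Rightarrow> 'a series \<Rightarrow> 'a series" where
  "series_mult f h \<alpha> = (\<Sum>(\<beta>, \<gamma>) \<in> {(\<beta>, \<gamma>). \<beta> + \<gamma> = \<alpha>}. f \<beta> * h \<gamma>)"

definition monomial_sym :: "nat list \<Rightarrow> 'a::field series" where
  "monomial_sym \<nu> \<alpha> =
     (if image_mset (Poly_Mapping.lookup \<alpha>) (mset_set (Poly_Mapping.keys \<alpha>)) = mset \<nu>
      then 1 else 0)"

definition power_sum :: "nat \<Rightarrow> 'a::field series" where
  "power_sum r \<alpha> = (if \<exists>i. \<alpha> = Poly_Mapping.single i r then 1 else 0)"

definition power_sum_prod :: "nat list \<Rightarrow> 'a::field series" where
  "power_sum_prod \<rho> = foldr (\<lambda>r f. series_mult (power_sum r) f) \<rho> series_one"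

text \<open>The coefficients of a symmetric function over a field of characteristic \<open>0\<close> in the basis
  of power sum products; they are unique because these products are linearly independent.\<close>

definition power_sum_coeffs :: "'a::field series \<Rightarrow> nat list \<Rightarrow> 'a" where
  "power_sum_coeffs f =
     (THE a. finite {\<rho>. a \<rho> \<noteq> 0} \<and> (\<forall>\<rho>. a \<rho> \<noteq> 0 \<longrightarrow> is_partition \<rho>) \<and>
             f = (\<lambda>\<alpha>. \<Sum>\<rho> | a \<rho> \<noteq> 0. a \<rho> * power_sum_prod \<rho> \<alpha>))"

text \<open>The bilinear form in which the power sum products are orthogonal with the squared norms
  prescribed by Macdonald.\<close>

definition qt_norm :: "'a::field \<Rightarrow> 'a \<Rightarrow> nat list \<Rightarrow> 'a" where
  "qt_norm q t \<rho> = of_nat (z_number \<rho>) * prod_list (map (\<lambda>r. (1 - q ^ r) / (1 - t ^ r)) \<rho>)"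

definition qt_inner :: "'a::field \<Rightarrow> 'a \<Rightarrow> 'a series \<Rightarrow> 'a series \<Rightarrow> 'a" where
  "qt_inner q t f h =
     (\<Sum>\<rho> | power_sum_coeffs f \<rho> \<noteq> 0.
        power_sum_coeffs f \<rho> * power_sum_coeffs h \<rho> * qt_norm q t \<rho>)"


section \<open>Macdonald polynomials\<close>

definition macdonald_family :: "'a::field \<Rightarrow> 'a \<Rightarrow> (nat list \<Rightarrow> 'a series) \<Rightarrow> bool" where
  "macdonald_family q t P \<longleftrightarrow>
     (\<forall>\<nu>. is_partition \<nu> \<longrightarrow>
        (\<exists>c. P \<nu> = (\<lambda>\<alpha>. monomial_sym \<nu> \<alpha> +
           (\<Sum>\<mu> | is_partition \<mu> \<and> dominated \<mu> \<nu> \<and> \<mu> \<noteq> \<nu>. c \<mu> * monomial_sym \<mu> \<alpha>)))) \<and>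
     (\<forall>\<mu> \<nu>. is_partition \<mu> \<longrightarrow> is_partition \<nu> \<longrightarrow> \<mu> \<noteq> \<nu> \<longrightarrow> qt_inner q t (P \<mu>) (P \<nu>) = 0)"

text \<open>For generic \<open>q, t\<close> (in particular for indeterminates) such a family exists and its values
  on partitions are unique, by a theorem of Macdonald.\<close>

definition macdonald_P :: "'a::field \<Rightarrow> 'a \<Rightarrow> nat list \<Rightarrow> 'a series" where
  "macdonald_P q t \<nu> = (THE f. \<exists>P. macdonald_family q t P \<and> f = P \<nu>)"

text \<open>The value of \<open>f(x\<^sub>0, \<dots>, x\<^bsub>n-1\<^esub>, 0, 0, \<dots>)\<close>. The sum is finite because symmetric functions
  have bounded degree.\<close>

definition eval_vars :: "nat \<Rightarrow> (nat \<Rightarrow> 'a) \<Rightarrow> 'a::field series \<Rightarrow> 'a" where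
  "eval_vars n x f =
     (\<Sum>\<alpha> | Poly_Mapping.keys \<alpha> \<subseteq> {..<n} \<and> f \<alpha> \<noteq> 0.
        f \<alpha> * (\<Prod>i<n. x i ^ Poly_Mapping.lookup \<alpha> i))"


section \<open>The field of rational functions in two indeterminates\<close>

text \<open>The fraction field of \<open>\<rat>[q][t]\<close>: the outer polynomial variable is \<open>t\<close>.\<close>

type_synonym qt_field = "rat poly poly fract"

definition q_var :: qt_field where
  "q_var = Fract [:[:0, 1:]:] 1"

definition t_var :: qt_field where
  "t_var = Fract [:0, 1:] 1"

end

theory Submission
  imports
    Defs
    "HOL-Computational_Algebra.Formal_Power_Series"
    "HOL-Computational_Algebra.Polynomial_FPS"
    "HOL-Computational_Algebra.Polynomial_Factorial"
begin

text \<open>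
  Put \<open>m = w * k\<close> and \<open>n = g + s * (k - 1) + h\<close>. Subtracting the \<open>n\<close> parts of \<open>staircase w s k g\<close>, zeros included,
  from \<open>m\<close> exchanges the \<open>g\<close> parts equal to \<open>m\<close> with the \<open>h\<close> zeros and permutes the other parts: the result
  is \<open>staircase w s k h\<close>. So the two partitions are complements of each other in the rectangle with \<open>n\<close> rows of
  length \<open>m\<close>, and the theorem is an instance of the reflection principle

    \<open>P\<^bsub>complement of \<mu>\<^esub>(x) = (x\<^sub>0 \<cdots> x\<^bsub>n-1\<^esub>)\<^sup>m P\<^bsub>\<mu>\<^esub>(1/x)\<close>   (\<open>macdonald_P_complement\<close>)

  at \<open>x\<^sub>i = t\<^sup>i\<close>. There, \<open>1/x\<close> is \<open>x\<close> in reversed order, divided by the scalar \<open>t\<^bsup>n-1\<^esup>\<close>, so symmetry and homogeneity of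
  \<open>P\<^bsub>\<mu>\<^esub>\<close> yield the power of \<open>t\<close>.

  The reflection principle comes from Macdonald's difference operator \<open>mac_op\<close>, whose eigenfunctions the \<open>P\<^bsub>\<mu>\<^esub>\<close> are. In
  \<open>n\<close> variables the eigenvalue and the coefficient at the monomial symmetric function of \<open>\<mu>\<close> characterise \<open>P\<^bsub>\<mu>\<^esub>\<close>, because
  different partitions have different eigenvalues. Inverting the variables turns the operator for \<open>q, t\<close> into the one for
  \<open>1/q, 1/t\<close> up to a scalar (\<open>mac_op_inverse\<close>). The functions \<open>P\<^bsub>\<mu>\<^esub>\<close> for both pairs of parameters are the same, since
  in each degree the two inner products are proportional (\<open>macdonald_family_inverse\<close>).

  As \<open>macdonald_P\<close> is a definite description, existence and uniqueness of Macdonald's functions must be proved on the way. The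
  operator is studied pointwise, at points with distinct nonzero coordinates. A partial fraction expansion computes it on
  power sum products (\<open>mac_op_psum_prod\<close>), where its matrix is visibly self-adjoint and independent of the number
  of variables. Restricting to curves \<open>x\<^sub>i = y ^ c\<^sub>i\<close> and comparing degrees in \<open>y\<close> for varying \<open>c\<close> shows that it is
  triangular for the dominance order on monomial symmetric functions, and finds the eigenvalues (\<open>coord_op_triangular\<close>).
  For distinct eigenvalues this produces an orthogonal family of eigenvectors (\<open>mac_vec_orthogonal\<close>), and triangularity
  together with nondegeneracy of the form shows that no other family exists (\<open>mac_vec_unique\<close>).
\<close>

section \<open>Triangular systems of linear equations\<close>

text \<open>Induction on the size of \<open>J\<close>: a maximal index \<open>m\<close> occurs in no other row, so subtracting the right multiple of
  row \<open>m\<close> from \<open>w\<close> removes \<open>m\<close> from the support. This one lemma serves three times: to expand in power sums, to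
  solve for eigenvectors, and to expand in families of the shape that Macdonald's functions have.\<close>

lemma triangular_span:
  fixes u :: "'i \<Rightarrow> 'i \<Rightarrow> 'a::field"
  assumes "finite J" and "transp_on J R" and "asymp_on J R"
    and "\<And>i j. i \<in> J \<Longrightarrow> u i j \<noteq> 0 \<Longrightarrow> j = i \<or> (j \<in> J \<and> R j i)"
    and "\<And>i. i \<in> J \<Longrightarrow> u i i \<noteq> 0"
    and "\<And>j. w j \<noteq> 0 \<Longrightarrow> j \<in> J"
  shows "\<exists>a. (\<forall>j. a j \<noteq> 0 \<longrightarrow> j \<in> J) \<and> (\<forall>j. w j = (\<Sum>i\<in>J. a i * u i j))"
  using assms
proof (induction "card J" arbitrary: J w)
  case 0
  then have "J = {}" by simp
  with "0.prems"(6) have "w j = 0" for j by blast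
  with \<open>J = {}\<close> show ?case by (intro exI[of _ "\<lambda>_. 0"]) auto
next
  case (Suc k)
  then have "J \<noteq> {}" by auto
  with Finite_Set.bex_max_element[OF Suc.prems(1) Suc.prems(3) Suc.prems(2)]
  obtain m where m: "m \<in> J" and max: "\<And>x. x \<in> J \<Longrightarrow> x \<noteq> m \<Longrightarrow> \<not> R m x"
    by blast
  define J' where "J' = J - {m}"
  define c where "c = w m / u m m"
  define w' where "w' j = w j - c * u m j" for j
  have w'_supp: "j \<in> J'" if "w' j \<noteq> 0" for j
  proof -
    have "j \<noteq> m" using that Suc.prems(5)[OF m] by (auto simp: w'_def c_def)
    moreover have "w j \<noteq> 0 \<or> u m j \<noteq> 0" using that by (auto simp: w'_def)
    ultimately show ?thesis using Suc.prems(4)[OF m] Suc.prems(6) by (auto simp: J'_def)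
  qed
  have "k = card J'" using Suc.hyps(2) m Suc.prems(1) by (simp add: J'_def)
  moreover have "finite J'" "transp_on J' R" "asymp_on J' R"
    using Suc.prems(1-3) by (auto simp: J'_def intro: transp_on_subset asymp_on_subset)
  moreover have "j = i \<or> (j \<in> J' \<and> R j i)" if "i \<in> J'" "u i j \<noteq> 0" for i j
    using Suc.prems(4)[of i j] that max by (auto simp: J'_def)
  moreover have "u i i \<noteq> 0" if "i \<in> J'" for i using Suc.prems(5) that by (auto simp: J'_def)
  ultimately obtain a where a: "\<And>j. a j \<noteq> 0 \<Longrightarrow> j \<in> J'" "\<And>j. w' j = (\<Sum>i\<in>J'. a i * u i j)"
    using Suc.hyps(1)[of J' w'] w'_supp by metis
  show ?case
  proof (intro exI[of _ "a(m := c)"] conjI allI impI)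
    fix j assume "(a(m := c)) j \<noteq> 0"
    then show "j \<in> J" using a(1)[of j] m by (auto simp: J'_def split: if_splits)
  next
    fix j
    have "(\<Sum>i\<in>J. (a(m := c)) i * u i j) = c * u m j + (\<Sum>i\<in>J'. (a(m := c)) i * u i j)"
      using m Suc.prems(1) by (simp add: J'_def sum.remove)
    also have "(\<Sum>i\<in>J'. (a(m := c)) i * u i j) = (\<Sum>i\<in>J'. a i * u i j)"
      by (intro sum.cong) (auto simp: J'_def)
    finally show "w j = (\<Sum>i\<in>J. (a(m := c)) i * u i j)"
      using a(2)[of j] by (simp add: w'_def algebra_simps)
  qed
qed

lemma triangular_independent:
  fixes u :: "'i \<Rightarrow> 'i \<Rightarrow> 'a::field"
  assumes "finite J" and "transp_on J R" and "asymp_on J R"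
    and "\<And>i j. i \<in> J \<Longrightarrow> u i j \<noteq> 0 \<Longrightarrow> j = i \<or> R j i"
    and "\<And>i. i \<in> J \<Longrightarrow> u i i \<noteq> 0"
    and "\<And>j. (\<Sum>i\<in>J. a i * u i j) = 0"
    and "i \<in> J"
  shows "a i = 0"
proof (rule ccontr)
  assume "a i \<noteq> 0"
  define S where "S = {i\<in>J. a i \<noteq> 0}"
  have "finite S" "S \<noteq> {}" "asymp_on S R" "transp_on S R"
    using assms(1-3,7) \<open>a i \<noteq> 0\<close> by (auto simp: S_def intro: transp_on_subset asymp_on_subset)
  then obtain m where m: "m \<in> S" and max: "\<And>x. x \<in> S \<Longrightarrow> x \<noteq> m \<Longrightarrow> \<not> R m x"
    using Finite_Set.bex_max_element[of S R] by blast
  have "a j * u j m = 0" if "j \<in> J - {m}" for j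
    using assms(4)[of j m] max[of j] that by (auto simp: S_def)
  then have "(\<Sum>i\<in>J - {m}. a i * u i m) = 0" by (intro sum.neutral ballI)
  then have "(\<Sum>i\<in>J. a i * u i m) = a m * u m m"
    using m assms(1) by (subst sum.remove[of J m]) (simp_all add: S_def)
  with assms(5)[of m] assms(6)[of m] m show False by (auto simp: S_def)
qed

text \<open>Writing the eigenvector as the unit vector at \<open>l\<close> plus unknowns below \<open>l\<close>, the eigenvector equation becomes a
  linear system with rows \<open>A i - A l l\<close>. It is again triangular, and its diagonal vanishes nowhere because the
  eigenvalues differ.\<close>

lemma triangular_eigenvector:
  fixes A :: "'i \<Rightarrow> 'i \<Rightarrow> 'a::field"
  assumes "finite J" and "transp_on J R" and "asymp_on J R"
    and A: "\<And>i j. i \<in> J \<Longrightarrow> A i j \<noteq> 0 \<Longrightarrow> j = i \<or> (j \<in> J \<and> R j i)"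
    and l: "l \<in> J" and ne: "\<And>i. i \<in> J \<Longrightarrow> i \<noteq> l \<Longrightarrow> A i i \<noteq> A l l"
  obtains w where "w l = 1" and "\<And>j. w j \<noteq> 0 \<Longrightarrow> j = l \<or> (j \<in> J \<and> R j l)"
    and "\<And>j. (\<Sum>i\<in>J. w i * A i j) = A l l * w j"
proof -
  define I where "I = {i\<in>J. R i l}"
  have irr: "\<not> R l l" using assms(3) l by (auto dest: asymp_onD)
  have I: "finite I" "transp_on I R" "asymp_on I R" "I \<subseteq> J" "l \<notin> I"
    using assms(1-3) irr by (auto simp: I_def intro: transp_on_subset asymp_on_subset)
  define u where "u i j = A i j - (if j = i then A l l else 0)" for i j
  define b where "b j = (if j = l then 0 else - A l j)" for j
  have "\<exists>a. (\<forall>j. a j \<noteq> 0 \<longrightarrow> j \<in> I) \<and> (\<forall>j. b j = (\<Sum>i\<in>I. a i * u i j))"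
  proof (rule triangular_span[OF I(1-3)])
    fix i j assume i: "i \<in> I" and "u i j \<noteq> 0"
    then have "j = i \<or> (j \<in> J \<and> R j i)"
      using A[of i j] I(4) by (auto simp: u_def split: if_splits)
    moreover have "R j l" if "j \<in> J" "R j i"
      using transp_onD[OF assms(2), of j i l] that i l by (auto simp: I_def)
    ultimately show "j = i \<or> (j \<in> I \<and> R j i)" by (auto simp: I_def)
  next
    fix i assume "i \<in> I"
    then show "u i i \<noteq> 0" using ne[of i] irr by (auto simp: I_def u_def)
  next
    fix j assume "b j \<noteq> 0"
    then show "j \<in> I" using A[OF l, of j] by (auto simp: b_def I_def split: if_splits)
  qed
  then obtain a where a: "\<And>j. a j \<noteq> 0 \<Longrightarrow> j \<in> I" "\<And>j. b j = (\<Sum>i\<in>I. a i * u i j)"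
    by blast
  show ?thesis
  proof (rule that[of "a(l := 1)"])
    show "(a(l := 1)) l = 1" by simp
    show "j = l \<or> (j \<in> J \<and> R j l)" if "(a(l := 1)) j \<noteq> 0" for j
      using that a(1)[of j] by (auto simp: I_def split: if_splits)
    fix j
    have "(\<Sum>i\<in>J. (a(l := 1)) i * A i j) = A l j + (\<Sum>i\<in>J-{l}. (a(l := 1)) i * A i j)"
      using l assms(1) by (subst sum.remove[of J l]) auto
    also have "(\<Sum>i\<in>J-{l}. (a(l := 1)) i * A i j) = (\<Sum>i\<in>I. a i * A i j)"
      using assms(1) I a(1) by (intro sum.mono_neutral_cong_right) auto
    also have "(\<Sum>i\<in>I. a i * A i j) = (\<Sum>i\<in>I. a i * u i j) + A l l * (\<Sum>i\<in>I. if j = i then a i else 0)"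
      by (auto simp: u_def sum_distrib_left sum.distrib[symmetric] algebra_simps intro!: sum.cong)
    also have "(\<Sum>i\<in>I. if j = i then a i else 0) = a j"
      using a(1)[of j] I(1) by (auto simp: sum.delta)
    also have "(\<Sum>i\<in>I. a i * u i j) = b j" by (simp add: a(2))
    finally show "(\<Sum>i\<in>J. (a(l := 1)) i * A i j) = A l l * (a(l := 1)) j"
      using a(1)[of l] I(5) by (auto simp: b_def)
  qed
qed

section \<open>Multisets of parts and their symmetry factors\<close>

text \<open>Partitions are handled as multisets of positive numbers: sub-multisets and differences of multisets are what the
  product rules below sum over.\<close>

definition parts :: "nat \<Rightarrow> nat multiset set" where
  "parts d = {M. 0 \<notin># M \<and> sum_mset M = d}"

lemma size_le_sum_mset: "0 \<notin># M \<Longrightarrow> size M \<le> sum_mset (M :: nat multiset)"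
proof (induction M)
  case (add x M)
  then show ?case by (cases x) auto
qed simp

lemma finite_parts [simp]: "finite (parts d)"
proof (rule finite_subset)
  show "parts d \<subseteq> mset ` {xs. set xs \<subseteq> {..d} \<and> length xs \<le> d}"
  proof
    fix M assume M: "M \<in> parts d"
    obtain xs where xs: "M = mset xs" by (metis ex_mset)
    have "x \<le> d" if "x \<in># M" for x
      using M that by (auto simp: parts_def dest!: multi_member_split)
    moreover have "size M \<le> d" using size_le_sum_mset[of M] M by (auto simp: parts_def)
    ultimately show "M \<in> mset ` {xs. set xs \<subseteq> {..d} \<and> length xs \<le> d}"
      using xs by auto
  qed
qed (simp add: finite_lists_length_le)

text \<open>The order of the centraliser of a permutation of cycle type \<open>M\<close>.\<close>

definition zee :: "nat multiset \<Rightarrow> nat" where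
  "zee M = (\<Prod>i\<in>set_mset M. i ^ count M i * fact (count M i))"

lemma zee_pos: "0 \<notin># M \<Longrightarrow> zee M > 0"
  by (auto simp: zee_def intro!: prod_pos) (metis gr0I)

lemma zee_add_mset: "zee (add_mset r M) = r * Suc (count M r) * zee M"
proof -
  let ?f = "\<lambda>M i. i ^ count M i * fact (count M i) :: nat"
  have *: "zee K = ?f K r * (\<Prod>i\<in>set_mset M - {r}. ?f K i)"
    if "set_mset K - {r} = set_mset M - {r}" for K
  proof (cases "r \<in># K")
    case True
    then show ?thesis unfolding zee_def by (subst prod.remove[of _ r]) (auto simp: that)
  next
    case False
    then have "set_mset K = set_mset M - {r}" using that by auto
    then have "zee K = (\<Prod>i\<in>set_mset M - {r}. ?f K i)" by (simp add: zee_def)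
    moreover have "?f K r = 1" using False by (simp add: not_in_iff)
    ultimately show ?thesis by (simp only: mult_1_left)
  qed
  have "zee (add_mset r M) = ?f (add_mset r M) r * (\<Prod>i\<in>set_mset M - {r}. ?f (add_mset r M) i)"
    by (rule *) auto
  also have "(\<Prod>i\<in>set_mset M - {r}. ?f (add_mset r M) i) = (\<Prod>i\<in>set_mset M - {r}. ?f M i)"
    by (intro prod.cong) auto
  finally show ?thesis using *[of M] by (simp add: algebra_simps)
qed

text \<open>The terms of an exponential formula: summed over all multisets \<open>M\<close>, the products of \<open>a\<close> over \<open>M\<close> divided by
  \<open>zee M\<close> give \<open>exp (\<Sum>r. a r / r)\<close>. The two facts about exponentials that are needed follow purely from the recurrence
  \<open>weight_step\<close>.\<close>

definition weight :: "(nat \<Rightarrow> 'a) \<Rightarrow> nat multiset \<Rightarrow> 'a::field_char_0" where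
  "weight a M = (\<Prod>r\<in>#M. a r) / of_nat (zee M)"

lemma weight_empty [simp]: "weight a {#} = 1"
  by (simp add: weight_def zee_def)

text \<open>Removing one part \<open>r\<close> from \<open>M\<close> divides \<open>zee M\<close> by \<open>r\<close> times the multiplicity of \<open>r\<close>.\<close>

lemma weight_step:
  assumes "0 \<notin># M"
  shows "of_nat (r * count M r) * weight a M = (if r \<in># M then a r * weight a (M - {#r#}) else 0)"
proof (cases "r \<in># M")
  case True
  then obtain K where K: "M = add_mset r K" by (metis multi_member_split)
  moreover have "0 \<notin># K" "r > 0" using assms K by auto
  then have "of_nat (zee K) \<noteq> (0::'a)" "of_nat r \<noteq> (0::'a)" using zee_pos[of K] by auto
  moreover define c :: 'a where "c = of_nat (Suc (count K r))"
  moreover have "c \<noteq> 0" unfolding c_def by (simp only: of_nat_eq_0_iff)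
  moreover have "count M r = Suc (count K r)" using K by simp
  ultimately show ?thesis
    unfolding weight_def by (simp only: zee_add_mset of_nat_mult c_def[symmetric]) simp
qed (simp add: count_eq_zero_iff)

lemma finite_subset_msets [simp]: "finite {K. K \<subseteq># M}"
proof (rule finite_subset)
  have "K \<in> mset ` {xs. set xs \<subseteq> set_mset M \<and> length xs \<le> size M}" if "K \<subseteq># M" for K
    using that set_mset_mono[OF that] size_mset_mono[OF that] ex_mset[of K] by auto
  then show "{K. K \<subseteq># M} \<subseteq> mset ` {xs. set xs \<subseteq> set_mset M \<and> length xs \<le> size M}" by auto
qed (simp add: finite_lists_length_le)

text \<open>The exponential of a sum is the product of the exponentials. Multiplying both sides by \<open>r * count M r\<close> and
  distributing the multiplicity of \<open>r\<close> over \<open>K\<close> and \<open>M - K\<close> reduces the claim to \<open>M - {#r#}\<close>, by \<open>weight_step\<close>.\<close>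

lemma weight_add:
  assumes "0 \<notin># M"
  shows "weight (\<lambda>r. a r + b r) M = (\<Sum>K | K \<subseteq># M. weight a K * weight b (M - K))"
  using assms
proof (induction "size M" arbitrary: M)
  case 0
  then show ?case by simp
next
  case (Suc k)
  then obtain r L where M: "M = add_mset r L" by (metis size_eq_Suc_imp_eq_union)
  have "k = size L" "0 \<notin># L" "r > 0" using Suc M by auto
  note IH = Suc.hyps(1)[OF this(1,2)]
  let ?c = "of_nat (r * count M r) :: 'a"
  have "?c \<noteq> 0" using \<open>r > 0\<close> M by (simp only: of_nat_eq_0_iff) simp
  have sub0: "0 \<notin># K" "0 \<notin># M - K" if "K \<subseteq># M" for K
    using that Suc.prems by (auto dest: mset_subset_eqD in_diffD)
  have "?c * (weight a K * weight b (M - K)) =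
      (of_nat (r * count K r) * weight a K) * weight b (M - K)
      + weight a K * (of_nat (r * count (M - K) r) * weight b (M - K))" if "K \<subseteq># M" for K
  proof -
    have "count M r = count K r + count (M - K) r"
      using that by (simp add: subseteq_mset_def)
    then show ?thesis by (simp add: algebra_simps)
  qed
  then have "?c * (\<Sum>K | K \<subseteq># M. weight a K * weight b (M - K)) =
      (\<Sum>K | K \<subseteq># M. (of_nat (r * count K r) * weight a K) * weight b (M - K))
      + (\<Sum>K | K \<subseteq># M. weight a K * (of_nat (r * count (M - K) r) * weight b (M - K)))"
    by (simp add: sum_distrib_left sum.distrib)
  also have "(\<Sum>K | K \<subseteq># M. (of_nat (r * count K r) * weight a K) * weight b (M - K))
      = (\<Sum>K | K \<subseteq># M \<and> r \<in># K. a r * (weight a (K - {#r#}) * weight b (M - K)))"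
    by (rule sum.mono_neutral_cong_right) (auto simp: sub0 weight_step simp del: of_nat_mult)
  also have "\<dots> = (\<Sum>K | K \<subseteq># L. a r * (weight a K * weight b (L - K)))"
  proof (rule sum.reindex_bij_witness[of _ "add_mset r" "\<lambda>K. K - {#r#}"])
    fix K assume "K \<in> {K. K \<subseteq># M \<and> r \<in># K}"
    then obtain K' where K': "K = add_mset r K'" "K' \<subseteq># L"
      by (metis (mono_tags, lifting) M mem_Collect_eq mset_subset_eq_add_mset_cancel multi_member_split)
    then show "add_mset r (K - {#r#}) = K" "K - {#r#} \<in> {K. K \<subseteq># L}"
      "a r * (weight a (K - {#r#}) * weight b (L - (K - {#r#}))) = a r * (weight a (K - {#r#}) * weight b (M - K))"
      by (simp_all add: M)
  next
    fix K assume "K \<in> {K. K \<subseteq># L}"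
    then show "add_mset r K - {#r#} = K" "add_mset r K \<in> {K. K \<subseteq># M \<and> r \<in># K}"
      by (simp_all add: M)
  qed
  also have "(\<Sum>K | K \<subseteq># M. weight a K * (of_nat (r * count (M - K) r) * weight b (M - K)))
      = (\<Sum>K | K \<subseteq># M. if r \<in># M - K then b r * (weight a K * weight b (M - K - {#r#})) else 0)"
    by (intro sum.cong refl, subst weight_step) (auto dest: sub0(2))
  also have "\<dots> = (\<Sum>K | K \<subseteq># M \<and> r \<in># M - K. b r * (weight a K * weight b (M - K - {#r#})))"
    by (simp only: sum.inter_filter[OF finite_subset_msets, symmetric] mem_Collect_eq)
  also have "\<dots> = (\<Sum>K | K \<subseteq># L. b r * (weight a K * weight b (L - K)))"
  proof (rule sum.cong)
    have "K \<subseteq># M \<and> r \<in># M - K \<longleftrightarrow> K \<subseteq># L" for K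
    proof
      assume *: "K \<subseteq># M \<and> r \<in># M - K"
      then obtain D where D: "M = K + D" by (metis subset_mset.add_diff_inverse)
      with * have "r \<in># D" by simp
      then obtain D' where "D = add_mset r D'" by (metis multi_member_split)
      then show "K \<subseteq># L" using D M by simp
    next
      assume "K \<subseteq># L"
      then obtain D where D: "L = K + D" by (metis subset_mset.add_diff_inverse)
      then show "K \<subseteq># M \<and> r \<in># M - K" using M by simp
    qed
    then show "{K. K \<subseteq># M \<and> r \<in># M - K} = {K. K \<subseteq># L}" by auto
    show "b r * (weight a K * weight b (M - K - {#r#})) = b r * (weight a K * weight b (L - K))" for K
      by (simp add: M diff_diff_add_mset[symmetric] diff_right_commute)
  qed
  also have "(\<Sum>K | K \<subseteq># L. a r * (weight a K * weight b (L - K))) +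
      (\<Sum>K | K \<subseteq># L. b r * (weight a K * weight b (L - K)))
      = (a r + b r) * weight (\<lambda>r. a r + b r) L"
    by (simp add: IH sum_distrib_left sum.distrib[symmetric] algebra_simps)
  also have "\<dots> = ?c * weight (\<lambda>r. a r + b r) M"
    using weight_step[OF Suc.prems, of r "\<lambda>r. a r + b r"] M by simp
  finally show ?case using \<open>?c \<noteq> 0\<close> by (metis mult_left_cancel)
qed

text \<open>For \<open>a r\<close> the \<open>r\<close>-th power sum this is the \<open>d\<close>-th complete homogeneous symmetric function.\<close>

definition hsum :: "(nat \<Rightarrow> 'a) \<Rightarrow> nat \<Rightarrow> 'a::field_char_0" where
  "hsum a d = (\<Sum>M\<in>parts d. weight a M)"

lemma parts_0 [simp]: "parts 0 = {{#}}"
proof -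
  have "M = {#}" if "M \<in> parts 0" for M
    using size_le_sum_mset[of M] that by (simp add: parts_def del: sum_mset_0_iff)
  then show ?thesis by (auto simp: parts_def)
qed

lemma hsum_0 [simp]: "hsum a 0 = 1"
  by (simp add: hsum_def)

lemma sum_mset_eq_sum_count: "sum_mset (M :: nat multiset) = (\<Sum>r\<in>set_mset M. r * count M r)"
proof (induction M)
  case (add x M)
  have "(\<Sum>r\<in>set_mset (add_mset x M). r * count (add_mset x M) r)
      = (\<Sum>r\<in>set_mset (add_mset x M). r * count M r + (if r = x then x else 0))"
    by (intro sum.cong) auto
  also have "\<dots> = (\<Sum>r\<in>set_mset (add_mset x M). r * count M r) + x"
    by (simp add: sum.distrib)
  also have "(\<Sum>r\<in>set_mset (add_mset x M). r * count M r) = (\<Sum>r\<in>set_mset M. r * count M r)"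
    by (intro sum.mono_neutral_right) (auto simp: not_in_iff)
  finally show ?case using add by simp
qed simp

text \<open>Newton's identity. Weighting the parts \<open>r\<close> of \<open>M\<close> by \<open>r * count M r\<close> counts \<open>d\<close>, and \<open>weight_step\<close> removes the part.\<close>

lemma hsum_newton: "of_nat d * hsum a d = (\<Sum>k\<in>{1..d}. a k * hsum a (d - k))"
proof -
  have "of_nat d * weight a M = (\<Sum>k\<in>{k\<in>{1..d}. k \<in># M}. a k * weight a (M - {#k#}))"
    if M: "M \<in> parts d" for M
  proof -
    have "d = (\<Sum>r\<in>set_mset M. r * count M r)"
      using M sum_mset_eq_sum_count[of M] by (simp add: parts_def)
    then have "of_nat d * weight a M = (\<Sum>r\<in>set_mset M. of_nat (r * count M r) * weight a M)"
      by (metis of_nat_sum sum_distrib_right)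
    also have "\<dots> = (\<Sum>r\<in>set_mset M. a r * weight a (M - {#r#}))"
      using M by (intro sum.cong refl) (subst weight_step, auto simp: parts_def)
    also have "set_mset M = {k\<in>{1..d}. k \<in># M}"
    proof -
      have "k \<in> {1..d}" if "k \<in># M" for k
        using that M by (auto simp: parts_def Suc_le_eq intro!: Nat.gr0I dest!: multi_member_split)
      then show ?thesis by auto
    qed
    finally show ?thesis .
  qed
  then have "of_nat d * hsum a d = 
     (\<Sum>M\<in>parts d. \<Sum>k\<in>{k\<in>{1..d}. k \<in># M}. a k * weight a (M - {#k#}))"
    by (simp add: hsum_def sum_distrib_left)
  also have "\<dots> = (\<Sum>k\<in>{1..d}. \<Sum>M\<in>{M\<in>parts d. k \<in># M}. a k * weight a (M - {#k#}))"
    by (rule sum.swap_restrict) auto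
  also have "\<dots> = (\<Sum>k\<in>{1..d}. \<Sum>M\<in>parts (d - k). a k * weight a M)"
  proof (rule sum.cong[OF refl])
    fix k assume "k \<in> {1..d}"
    then show "(\<Sum>M\<in>{M\<in>parts d. k \<in># M}. a k * weight a (M - {#k#}))
        = (\<Sum>M\<in>parts (d - k). a k * weight a M)"
      by (intro sum.reindex_bij_witness[of _ "add_mset k" "\<lambda>M. M - {#k#}"])
         (auto simp: parts_def dest: in_diffD dest!: multi_member_split)
  qed
  finally show ?thesis by (simp add: hsum_def sum_distrib_left)
qed

section \<open>The generating function of the complete sums\<close>

unbundle fps_syntax

text \<open>\<open>P\<close> is the Euler derivative of \<open>F\<close> divided by \<open>F\<close>. This relation avoids exponentials and logarithms of power
  series and, together with the constant term, still determines \<open>F\<close>.\<close>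

definition has_log_deriv :: "'a::field_char_0 fps \<Rightarrow> 'a fps \<Rightarrow> bool" where
  "has_log_deriv F P \<longleftrightarrow> fps_X * fps_deriv F = F * P"

lemma has_log_deriv_mult:
  "has_log_deriv F P \<Longrightarrow> has_log_deriv G Q \<Longrightarrow> has_log_deriv (F * G) (P + Q)"
proof -
  assume "has_log_deriv F P" "has_log_deriv G Q"
  then have "fps_X * fps_deriv F = F * P" "fps_X * fps_deriv G = G * Q"
    by (simp_all add: has_log_deriv_def)
  then have "F * (fps_X * fps_deriv G) + (fps_X * fps_deriv F) * G = F * G * (P + Q)"
    by (simp add: algebra_simps)
  then show ?thesis by (simp add: has_log_deriv_def algebra_simps)
qed

lemma has_log_deriv_prod:
  "finite A \<Longrightarrow> (\<And>i. i \<in> A \<Longrightarrow> has_log_deriv (F i) (P i)) \<Longrightarrow> has_log_deriv (\<Prod>i\<in>A. F i) (\<Sum>i\<in>A. P i)"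
proof (induction A rule: finite_induct)
  case empty
  then show ?case by (simp add: has_log_deriv_def)
next
  case (insert x A)
  then show ?case by (simp add: has_log_deriv_mult)
qed

lemma has_log_deriv_unique:
  assumes "has_log_deriv F P" "has_log_deriv G P" "P $ 0 = 0" "F $ 0 = G $ 0"
  shows "F = G"
proof (rule fps_ext)
  fix n
  show "F $ n = G $ n"
  proof (induction n rule: less_induct)
    case (less n)
    have eq: "of_nat n * S $ n = (\<Sum>i=0..n. S $ i * P $ (n - i))" if "has_log_deriv S P" for S
    proof -
      have "of_nat n * S $ n = (fps_X * fps_deriv S) $ n" by (cases n) (auto simp: algebra_simps)
      also have "\<dots> = (S * P) $ n" using that by (simp add: has_log_deriv_def)
      finally show ?thesis by (simp add: fps_mult_nth)
    qed
    have "(\<Sum>i=0..n. F $ i * P $ (n - i)) = (\<Sum>i=0..n. G $ i * P $ (n - i))"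
    proof (rule sum.cong[OF refl])
      fix i assume "i \<in> {0..n}"
      then show "F $ i * P $ (n - i) = G $ i * P $ (n - i)"
        using less[of i] assms(3) by (cases "i = n") auto
    qed
    then have "of_nat n * F $ n = of_nat n * G $ n" using eq assms(1,2) by metis
    then show ?case using assms(4) by (cases "n = 0") auto
  qed
qed

definition power_fps :: "(nat \<Rightarrow> 'a) \<Rightarrow> 'a::field_char_0 fps" where
  "power_fps a = Abs_fps (\<lambda>k. if k = 0 then 0 else a k)"

lemma has_log_deriv_hsum: "has_log_deriv (Abs_fps (hsum a)) (power_fps a)"
  unfolding has_log_deriv_def
proof (rule fps_ext)
  fix n
  have "(fps_X * fps_deriv (Abs_fps (hsum a))) $ n = of_nat n * hsum a n"
    by (cases n) (auto simp: algebra_simps)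
  also have "\<dots> = (\<Sum>k\<in>{1..n}. a k * hsum a (n - k))" by (rule hsum_newton)
  also have "\<dots> = (\<Sum>k=0..n. power_fps a $ k * Abs_fps (hsum a) $ (n - k))"
    by (intro sum.mono_neutral_cong_left) (auto simp: power_fps_def)
  also have "\<dots> = (Abs_fps (hsum a) * power_fps a) $ n" by (simp add: fps_mult_nth mult.commute)
  finally show "(fps_X * fps_deriv (Abs_fps (hsum a))) $ n = (Abs_fps (hsum a) * power_fps a) $ n" .
qed

definition geom_fps :: "'a \<Rightarrow> 'a::field_char_0 fps" where
  "geom_fps c = Abs_fps (\<lambda>k. c ^ k)"

lemma linear_times_geom_fps: "fps_of_poly [:1, - c:] * geom_fps c = 1"
proof (rule fps_ext)
  fix n
  show "(fps_of_poly [:1, - c:] * geom_fps c) $ n = 1 $ n"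
    by (cases n) (simp_all add: fps_of_poly_pCons ring_distribs geom_fps_def mult.assoc)
qed

lemma has_log_deriv_linear:
  "has_log_deriv (fps_of_poly [:1, - c:]) (- power_fps (\<lambda>k. c ^ k))"
proof -
  have "power_fps (\<lambda>k. c ^ k) = geom_fps c - 1"
    by (rule fps_ext) (simp add: power_fps_def geom_fps_def)
  then show ?thesis
    by (simp add: has_log_deriv_def linear_times_geom_fps right_diff_distrib)
       (simp add: fps_of_poly_pCons algebra_simps)
qed

text \<open>Both sides have constant term \<open>1\<close> and the same logarithmic derivative: \<open>1 - s ^ k\<close> times the
  \<open>k\<close>-th power sum of \<open>x\<close> is the difference of the power sums of \<open>x\<close> and of \<open>s * x\<close>.\<close>

lemma hsum_power_sums:
  fixes x :: "nat \<Rightarrow> 'a::field_char_0"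
  shows "Abs_fps (hsum (\<lambda>k. (1 - s ^ k) * (\<Sum>i<n. x i ^ k))) * fps_of_poly (\<Prod>i<n. [:1, - x i:])
    = fps_of_poly (\<Prod>i<n. [:1, - (s * x i):])"
proof (rule has_log_deriv_unique)
  let ?a = "\<lambda>k. (1 - s ^ k) * (\<Sum>i<n. x i ^ k)"
  show "has_log_deriv (fps_of_poly (\<Prod>i<n. [:1, - (s * x i):])) (\<Sum>i<n. - power_fps (\<lambda>k. (s * x i) ^ k))"
    unfolding fps_of_poly_prod by (rule has_log_deriv_prod) (simp_all add: has_log_deriv_linear del: fps_of_poly_pCons)
  have "has_log_deriv (fps_of_poly (\<Prod>i<n. [:1, - x i:])) (\<Sum>i<n. - power_fps (\<lambda>k. x i ^ k))"
    unfolding fps_of_poly_prod by (rule has_log_deriv_prod) (simp_all add: has_log_deriv_linear)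
  then have "has_log_deriv (Abs_fps (hsum ?a) * fps_of_poly (\<Prod>i<n. [:1, - x i:]))
     (power_fps ?a + (\<Sum>i<n. - power_fps (\<lambda>k. x i ^ k)))"
    by (intro has_log_deriv_mult has_log_deriv_hsum)
  moreover have "power_fps ?a + (\<Sum>i<n. - power_fps (\<lambda>k. x i ^ k)) = (\<Sum>i<n. - power_fps (\<lambda>k. (s * x i) ^ k))"
    by (rule fps_ext)
       (auto simp: power_fps_def fps_sum_nth sum_negf sum_distrib_left power_mult_distrib sum_subtractf algebra_simps)
  ultimately show "has_log_deriv (Abs_fps (hsum ?a) * fps_of_poly (\<Prod>i<n. [:1, - x i:]))
     (\<Sum>i<n. - power_fps (\<lambda>k. (s * x i) ^ k))" by simp
qed (auto simp: power_fps_def fps_sum_nth fps_mult_nth poly_0_coeff_0[symmetric] poly_prod)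

section \<open>Partial fractions\<close>

text \<open>The coefficients of Macdonald's difference operator \<open>mac_op\<close> below.\<close>

definition shift_coeff :: "nat \<Rightarrow> 'a::field \<Rightarrow> (nat \<Rightarrow> 'a) \<Rightarrow> nat \<Rightarrow> 'a" where
  "shift_coeff n t x i = (\<Prod>j\<in>{..<n} - {i}. (t * x i - x j) / (x i - x j))"

text \<open>The points at which the operator may be evaluated and at which partial fractions are available.\<close>

definition good_point :: "nat \<Rightarrow> (nat \<Rightarrow> 'a::field) \<Rightarrow> bool" where
  "good_point n x \<longleftrightarrow> inj_on x {..<n} \<and> (\<forall>i<n. x i \<noteq> 0)"

lemma lead_prod_linear:
  fixes c :: "'i \<Rightarrow> 'a::idom"
  assumes "finite A" and "\<And>i. i \<in> A \<Longrightarrow> c i \<noteq> 0"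
  shows "degree (\<Prod>i\<in>A. [:1, c i:]) = card A" and "coeff (\<Prod>i\<in>A. [:1, c i:]) (card A) = (\<Prod>i\<in>A. c i)"
proof -
  show *: "degree (\<Prod>i\<in>A. [:1, c i:]) = card A"
    using assms by (subst degree_prod_eq_sum_degree) auto
  have "lead_coeff (\<Prod>i\<in>A. [:1, c i:]) = (\<Prod>i\<in>A. c i)"
    using assms by (simp add: lead_coeff_prod)
  then show "coeff (\<Prod>i\<in>A. [:1, c i:]) (card A) = (\<Prod>i\<in>A. c i)" by (simp add: *)
qed

lemma degree_less_if_coeff_0: "degree p \<le> n \<Longrightarrow> coeff p n = 0 \<Longrightarrow> n \<noteq> 0 \<Longrightarrow> degree p < n"
  by (metis degree_0 leading_coeff_0_iff le_neq_implies_less gr0I)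

text \<open>The partial fraction expansion of \<open>\<Prod>i. (1 - x i z / t) / (1 - x i z)\<close>, cleared of denominators. Both sides agree at the
  \<open>n\<close> points \<open>1 / x k\<close>, and the terms of degree \<open>n\<close> cancel in their difference.\<close>

lemma partial_fractions:
  fixes x :: "nat \<Rightarrow> 'a::field_char_0"
  assumes x: "good_point n x" and t: "t \<noteq> 0"
  shows "(\<Prod>i<n. [:1, - (inverse t * x i):]) = smult (inverse t ^ n) (\<Prod>i<n. [:1, - x i:])
     + (\<Sum>i<n. smult ((t - 1) * inverse t ^ n * shift_coeff n t x i) (\<Prod>j\<in>{..<n}-{i}. [:1, - x j:]))"
    (is "?L = ?R1 + ?R2")
proof (cases "n = 0")
  case True
  then show ?thesis by simp
next
  case False
  let ?D = "?L - (?R1 + ?R2)"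
  let ?g = "\<lambda>i. (t - 1) * inverse t ^ n * shift_coeff n t x i"
  let ?f = "\<lambda>k i. \<Prod>j\<in>{..<n}-{i}. (x k - x j) / x k"
  have nz: "x i \<noteq> 0" if "i < n" for i using x that by (auto simp: good_point_def)
  have inj: "x i \<noteq> x j" if "i < n" "j < n" "i \<noteq> j" for i j
    using x that by (auto simp: good_point_def inj_on_def)
  have deg: "degree ?D < n"
  proof -
    have "degree ?L = n" "coeff ?L n = (\<Prod>i<n. - (inverse t * x i))"
      using lead_prod_linear[of "{..<n}" "\<lambda>i. - (inverse t * x i)"] nz t by auto
    moreover have "degree (\<Prod>i<n. [:1, - x i:]) = n" "coeff (\<Prod>i<n. [:1, - x i:]) n = (\<Prod>i<n. - x i)"
      using lead_prod_linear[of "{..<n}" "\<lambda>i. - x i"] nz by auto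
    moreover have "(\<Prod>i<n. - (inverse t * x i)) = inverse t ^ n * (\<Prod>i<n. - x i)"
    proof -
      have "(\<Prod>i<n. - (inverse t * x i)) = (\<Prod>i<n. inverse t * (- x i))" by simp
      then show ?thesis by (simp only: prod.distrib) simp
    qed
    ultimately have "degree (?L - ?R1) \<le> n" "coeff (?L - ?R1) n = 0"
      by (auto intro!: degree_diff_le)
    then have "degree (?L - ?R1) < n"
      using False by (rule degree_less_if_coeff_0)
    moreover have "degree ?R2 < n"
    proof -
      have "degree (smult (?g i) (\<Prod>j\<in>{..<n}-{i}. [:1, - x j:])) \<le> n - 1"
        if "i < n" for i
      proof -
        have "degree (\<Prod>j\<in>{..<n}-{i}. [:1, - x j:]) = n - 1"
          using lead_prod_linear[of "{..<n}-{i}" "\<lambda>j. - x j"] nz that by auto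
        then show ?thesis using degree_smult_le by metis
      qed
      then have "degree ?R2 \<le> n - 1" by (intro degree_sum_le) auto
      then show ?thesis using False by simp
    qed
    moreover have "?D = (?L - ?R1) - ?R2" by simp
    ultimately show ?thesis by (simp only: degree_diff_less)
  qed
  have root: "poly ?D (inverse (x k)) = 0" if k: "k < n" for k
  proof -
    have lin: "poly [:1, - c:] (inverse (x k)) = (x k - c) / x k" for c
      using nz[OF k] by (simp add: field_simps)
    have "poly ?L (inverse (x k)) = (\<Prod>i<n. (x k - inverse t * x i) / x k)"
      by (simp only: poly_prod lin)
    also have "\<dots> = ((x k - inverse t * x k) / x k) * (\<Prod>i\<in>{..<n}-{k}. (x k - inverse t * x i) / x k)"
      using k by (subst prod.remove[of _ k]) auto
    also have "(\<Prod>i\<in>{..<n}-{k}. (x k - inverse t * x i) / x k)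
        = (\<Prod>i\<in>{..<n}-{k}. inverse t * ((t * x k - x i) / (x k - x i)) * ((x k - x i) / x k))"
    proof (rule prod.cong[OF refl])
      fix i assume "i \<in> {..<n}-{k}"
      then have "x k - x i \<noteq> 0" using inj[of k i] k by auto
      then show "(x k - inverse t * x i) / x k = inverse t * ((t * x k - x i) / (x k - x i)) * ((x k - x i) / x k)"
        using t nz[OF k] by (simp add: field_simps)
    qed
    also have "\<dots> = inverse t ^ (n - 1) * shift_coeff n t x k * ?f k k"
      using k by (simp only: prod.distrib shift_coeff_def) simp
    also have "(x k - inverse t * x k) / x k = (t - 1) * inverse t"
      using t nz[OF k] by (simp add: field_simps)
    finally have 1: "poly ?L (inverse (x k)) = ?g k * ?f k k"
      using False by (cases n) (simp_all add: algebra_simps)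
    have 2: "poly ?R1 (inverse (x k)) = 0"
    proof -
      have "(\<Prod>i<n. (x k - x i) / x k) = 0" using k by (auto simp: prod_zero_iff)
      then show ?thesis by (simp only: poly_smult poly_prod lin) simp
    qed
    have "poly ?R2 (inverse (x k)) = (\<Sum>i<n. ?g i * ?f k i)"
      by (simp only: poly_sum poly_smult poly_prod lin)
    also have "\<dots> = ?g k * ?f k k
        + (\<Sum>i\<in>{..<n}-{k}. ?g i * ?f k i)"
      using k by (subst sum.remove[of _ k]) auto
    also have "(\<Sum>i\<in>{..<n}-{k}. ?g i * ?f k i) = 0"
    proof (intro sum.neutral ballI)
      fix i assume "i \<in> {..<n}-{k}"
      then have "?f k i = 0" using k by (auto simp: prod_zero_iff)
      then show "?g i * ?f k i = 0" by simp
    qed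
    finally show ?thesis using 1 2 by (simp only: poly_diff poly_add) simp
  qed
  have "?D = 0"
  proof (rule ccontr)
    assume "?D \<noteq> 0"
    have "card ((\<lambda>k. inverse (x k)) ` {..<n}) = n"
      by (subst card_image) (auto simp: inj_on_def dest: inj)
    moreover have "(\<lambda>k. inverse (x k)) ` {..<n} \<subseteq> {z. poly ?D z = 0}" using root by auto
    then have "card ((\<lambda>k. inverse (x k)) ` {..<n}) \<le> card {z. poly ?D z = 0}"
      by (rule card_mono[OF poly_roots_finite[OF \<open>?D \<noteq> 0\<close>]])
    moreover have "card {z. poly ?D z = 0} \<le> degree ?D"
      by (rule card_poly_roots_bound[OF \<open>?D \<noteq> 0\<close>])
    ultimately show False using deg by simp
  qed
  then show ?thesis by simp
qed

text \<open>The generating function of the left-hand sides is the rational function expanded in \<open>partial_fractions\<close>, and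
  \<open>hsum_power_sums\<close> identifies it with the generating function of the \<open>hsum\<close>. The case \<open>r = 0\<close> absorbs the constant of
  the partial fraction expansion.\<close>

lemma shift_coeff_moments:
  fixes x :: "nat \<Rightarrow> 'a::field_char_0"
  assumes x: "good_point n x" and t: "t \<noteq> 0"
  shows "(t - 1) * (\<Sum>i<n. shift_coeff n t x i * x i ^ r) + (if r = 0 then 1 else 0)
    = t ^ n * hsum (\<lambda>k. (1 - inverse t ^ k) * (\<Sum>i<n. x i ^ k)) r"
proof -
  let ?P = "fps_of_poly (\<Prod>i<n. [:1, - x i:])"
  let ?H = "Abs_fps (hsum (\<lambda>k. (1 - inverse t ^ k) * (\<Sum>i<n. x i ^ k)))"
  let ?g = "\<lambda>i. (t - 1) * inverse t ^ n * shift_coeff n t x i"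
  let ?R = "fps_const (inverse t ^ n) + (\<Sum>i<n. fps_const (?g i) * geom_fps (x i))"
  have P: "fps_of_poly (\<Prod>j\<in>{..<n}-{i}. [:1, - x j:]) = ?P * geom_fps (x i)" if "i < n" for i
  proof -
    have "?P * geom_fps (x i) = fps_of_poly (\<Prod>j\<in>{..<n}-{i}. [:1, - x j:]) * (fps_of_poly [:1, - x i:] * geom_fps (x i))"
      using that by (subst prod.remove[of _ i]) (simp_all only: fps_of_poly_mult mult.assoc mult.commute mult.left_commute finite_lessThan lessThan_iff)
    then show ?thesis by (simp only: linear_times_geom_fps mult_1_right)
  qed
  have "?H * ?P = fps_of_poly (\<Prod>i<n. [:1, - (inverse t * x i):])"
    by (rule hsum_power_sums)
  also have "\<dots> = fps_const (inverse t ^ n) * ?P + (\<Sum>i<n. fps_const (?g i) * fps_of_poly (\<Prod>j\<in>{..<n}-{i}. [:1, - x j:]))"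
    by (simp only: partial_fractions[OF x t] fps_of_poly_add fps_of_poly_smult fps_of_poly_sum)
  also have "\<dots> = (?R) * ?P"
    by (simp add: P distrib_right sum_distrib_right mult.assoc mult.commute[of ?P])
  finally have "?H * ?P = (?R) * ?P" .
  moreover have "?P $ 0 \<noteq> 0" by (simp add: poly_0_coeff_0[symmetric] poly_prod)
  then have "?P \<noteq> 0" by (metis fps_zero_nth)
  ultimately have "?H = ?R"
    by simp
  then have "?H $ r = (?R) $ r"
    by (rule arg_cong)
  then have "hsum (\<lambda>k. (1 - inverse t ^ k) * (\<Sum>i<n. x i ^ k)) r
     = (if r = 0 then inverse t ^ n else 0) + (\<Sum>i<n. ?g i * x i ^ r)"
    by (simp add: fps_sum_nth geom_fps_def)
  then have "t ^ n * hsum (\<lambda>k. (1 - inverse t ^ k) * (\<Sum>i<n. x i ^ k)) r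
     = (if r = 0 then t ^ n * inverse t ^ n else 0) + t ^ n * inverse t ^ n * ((t - 1) * (\<Sum>i<n. shift_coeff n t x i * x i ^ r))"
    by (simp add: ring_distribs sum_distrib_left mult.assoc mult.left_commute)
  moreover have "t ^ n * inverse t ^ n = 1" using t by (simp flip: power_mult_distrib)
  ultimately show ?thesis by simp
qed

unbundle no fps_syntax

section \<open>Macdonald's operator on power sums\<close>

lemma weight_mult: "weight (\<lambda>r. a r * b r) M = weight a M * (\<Prod>r\<in>#M. b r)"
  by (simp add: weight_def prod_mset.distrib)

lemma prod_mset_power_sum_mset: "(\<Prod>r\<in>#M. y ^ r) = (y::'a::comm_monoid_mult) ^ sum_mset M"
  by (induction M) (auto simp: power_add)

definition psum_prod :: "nat \<Rightarrow> nat multiset \<Rightarrow> (nat \<Rightarrow> 'a) \<Rightarrow> 'a::field" where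
  "psum_prod n M x = (\<Prod>r\<in>#M. \<Sum>i<n. x i ^ r)"

text \<open>Macdonald's first difference operator, acting on functions of points instead of polynomials. Polynomial
  quotients never occur, since all identities are checked at good points.\<close>

definition mac_op :: "nat \<Rightarrow> 'a \<Rightarrow> 'a \<Rightarrow> ((nat \<Rightarrow> 'a) \<Rightarrow> 'a) \<Rightarrow> (nat \<Rightarrow> 'a) \<Rightarrow> 'a::field" where
  "mac_op n q t F x = (\<Sum>i<n. shift_coeff n t x i * F (x(i := q * x i)))"

text \<open>The matrix of the operator on power sum products, see \<open>mac_op_psum_prod\<close>. It does not depend on the number of
  variables.\<close>

definition trans_coeff :: "'a \<Rightarrow> 'a \<Rightarrow> nat multiset \<Rightarrow> nat multiset \<Rightarrow> 'a::field_char_0" where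
  "trans_coeff q t M N = of_nat (zee M) * (\<Sum>K | K \<subseteq># M \<and> K \<subseteq># N.
     weight (\<lambda>_. 1) K * weight (\<lambda>r. q ^ r - 1) (M - K) * weight (\<lambda>r. 1 - inverse t ^ r) (N - K))"

text \<open>Scaling the variable \<open>x i\<close> by \<open>q\<close> adds \<open>(q ^ r - 1) * x i ^ r\<close> to the \<open>r\<close>-th power sum, so \<open>weight_add\<close> expands
  the product.\<close>

lemma psum_prod_shift:
  fixes x :: "nat \<Rightarrow> 'a::field_char_0"
  assumes "0 \<notin># M" and "i < n"
  shows "psum_prod n M (x(i := q * x i)) = of_nat (zee M) * (\<Sum>K | K \<subseteq># M.
     weight (\<lambda>r. \<Sum>j<n. x j ^ r) K * weight (\<lambda>r. q ^ r - 1) (M - K) * x i ^ sum_mset (M - K))"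
proof -
  have p: "(\<Sum>j<n. (x(i := q * x i)) j ^ r) = (\<Sum>j<n. x j ^ r) + (q ^ r - 1) * x i ^ r" for r
  proof -
    have "(\<Sum>j<n. (x(i := q * x i)) j ^ r) = (\<Sum>j<n. x j ^ r + (if j = i then (q ^ r - 1) * x i ^ r else 0))"
      by (intro sum.cong) (auto simp: algebra_simps power_mult_distrib)
    then show ?thesis using assms(2) by (simp add: sum.distrib)
  qed
  have "psum_prod n M (x(i := q * x i)) = of_nat (zee M) * weight (\<lambda>r. (\<Sum>j<n. x j ^ r) + (q ^ r - 1) * x i ^ r) M"
    using zee_pos[OF assms(1)] by (simp only: psum_prod_def weight_def p) simp
  then show ?thesis
    by (simp only: weight_add[OF assms(1)] weight_mult[where b = "\<lambda>r. x i ^ r"] prod_mset_power_sum_mset mult.assoc)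
qed

text \<open>After the expansion of \<open>psum_prod_shift\<close> the sum over the variables is a moment of the shift coefficients, which
  \<open>shift_coeff_moments\<close> turns into power sums again. Multiplying by \<open>t - 1\<close> and adding the function itself removes the
  dependence on \<open>n\<close> up to the factor \<open>t ^ n\<close>.\<close>

lemma mac_op_psum_prod:
  fixes x :: "nat \<Rightarrow> 'a::field_char_0"
  assumes M: "0 \<notin># M" and x: "good_point n x" and t: "t \<noteq> 0"
  shows "(t - 1) * mac_op n q t (psum_prod n M) x + psum_prod n M x
    = t ^ n * (\<Sum>N\<in>parts (sum_mset M). trans_coeff q t M N * psum_prod n N x)"
proof -
  let ?p = "\<lambda>r. \<Sum>j<n. x j ^ r"
  let ?b = "\<lambda>r. q ^ r - 1"
  let ?c = "\<lambda>r. 1 - inverse t ^ r"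
  let ?z = "of_nat (zee M) :: 'a"
  let ?S = "\<lambda>r. \<Sum>i<n. shift_coeff n t x i * x i ^ r"
  let ?T = "\<lambda>K L. t ^ n * (?z * (weight (\<lambda>_. 1) K * weight ?b (M - K) * weight ?c L) * psum_prod n (K + L) x)"
  let ?U = "\<lambda>N K. t ^ n * (?z * (weight (\<lambda>_. 1) K * weight ?b (M - K) * weight ?c (N - K)) * psum_prod n N x)"
  let ?W = "\<lambda>K. ?z * (weight ?p K * weight ?b (M - K))"
  let ?KL = "SIGMA K:{K. K \<subseteq># M}. parts (sum_mset (M - K))"
  let ?NK = "SIGMA N:parts (sum_mset M). {K. K \<subseteq># M \<and> K \<subseteq># N}"
  have "mac_op n q t (psum_prod n M) x =
      (\<Sum>i<n. \<Sum>K | K \<subseteq># M. ?W K * (shift_coeff n t x i * x i ^ sum_mset (M - K)))"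
    unfolding mac_op_def
    by (intro sum.cong refl) (simp add: psum_prod_shift[OF M] sum_distrib_left algebra_simps)
  also have "\<dots> = (\<Sum>K | K \<subseteq># M. ?W K * ?S (sum_mset (M - K)))"
    by (subst sum.swap) (simp only: sum_distrib_left)
  finally have "(t - 1) * mac_op n q t (psum_prod n M) x
      = (\<Sum>K | K \<subseteq># M. ?W K * ((t - 1) * ?S (sum_mset (M - K))))"
    by (simp only: sum_distrib_left mult.assoc mult.left_commute)
  moreover have "psum_prod n M x = (\<Sum>K | K \<subseteq># M. ?W K * (if sum_mset (M - K) = 0 then 1 else 0))"
  proof -
    have "K = M" if "K \<subseteq># M" "sum_mset (M - K) = 0" for K
    proof -
      have "0 \<notin># M - K" using M by (auto dest: in_diffD)
      then have "M - K = {#}" using size_le_sum_mset[of "M - K"] that(2) by (metis le_zero_eq size_eq_0_iff_empty)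
      then show ?thesis using that(1) by (metis subset_mset.add_diff_inverse add.right_neutral)
    qed
    then have "(\<Sum>K | K \<subseteq># M. ?W K * (if sum_mset (M - K) = 0 then 1 else 0))
       = (\<Sum>K | K \<subseteq># M. if K = M then ?z * weight ?p M else 0)"
      by (intro sum.cong refl) auto
    also have "\<dots> = ?z * weight ?p M" by (simp add: sum.delta)
    finally show ?thesis using zee_pos[OF M] by (simp add: weight_def psum_prod_def)
  qed
  ultimately have "(t - 1) * mac_op n q t (psum_prod n M) x + psum_prod n M x
     = (\<Sum>K | K \<subseteq># M. ?W K *
          ((t - 1) * ?S (sum_mset (M - K)) + (if sum_mset (M - K) = 0 then 1 else 0)))"
    by (simp only: sum.distrib[symmetric] distrib_left[symmetric])
  also have "\<dots> = (\<Sum>K | K \<subseteq># M. ?W K *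
      (t ^ n * hsum (\<lambda>k. ?c k * ?p k) (sum_mset (M - K))))"
    by (simp only: shift_coeff_moments[OF x t])
  also have "\<dots> = (\<Sum>K | K \<subseteq># M. \<Sum>L\<in>parts (sum_mset (M - K)).
      ?T K L)"
  proof (rule sum.cong[OF refl])
    fix K
    have "weight ?p K = weight (\<lambda>_. 1) K * psum_prod n K x"
      using weight_mult[of "\<lambda>_. 1" ?p K] by (simp add: psum_prod_def)
    moreover have "weight (\<lambda>k. ?c k * ?p k) L = weight ?c L * psum_prod n L x" for L
      by (simp only: weight_mult psum_prod_def)
    moreover have "psum_prod n (K + L) x = psum_prod n K x * psum_prod n L x" for L
      by (simp add: psum_prod_def)
    ultimately show "?W K * (t ^ n * hsum (\<lambda>k. ?c k * ?p k) (sum_mset (M - K)))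
       = (\<Sum>L\<in>parts (sum_mset (M - K)).
      ?T K L)"
      by (simp only: hsum_def sum_distrib_left mult.assoc mult.left_commute mult.commute)
  qed
  also have "\<dots> = (\<Sum>(K, L)\<in>?KL.
      ?T K L)"
    by (rule sum.Sigma) auto
  also have "\<dots> = (\<Sum>(N, K)\<in>?NK.
      ?U N K)"
  proof (rule sum.reindex_bij_witness[of _ "\<lambda>(N, K). (K, N - K)" "\<lambda>(K, L). (K + L, K)"])
    fix a assume "a \<in> ?KL"
    then obtain K L where a: "a = (K, L)" "K \<subseteq># M" "L \<in> parts (sum_mset (M - K))" by auto
    then obtain D where D: "M = K + D" by (metis subset_mset.add_diff_inverse)
    show "(case (case a of (K, L) \<Rightarrow> (K + L, K)) of (N, K) \<Rightarrow> (K, N - K)) = a"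
      "(case a of (K, L) \<Rightarrow> (K + L, K)) \<in> ?NK"
      using a D M by (auto simp: parts_def)
    show "(case case a of (K, L) \<Rightarrow> (K + L, K) of (N, K) \<Rightarrow>
        ?U N K) =
      (case a of (K, L) \<Rightarrow>
        ?T K L)"
      using a by simp
  next
    fix b assume "b \<in> ?NK"
    then obtain N K where b: "b = (N, K)" "K \<subseteq># M" "K \<subseteq># N" "N \<in> parts (sum_mset M)" by auto
    then obtain D D' where D: "M = K + D" "N = K + D'" by (metis subset_mset.add_diff_inverse)
    show "(case case b of (N, K) \<Rightarrow> (K, N - K) of (K, L) \<Rightarrow> (K + L, K)) = b"
      "(case b of (N, K) \<Rightarrow> (K, N - K)) \<in> ?KL"
      using b D by (auto simp: parts_def)
  qed
  also have "\<dots> = (\<Sum>N\<in>parts (sum_mset M). \<Sum>K | K \<subseteq># M \<and> K \<subseteq># N.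
      ?U N K)"
    by (rule sum.Sigma[symmetric]) (auto intro: finite_subset[OF _ finite_subset_msets[of M]])
  finally show ?thesis
    by (simp only: trans_coeff_def sum_distrib_left sum_distrib_right)
qed

definition qt_norm_mset :: "'a \<Rightarrow> 'a \<Rightarrow> nat multiset \<Rightarrow> 'a::field_char_0" where
  "qt_norm_mset q t M = of_nat (zee M) * (\<Prod>r\<in>#M. (1 - q ^ r) / (1 - t ^ r))"

text \<open>The norm of a part \<open>r\<close> turns \<open>1 - inverse t ^ r\<close> into \<open>(q ^ r - 1) * inverse t ^ r\<close>. The two kinds of factors in
  \<open>trans_coeff\<close> thereby become equal, up to a power of \<open>t\<close> that depends on degrees only, and the right-hand side is
  symmetric in \<open>M\<close> and \<open>N\<close> when their sums agree.\<close>

lemma trans_coeff_times_norm: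
  assumes N: "0 \<notin># N" and t: "t \<noteq> 0" "\<And>r. r > 0 \<Longrightarrow> t ^ r \<noteq> 1"
  shows "trans_coeff q t M N * qt_norm_mset q t N = of_nat (zee M) * of_nat (zee N) *
    (\<Sum>K | K \<subseteq># M \<and> K \<subseteq># N. weight (\<lambda>r. (1 - q ^ r) / (1 - t ^ r)) K
       * (weight (\<lambda>r. q ^ r - 1) (M - K) * weight (\<lambda>r. q ^ r - 1) (N - K))
       * inverse t ^ (sum_mset N - sum_mset K))"
proof -
  let ?n = "\<lambda>r. (1 - q ^ r) / (1 - t ^ r)"
  let ?b = "\<lambda>r. q ^ r - 1" and ?c = "\<lambda>r. 1 - inverse t ^ r"
  let ?e = "\<lambda>K. inverse t ^ (sum_mset N - sum_mset K)"
  have "weight (\<lambda>_. 1) K * weight ?b (M - K) * weight ?c (N - K) * (\<Prod>r\<in>#N. ?n r)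
     = weight ?n K * (weight ?b (M - K) * weight ?b (N - K))
       * ?e K" if K: "K \<subseteq># N" for K
  proof -
    obtain D where D: "N = K + D" using K by (metis subset_mset.add_diff_inverse)
    have 1: "weight ?n K = weight (\<lambda>_. 1) K * (\<Prod>r\<in>#K. ?n r)"
      using weight_mult[of "\<lambda>_. 1" ?n K] by simp
    have "weight ?c D * (\<Prod>r\<in>#D. ?n r) = weight (\<lambda>r. (1 - inverse t ^ r) * ?n r) D"
      by (simp only: weight_mult)
    also have "\<dots> = weight (\<lambda>r. (q ^ r - 1) * inverse t ^ r) D"
      unfolding weight_def
    proof (intro arg_cong2[of _ _ _ _ "(/)"] refl arg_cong[of _ _ prod_mset] image_mset_cong)
      fix r assume "r \<in># D"
      then have "r > 0" using N D by (cases r) auto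
      then have "1 - t ^ r \<noteq> 0" using t(2)[of r] by auto
      moreover have "1 - inverse t ^ r = - (inverse t ^ r) * (1 - t ^ r)"
        using t(1) by (simp add: algebra_simps flip: power_mult_distrib)
      ultimately have "(1 - inverse t ^ r) * ?n r = - (inverse t ^ r) * (1 - q ^ r)"
        by (simp only:) simp
      then show "(1 - inverse t ^ r) * ?n r = (q ^ r - 1) * inverse t ^ r"
        by (simp add: algebra_simps)
    qed
    also have "\<dots> = weight ?b D * inverse t ^ sum_mset D"
      by (simp only: weight_mult prod_mset_power_sum_mset)
    finally have 2: "weight ?c D * (\<Prod>r\<in>#D. ?n r) = weight ?b D * inverse t ^ sum_mset D" .
    have "weight (\<lambda>_. 1) K * weight ?b (M - K) * weight ?c (N - K) * (\<Prod>r\<in>#N. ?n r)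
      = (weight (\<lambda>_. 1) K * (\<Prod>r\<in>#K. ?n r)) * weight ?b (M - K) * (weight ?c D * (\<Prod>r\<in>#D. ?n r))"
      by (simp add: D)
    also have "\<dots> = weight ?n K * weight ?b (M - K) * (weight ?b D * inverse t ^ sum_mset D)"
      by (simp only: 1 2)
    finally show ?thesis by (simp add: D mult.assoc)
  qed
  then have "(\<Sum>K | K \<subseteq># M \<and> K \<subseteq># N. weight (\<lambda>_. 1) K * weight ?b (M - K) * weight ?c (N - K)) * (\<Prod>r\<in>#N. ?n r)
    = (\<Sum>K | K \<subseteq># M \<and> K \<subseteq># N. weight ?n K * (weight ?b (M - K) * weight ?b (N - K))
       * ?e K)" (is "?S * ?P = ?T")
    unfolding sum_distrib_right by (intro sum.cong refl) blast
  moreover have "trans_coeff q t M N * qt_norm_mset q t N = of_nat (zee M) * of_nat (zee N) * (?S * ?P)"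
    unfolding trans_coeff_def qt_norm_mset_def by (simp only: mult.assoc mult.commute mult.left_commute)
  ultimately show ?thesis by (simp only:)
qed

lemma trans_coeff_selfadjoint:
  assumes "M \<in> parts d" and "N \<in> parts d" and t: "t \<noteq> 0" "\<And>r. r > 0 \<Longrightarrow> t ^ r \<noteq> 1"
  shows "trans_coeff q t M N * qt_norm_mset q t N = trans_coeff q t N M * qt_norm_mset q t M"
proof -
  have M: "0 \<notin># M" "sum_mset M = d" and N: "0 \<notin># N" "sum_mset N = d"
    using assms by (auto simp: parts_def)
  have "{K. K \<subseteq># N \<and> K \<subseteq># M} = {K. K \<subseteq># M \<and> K \<subseteq># N}" by blast
  then show ?thesis
    using trans_coeff_times_norm[OF N(1) t, of q M] trans_coeff_times_norm[OF M(1) t, of q N]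
    by (simp add: M(2) N(2) mult.commute)
qed

section \<open>Symmetric series in coordinates\<close>

abbreviation expo :: "(nat \<Rightarrow>\<^sub>0 nat) \<Rightarrow> nat \<Rightarrow> nat" where
  "expo \<equiv> Poly_Mapping.lookup"

abbreviation supp :: "(nat \<Rightarrow>\<^sub>0 nat) \<Rightarrow> nat set" where
  "supp \<equiv> Poly_Mapping.keys"

text \<open>The multiset of the nonzero exponents of a monomial. A symmetric series is a function of it, so \<open>sym_series\<close> takes the
  coordinates of a symmetric function in the monomial basis to the series itself.\<close>

definition mono_type :: "(nat \<Rightarrow>\<^sub>0 nat) \<Rightarrow> nat multiset" where
  "mono_type \<alpha> = image_mset (expo \<alpha>) (mset_set (supp \<alpha>))"

definition sym_series :: "(nat multiset \<Rightarrow> 'a) \<Rightarrow> 'a::field series" where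
  "sym_series v = (\<lambda>\<alpha>. v (mono_type \<alpha>))"

definition homogeneous :: "nat \<Rightarrow> (nat multiset \<Rightarrow> 'a::zero) \<Rightarrow> bool" where
  "homogeneous d v \<longleftrightarrow> (\<forall>N. v N \<noteq> 0 \<longrightarrow> N \<in> parts d)"

lemma filter_mset_nonzero: "0 \<notin># X \<Longrightarrow> filter_mset (\<lambda>a. a \<noteq> 0) X = X"
  by (induction X) auto

lemma mono_type_superset:
  assumes "finite A" and "supp \<alpha> \<subseteq> A"
  shows "mono_type \<alpha> = filter_mset (\<lambda>a. a \<noteq> 0) (image_mset (expo \<alpha>) (mset_set A))"
proof -
  have "{i\<in>A. expo \<alpha> i \<noteq> 0} = supp \<alpha>"
    using assms(2) by (auto simp: in_keys_iff)
  then show ?thesis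
    using assms(1) by (simp add: mono_type_def filter_mset_image_mset filter_mset_mset_set comp_def)
qed

lemma image_mset_mono_type:
  "image_mset f (mono_type \<alpha>) = image_mset (\<lambda>i. f (expo \<alpha> i)) (mset_set (supp \<alpha>))"
  by (simp add: mono_type_def multiset.map_comp comp_def)

lemma zero_notin_mono_type [simp]: "0 \<notin># mono_type \<alpha>"
  by (auto simp: mono_type_def in_keys_iff)

lemma mono_type_nth: "0 \<notin> set xs \<Longrightarrow> mono_type (Poly_Mapping.nth xs) = mset xs"
proof -
  assume xs: "0 \<notin> set xs"
  have "mono_type (Poly_Mapping.nth xs) = filter_mset (\<lambda>a. a \<noteq> 0)
     (image_mset (expo (Poly_Mapping.nth xs)) (mset_set {..<length xs}))"
  proof (rule mono_type_superset)
    show "supp (Poly_Mapping.nth xs) \<subseteq> {..<length xs}"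
      by (auto simp: in_keys_iff nth_default_def simp del: keys_nth split: if_splits)
  qed simp
  also have "image_mset (expo (Poly_Mapping.nth xs)) (mset_set {..<length xs})
     = image_mset ((!) xs) (mset_set {..<length xs})"
    by (intro image_mset_cong) (auto simp: nth_default_nth)
  also have "\<dots> = mset xs"
    by (metis map_nth mset_map mset_upt atLeast0LessThan)
  also have "filter_mset (\<lambda>a. a \<noteq> 0) (mset xs) = mset xs"
    using xs by (intro filter_mset_nonzero) auto
  finally show ?thesis .
qed

text \<open>The partition that belongs to a multiset; inverse to \<open>mset\<close> on partitions.\<close>

definition part_list :: "nat multiset \<Rightarrow> nat list" where
  "part_list M = rev (sorted_list_of_multiset M)"

lemma mset_part_list [simp]: "mset (part_list M) = M"
  by (simp add: part_list_def)

lemma set_part_list [simp]: "set (part_list M) = set_mset M"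
  by (metis mset_part_list set_mset_mset)

lemma length_part_list [simp]: "length (part_list M) = size M"
  by (metis mset_part_list size_mset)

lemma sum_list_part_list [simp]: "sum_list (part_list M) = sum_mset M"
  by (metis mset_part_list sum_mset_sum_list)

lemma sorted_part_list: "sorted_wrt (\<ge>) (part_list M)"
  by (simp add: part_list_def sorted_wrt_rev)

lemma part_list_mset: "is_partition \<nu> \<Longrightarrow> part_list (mset \<nu>) = \<nu>"
proof -
  assume "is_partition \<nu>"
  then have "sorted (rev \<nu>)" by (simp add: is_partition_def sorted_wrt_rev)
  then have "sort \<nu> = rev \<nu>" by (intro properties_for_sort) simp_all
  then show ?thesis by (simp add: part_list_def)
qed

lemma is_partition_part_list: "0 \<notin># M \<Longrightarrow> is_partition (part_list M)"
  by (simp add: is_partition_def sorted_part_list)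

lemma mono_type_surj: "0 \<notin># M \<Longrightarrow> \<exists>\<alpha>. mono_type \<alpha> = M"
  using mono_type_nth[of "part_list M"] by auto

section \<open>Multiplication by a power sum\<close>

text \<open>Multiplication by the \<open>r\<close>-th power sum in monomial coordinates: the coefficient at a monomial collects the
  coefficients of all monomials that arise from it by lowering one exponent by \<open>r\<close>.\<close>

definition raise :: "nat \<Rightarrow> (nat multiset \<Rightarrow> 'a) \<Rightarrow> nat multiset \<Rightarrow> 'a::field_char_0" where
  "raise r v N = (\<Sum>a\<in>#N. if r \<le> a then v (N - {#a#} + (if a = r then {#} else {#a - r#})) else 0)"

lemma mono_type_minus_single:
  assumes "i \<in> supp \<alpha>"
  shows "mono_type (\<alpha> - Poly_Mapping.single i r) = mono_type \<alpha> - {#expo \<alpha> i#}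
     + (if expo \<alpha> i \<le> r then {#} else {#expo \<alpha> i - r#})"
proof -
  let ?K = "supp \<alpha>" and ?\<beta> = "\<alpha> - Poly_Mapping.single i r"
  let ?a = "expo \<alpha> i"
  have K: "mset_set ?K = add_mset i (mset_set (?K - {i}))"
    using assms by (simp add: mset_set.remove)
  have l: "expo ?\<beta> j = expo \<alpha> j - (if j = i then r else 0)" for j
    by (simp add: lookup_minus lookup_single when_def)
  then have "supp ?\<beta> \<subseteq> ?K" by (auto simp: in_keys_iff)
  then have "mono_type ?\<beta> = filter_mset (\<lambda>a. a \<noteq> 0) (image_mset (expo ?\<beta>) (mset_set ?K))"
    by (intro mono_type_superset) auto
  also have "\<dots> = filter_mset (\<lambda>a. a \<noteq> 0) (add_mset (?a - r)
      (image_mset (expo ?\<beta>) (mset_set (?K - {i}))))"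
    by (simp add: K l)
  also have "image_mset (expo ?\<beta>) (mset_set (?K - {i}))
      = image_mset (expo \<alpha>) (mset_set (?K - {i}))"
    by (intro image_mset_cong) (auto simp: l)
  also have "\<dots> = mono_type \<alpha> - {#?a#}"
    by (simp add: mono_type_def K)
  also have "filter_mset (\<lambda>a. a \<noteq> 0) (add_mset (?a - r) (mono_type \<alpha> - {#?a#}))
     = (mono_type \<alpha> - {#?a#}) + (if ?a \<le> r then {#} else {#?a - r#})"
  proof -
    have "filter_mset (\<lambda>a. a \<noteq> 0) (mono_type \<alpha> - {#?a#}) = mono_type \<alpha> - {#?a#}"
      by (rule filter_mset_nonzero) (metis in_diffD zero_notin_mono_type)
    then show ?thesis by (cases "?a \<le> r") (simp_all only: filter_mset_add_mset, simp_all)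
  qed
  finally show ?thesis .
qed

lemma raise_mono_type:
  assumes "r > 0"
  shows "raise r v (mono_type \<alpha>) =
     (\<Sum>i | r \<le> expo \<alpha> i. v (mono_type (\<alpha> - Poly_Mapping.single i r)))"
proof -
  let ?l = "expo \<alpha>"
  let ?g = "\<lambda>a. if r \<le> a then v (mono_type \<alpha> - {#a#} + (if a = r then {#} else {#a - r#})) else 0"
  have "raise r v (mono_type \<alpha>) = (\<Sum>i\<in>supp \<alpha>. ?g (?l i))"
    by (simp only: raise_def image_mset_mono_type sum_unfold_sum_mset)
  also have "\<dots> = (\<Sum>i\<in>supp \<alpha>. if r \<le> ?l i then v (mono_type (\<alpha> - Poly_Mapping.single i r)) else 0)"
    by (intro sum.cong refl) (auto simp: mono_type_minus_single)
  also have "\<dots> = (\<Sum>i | i \<in> supp \<alpha> \<and> r \<le> ?l i. v (mono_type (\<alpha> - Poly_Mapping.single i r)))"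
    by (simp add: sum.inter_filter)
  also have "{i. i \<in> supp \<alpha> \<and> r \<le> ?l i} = {i. r \<le> ?l i}"
    using assms by (auto simp: in_keys_iff)
  finally show ?thesis .
qed

text \<open>Without this the sum in \<open>series_mult\<close> would be \<open>0\<close> by convention.\<close>

lemma finite_factorisations: "finite {(\<beta>, \<gamma>). \<beta> + \<gamma> = (\<alpha> :: nat \<Rightarrow>\<^sub>0 nat)}"
proof (rule inj_on_finite)
  let ?f = "\<lambda>(\<beta>, \<gamma>::nat \<Rightarrow>\<^sub>0 nat). restrict (expo (\<beta> :: nat \<Rightarrow>\<^sub>0 nat)) (supp \<alpha>)"
  show "inj_on ?f {(\<beta>, \<gamma>). \<beta> + \<gamma> = \<alpha>}"
  proof (rule inj_onI; clarify)
    fix \<beta> \<gamma> \<beta>' \<gamma>' :: "nat \<Rightarrow>\<^sub>0 nat"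
    assume a: "\<alpha> = \<beta> + \<gamma>" "\<beta>' + \<gamma>' = \<beta> + \<gamma>"
      and eq: "restrict (expo \<beta>) (supp (\<beta> + \<gamma>)) = restrict (expo \<beta>') (supp (\<beta> + \<gamma>))"
    have "expo \<beta> i = expo \<beta>' i" for i
    proof (cases "i \<in> supp (\<beta> + \<gamma>)")
      case True
      then show ?thesis using fun_cong[OF eq, of i] by simp
    next
      case False
      then have "expo (\<beta> + \<gamma>) i = 0" "expo (\<beta>' + \<gamma>') i = 0"
        using a(2) by (simp_all add: in_keys_iff)
      then show ?thesis by (simp add: lookup_add)
    qed
    then have "\<beta> = \<beta>'" by (intro poly_mapping_eqI)
    then show "\<beta> = \<beta>' \<and> \<gamma> = \<gamma>'" using a by simp
  qed
  show "?f ` {(\<beta>, \<gamma>). \<beta> + \<gamma> = \<alpha>} \<subseteq> (\<Pi>\<^sub>E i\<in>supp \<alpha>. {..expo \<alpha> i})"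
    by (auto simp: lookup_add)
  show "finite (\<Pi>\<^sub>E i\<in>supp \<alpha>. {..expo \<alpha> i})"
    by (intro finite_PiE) auto
qed

lemma minus_single_plus_single:
  assumes "r \<le> expo \<alpha> i"
  shows "Poly_Mapping.single i r + (\<alpha> - Poly_Mapping.single i r) = (\<alpha> :: nat \<Rightarrow>\<^sub>0 nat)"
  using assms by (intro poly_mapping_eqI) (auto simp: lookup_add lookup_minus lookup_single when_def)

lemma series_mult_power_sum:
  assumes "r > 0"
  shows "series_mult (power_sum r) (sym_series v) = sym_series (raise r v)"
proof
  fix \<alpha> :: "nat \<Rightarrow>\<^sub>0 nat"
  have "series_mult (power_sum r) (sym_series v) \<alpha>
    = (\<Sum>(\<beta>, \<gamma>) \<in> {(\<beta>, \<gamma>). \<beta> + \<gamma> = \<alpha> \<and> (\<exists>i. \<beta> = Poly_Mapping.single i r)}. v (mono_type \<gamma>))"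
    unfolding series_mult_def
    by (rule sum.mono_neutral_cong_right) (auto simp: finite_factorisations power_sum_def sym_series_def split: if_splits)
  also have "\<dots> = (\<Sum>i | r \<le> expo \<alpha> i. v (mono_type (\<alpha> - Poly_Mapping.single i r)))"
  proof (rule sum.reindex_bij_betw[symmetric, where h = "\<lambda>i. (Poly_Mapping.single i r, \<alpha> - Poly_Mapping.single i r)"
        and g = "\<lambda>(\<beta>, \<gamma>). v (mono_type \<gamma>)", simplified case_prod_conv])
    let ?h = "\<lambda>i. (Poly_Mapping.single i r, \<alpha> - Poly_Mapping.single i r)"
    have "inj_on ?h {i. r \<le> expo \<alpha> i}"
    proof (rule inj_onI)
      fix i j assume "?h i = ?h j"
      then have "supp (Poly_Mapping.single i r) = supp (Poly_Mapping.single j r)" by simp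
      then show "i = j" using assms by simp
    qed
    moreover have "?h ` {i. r \<le> expo \<alpha> i} = {(\<beta>, \<gamma>). \<beta> + \<gamma> = \<alpha> \<and> (\<exists>i. \<beta> = Poly_Mapping.single i r)}"
    proof (intro equalityI subsetI)
      fix p assume "p \<in> {(\<beta>, \<gamma>). \<beta> + \<gamma> = \<alpha> \<and> (\<exists>i. \<beta> = Poly_Mapping.single i r)}"
      then obtain i \<gamma> where p: "p = (Poly_Mapping.single i r, \<gamma>)" "Poly_Mapping.single i r + \<gamma> = \<alpha>" by auto
      then have "p = ?h i" by auto
      moreover have "r \<le> expo \<alpha> i" unfolding p(2)[symmetric] by (simp add: lookup_add)
      ultimately show "p \<in> ?h ` {i. r \<le> expo \<alpha> i}" by blast
    qed (auto simp: minus_single_plus_single)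
    ultimately show "bij_betw ?h {i. r \<le> expo \<alpha> i} {(\<beta>, \<gamma>). \<beta> + \<gamma> = \<alpha> \<and> (\<exists>i. \<beta> = Poly_Mapping.single i r)}"
      by (simp add: bij_betw_def)
  qed
  also have "\<dots> = sym_series (raise r v) \<alpha>"
    by (simp add: sym_series_def raise_mono_type[OF assms])
  finally show "series_mult (power_sum r) (sym_series v) \<alpha> = sym_series (raise r v) \<alpha>" .
qed

primrec psum_coords :: "nat list \<Rightarrow> nat multiset \<Rightarrow> 'a::field_char_0" where
  "psum_coords [] = (\<lambda>N. if N = {#} then 1 else 0)"
| "psum_coords (r # \<rho>) = raise r (psum_coords \<rho>)"

lemma power_sum_prod_eq_sym_series:
  "0 \<notin> set \<rho> \<Longrightarrow> power_sum_prod \<rho> = (sym_series (psum_coords \<rho>) :: 'a::field_char_0 series)"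
proof (induction \<rho>)
  case Nil
  show ?case by (rule ext) (auto simp: power_sum_prod_def series_one_def sym_series_def mono_type_def mset_set_empty_iff)
next
  case (Cons r \<rho>)
  then have "power_sum_prod (r # \<rho>) = series_mult (power_sum r) (sym_series (psum_coords \<rho>) :: 'a series)"
    by (simp add: power_sum_prod_def)
  then show ?case using Cons by (simp add: series_mult_power_sum)
qed

lemma raise_nonzero:
  assumes "raise r v N \<noteq> 0"
  obtains a where "a \<in># N" "r \<le> a" "v (N - {#a#} + (if a = r then {#} else {#a - r#})) \<noteq> 0"
proof -
  have "\<exists>a\<in>#N. (if r \<le> a then v (N - {#a#} + (if a = r then {#} else {#a - r#})) else 0) \<noteq> 0"
  proof (rule ccontr)
    assume "\<not> ?thesis"
    then have "raise r v N = (\<Sum>a\<in>#N. 0)"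
      unfolding raise_def by (intro arg_cong[of _ _ sum_mset] image_mset_cong) blast
    with assms show False by simp
  qed
  then show ?thesis using that by (metis (no_types, lifting))
qed

text \<open>Each multiplication by a power sum either appends a new part or enlarges an existing one, so only the monomial in which
  no two factors share a variable has full length.\<close>

lemma psum_coords_support:
  assumes "0 \<notin> set \<rho>" and "psum_coords \<rho> N \<noteq> (0::'a::field_char_0)"
  shows "N \<in> parts (sum_list \<rho>)" and "N = mset \<rho> \<or> size N < length \<rho>"
proof -
  have "N \<in> parts (sum_list \<rho>) \<and> (N = mset \<rho> \<or> size N < length \<rho>)"
    using assms
  proof (induction \<rho> arbitrary: N)
    case Nil
    then show ?case by (auto split: if_splits)
  next
    case (Cons r \<rho>)
    from Cons.prems(2) have "raise r (psum_coords \<rho>) N \<noteq> (0::'a)" by simp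
    then obtain a where a: "a \<in># N" "r \<le> a"
      and nz: "psum_coords \<rho> (N - {#a#} + (if a = r then {#} else {#a - r#})) \<noteq> (0::'a)"
      by (rule raise_nonzero)
    then obtain N' where N': "N = add_mset a N'" by (metis multi_member_split)
    have "r > 0" "0 \<notin> set \<rho>" using Cons.prems(1) by auto
    have *: "N' + (if a = r then {#} else {#a - r#}) = mset \<rho> \<or> size (N' + (if a = r then {#} else {#a - r#})) < length \<rho>"
      "N' + (if a = r then {#} else {#a - r#}) \<in> parts (sum_list \<rho>)"
      using Cons.IH[OF \<open>0 \<notin> set \<rho>\<close> nz] N' by auto
    have "N = mset (r # \<rho>) \<or> size N < length (r # \<rho>)"
    proof (cases "a = r")
      case True
      then show ?thesis using * N' by auto
    next
      case False
      then have "size N = size (N' + (if a = r then {#} else {#a - r#}))" using N' by simp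
      also have "\<dots> \<le> length \<rho>" using *(1) by (metis less_imp_le order_refl size_mset)
      finally show ?thesis by simp
    qed
    moreover have "N \<in> parts (sum_list (r # \<rho>))"
      using *(2) N' a(2) \<open>r > 0\<close> by (auto simp: parts_def split: if_splits)
    ultimately show ?case by blast
  qed
  then show "N \<in> parts (sum_list \<rho>)" and "N = mset \<rho> \<or> size N < length \<rho>" by auto
qed

text \<open>By \<open>psum_coords_support\<close> only the terms that delete a part \<open>r\<close> contribute, and there are as many as the multiplicity
  of \<open>r\<close>; characteristic \<open>0\<close> enters here.\<close>

lemma psum_coords_diag: "0 \<notin> set \<rho> \<Longrightarrow> psum_coords \<rho> (mset \<rho>) \<noteq> (0::'a::field_char_0)"
proof (induction \<rho>)
  case Nil
  then show ?case by simp
next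
  case (Cons r \<rho>)
  let ?N = "mset (r # \<rho>)"
  have "psum_coords (r # \<rho>) ?N = (\<Sum>a\<in>#?N. if a = r then psum_coords \<rho> (mset \<rho>) else (0::'a))"
    unfolding psum_coords.simps raise_def
  proof (intro arg_cong[of _ _ sum_mset] image_mset_cong)
    fix a assume a: "a \<in># ?N"
    have "psum_coords \<rho> (?N - {#a#} + {#a - r#}) = (0::'a)" if "a \<noteq> r" "r \<le> a"
    proof (rule ccontr)
      assume nz: "psum_coords \<rho> (?N - {#a#} + {#a - r#}) \<noteq> (0::'a)"
      have "size (?N - {#a#} + {#a - r#}) = Suc (length \<rho>)"
        using a by (auto simp: size_Diff_singleton_if)
      with psum_coords_support(2)[OF _ nz] Cons.prems show False
        by (metis list.set_intros(2) size_mset lessI not_less_iff_gr_or_eq n_not_Suc_n)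
    qed
    then show "(if r \<le> a then psum_coords \<rho> (?N - {#a#} + (if a = r then {#} else {#a - r#})) else 0)
      = (if a = r then psum_coords \<rho> (mset \<rho>) else (0::'a))"
      by auto
  qed
  also have "\<dots> = of_nat (count ?N r) * psum_coords \<rho> (mset \<rho>)"
    by (simp only: sum_mset_delta mult.commute)
  finally have *: "psum_coords (r # \<rho>) ?N = of_nat (count ?N r) * (psum_coords \<rho> (mset \<rho>) :: 'a)" .
  have "of_nat (count ?N r) \<noteq> (0::'a)" by (simp only: of_nat_eq_0_iff) simp
  then show ?case using * Cons by (simp only: mult_eq_0_iff) simp
qed

section \<open>The power sum basis\<close>

text \<open>The power sum products, in monomial coordinates.\<close>

definition pvec :: "nat multiset \<Rightarrow> nat multiset \<Rightarrow> 'a::field_char_0" where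
  "pvec M = psum_coords (part_list M)"

lemma pvec_support:
  assumes "0 \<notin># M" and "pvec M N \<noteq> 0"
  shows "N \<in> parts (sum_mset M)" and "N = M \<or> size N < size M"
  using psum_coords_support[of "part_list M" N] assms by (auto simp: pvec_def)

lemma pvec_diag: "0 \<notin># M \<Longrightarrow> pvec M M \<noteq> 0"
  using psum_coords_diag[of "part_list M"] by (simp add: pvec_def)

lemma power_sum_prod_pvec: "is_partition \<rho> \<Longrightarrow> power_sum_prod \<rho> = sym_series (pvec (mset \<rho>))"
  by (simp add: pvec_def part_list_mset power_sum_prod_eq_sym_series is_partition_def)

text \<open>The transition matrix is triangular with respect to the number of parts.\<close>

lemma power_sum_basis:
  fixes v :: "nat multiset \<Rightarrow> 'a::field_char_0"
  assumes "homogeneous d v"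
  shows "\<exists>a. homogeneous d a \<and> (\<forall>N. v N = (\<Sum>M\<in>parts d. a M * pvec M N))"
  unfolding homogeneous_def
proof (rule triangular_span[where R = "\<lambda>M N. size M < size N"])
  show "N = M \<or> N \<in> parts d \<and> size N < size M" if "M \<in> parts d" "pvec M N \<noteq> (0::'a)" for M N
    using pvec_support[OF _ that(2)] that(1) by (auto simp: parts_def)
  show "pvec M M \<noteq> (0::'a)" if "M \<in> parts d" for M
    using that by (auto simp: parts_def pvec_diag)
qed (use assms in \<open>auto simp: homogeneous_def intro: transp_onI asymp_onI\<close>)

lemma power_sums_independent:
  fixes a :: "nat multiset \<Rightarrow> 'a::field_char_0"
  assumes "finite J" and "\<And>M. M \<in> J \<Longrightarrow> 0 \<notin># M"
    and "\<And>N. 0 \<notin># N \<Longrightarrow> (\<Sum>M\<in>J. a M * pvec M N) = 0" and "M \<in> J"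
  shows "a M = 0"
proof (rule triangular_independent[where R = "\<lambda>M N. size M < size N" and u = pvec and J = J])
  fix N
  show "(\<Sum>M\<in>J. a M * pvec M N) = 0"
  proof (cases "0 \<in># N")
    case True
    then have "pvec M N = (0::'a)" if "M \<in> J" for M
      using pvec_support(1)[of M N] assms(2)[OF that] by (auto simp: parts_def)
    then show ?thesis by simp
  qed (use assms in auto)
next
  show "N = M \<or> size N < size M" if "M \<in> J" "pvec M N \<noteq> (0::'a)" for M N
    using pvec_support[OF _ that(2)] assms(2) that(1) by auto
  show "pvec M M \<noteq> (0::'a)" if "M \<in> J" for M
    using that assms(2) by (auto simp: pvec_diag)
qed (use assms in \<open>auto intro: transp_onI asymp_onI\<close>)

text \<open>The description by which \<open>power_sum_coeffs\<close> is defined has a unique solution, by linear independence of the power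
  sum products. The competitor \<open>b\<close> may involve several degrees, hence the finite index set \<open>J\<close> instead of \<open>parts d\<close>.\<close>

lemma power_sum_coeffs_sym_series:
  assumes a: "homogeneous d a" and v: "\<And>N. v N = (\<Sum>M\<in>parts d. a M * pvec M N)"
  shows "power_sum_coeffs (sym_series v) = (\<lambda>\<rho>. if is_partition \<rho> then a (mset \<rho>) else 0)"
proof -
  let ?Q = "\<lambda>a. finite {\<rho>. a \<rho> \<noteq> 0} \<and> (\<forall>\<rho>. a \<rho> \<noteq> 0 \<longrightarrow> is_partition \<rho>) \<and>
             sym_series v = (\<lambda>\<alpha>. \<Sum>\<rho> | a \<rho> \<noteq> 0. a \<rho> * power_sum_prod \<rho> \<alpha>)"
  let ?a = "\<lambda>\<rho>. if is_partition \<rho> then a (mset \<rho>) else 0"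
  have inj: "inj_on mset {\<rho>. is_partition \<rho>}" by (rule inj_onI) (metis mem_Collect_eq part_list_mset)
  have pl: "0 \<notin># M" if "M \<in> mset ` {\<rho>. is_partition \<rho>}" for M
    using that by (auto simp: is_partition_def)
  \<comment> \<open>Sums over partitions become sums over any index set of multisets that contains the support.\<close>
  have trans: "(\<Sum>\<rho> | b \<rho> \<noteq> 0. b \<rho> * power_sum_prod \<rho> \<alpha>) = (\<Sum>M\<in>J. b (part_list M) * pvec M (mono_type \<alpha>))"
    if b: "\<And>\<rho>. b \<rho> \<noteq> 0 \<Longrightarrow> is_partition \<rho>" and J: "finite J" "mset ` {\<rho>. b \<rho> \<noteq> 0} \<subseteq> J" "\<And>M. M \<in> J \<Longrightarrow> 0 \<notin># M"
    for b J \<alpha>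
  proof -
    have "(\<Sum>\<rho> | b \<rho> \<noteq> 0. b \<rho> * power_sum_prod \<rho> \<alpha>) = (\<Sum>\<rho> | b \<rho> \<noteq> 0. b (part_list (mset \<rho>)) * pvec (mset \<rho>) (mono_type \<alpha>))"
      using b by (intro sum.cong refl) (simp add: power_sum_prod_pvec part_list_mset sym_series_def)
    also have "\<dots> = (\<Sum>M\<in>mset ` {\<rho>. b \<rho> \<noteq> 0}. b (part_list M) * pvec M (mono_type \<alpha>))"
      using b by (subst sum.reindex) (auto intro!: inj_on_subset[OF inj])
    also have "\<dots> = (\<Sum>M\<in>J. b (part_list M) * pvec M (mono_type \<alpha>))"
    proof (rule sum.mono_neutral_left)
      show "\<forall>M\<in>J - mset ` {\<rho>. b \<rho> \<noteq> 0}. b (part_list M) * pvec M (mono_type \<alpha>) = 0"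
      proof
        fix M assume "M \<in> J - mset ` {\<rho>. b \<rho> \<noteq> 0}"
        then have "b (part_list M) = 0" by (metis (mono_tags) DiffE image_eqI mem_Collect_eq mset_part_list)
        then show "b (part_list M) * pvec M (mono_type \<alpha>) = 0" by simp
      qed
    qed (use J in auto)
    finally show ?thesis .
  qed
  have supp: "mset ` {\<rho>. ?a \<rho> \<noteq> 0} \<subseteq> parts d" using a by (auto simp: homogeneous_def)
  have "?Q ?a"
  proof (intro conjI)
    show "finite {\<rho>. ?a \<rho> \<noteq> 0}"
      by (rule inj_on_finite[OF inj_on_subset[OF inj] supp]) (auto split: if_splits)
    show "sym_series v = (\<lambda>\<alpha>. \<Sum>\<rho> | ?a \<rho> \<noteq> 0. ?a \<rho> * power_sum_prod \<rho> \<alpha>)"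
    proof
      fix \<alpha> :: "nat \<Rightarrow>\<^sub>0 nat"
      have "(\<Sum>\<rho> | ?a \<rho> \<noteq> 0. ?a \<rho> * power_sum_prod \<rho> \<alpha>) = (\<Sum>M\<in>parts d. ?a (part_list M) * pvec M (mono_type \<alpha>))"
      proof (rule trans)
        show "0 \<notin># M" if "M \<in> parts d" for M using that by (simp add: parts_def)
      qed (use supp in \<open>auto split: if_splits\<close>)
      also have "\<dots> = v (mono_type \<alpha>)"
        unfolding v by (intro sum.cong refl) (auto simp: parts_def is_partition_part_list)
      finally show "sym_series v \<alpha> = (\<Sum>\<rho> | ?a \<rho> \<noteq> 0. ?a \<rho> * power_sum_prod \<rho> \<alpha>)"
        by (simp add: sym_series_def)
    qed
  qed auto
  moreover have "b = ?a" if "?Q b" for b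
  proof
    fix \<rho>
    show "b \<rho> = ?a \<rho>"
    proof (cases "is_partition \<rho>")
      case False
      then show ?thesis using that by auto
    next
      case True
      define J where "J = parts d \<union> mset ` {\<rho>. b \<rho> \<noteq> 0} \<union> {mset \<rho>}"
      have "finite J" using that by (simp add: J_def)
      moreover have "0 \<notin># M" if M: "M \<in> J" for M
      proof -
        have "M \<in> parts d \<or> M \<in> mset ` {\<rho>. is_partition \<rho>}"
          using M True \<open>?Q b\<close> unfolding J_def by blast
        then show ?thesis using pl by (auto simp: parts_def)
      qed
      moreover have "mset \<rho> \<in> J" by (simp add: J_def)
      ultimately have J: "finite J" "\<And>M. M \<in> J \<Longrightarrow> 0 \<notin># M" "mset \<rho> \<in> J" by blast+
      have "b (part_list (mset \<rho>)) - ?a (part_list (mset \<rho>)) = 0"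
      proof (rule power_sums_independent[OF J(1,2) _ J(3)])
        fix N :: "nat multiset" assume "0 \<notin># N"
        then obtain \<alpha> where N: "mono_type \<alpha> = N" using mono_type_surj by blast
        have "(\<Sum>\<rho> | b \<rho> \<noteq> 0. b \<rho> * power_sum_prod \<rho> \<alpha>) = (\<Sum>M\<in>J. b (part_list M) * pvec M (mono_type \<alpha>))"
          by (rule trans[OF _ J(1) _ J(2)]) (use \<open>?Q b\<close> in \<open>auto simp: J_def\<close>)
        then have "(\<Sum>M\<in>J. b (part_list M) * pvec M N) = sym_series v \<alpha>"
          using \<open>?Q b\<close> by (simp only: N)
        moreover have "mset ` {\<rho>. ?a \<rho> \<noteq> 0} \<subseteq> J" using supp unfolding J_def by blast
        then have "(\<Sum>\<rho> | ?a \<rho> \<noteq> 0. ?a \<rho> * power_sum_prod \<rho> \<alpha>) = (\<Sum>M\<in>J. ?a (part_list M) * pvec M (mono_type \<alpha>))"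
          by (intro trans[OF _ J(1) _ J(2)]) (auto split: if_splits)
        then have "(\<Sum>M\<in>J. ?a (part_list M) * pvec M N) = sym_series v \<alpha>"
          using \<open>?Q ?a\<close> by (simp only: N)
        ultimately show "(\<Sum>M\<in>J. (b (part_list M) - ?a (part_list M)) * pvec M N) = 0"
          by (simp add: left_diff_distrib sum_subtractf)
      qed
      then show ?thesis using True by (simp add: part_list_mset)
    qed
  qed
  ultimately show ?thesis unfolding power_sum_coeffs_def by (rule the_equality)
qed

section \<open>Evaluation in finitely many variables\<close>

definition exps :: "nat \<Rightarrow> nat \<Rightarrow> (nat \<Rightarrow>\<^sub>0 nat) set" where
  "exps n d = {\<alpha>. supp \<alpha> \<subseteq> {..<n} \<and> mono_type \<alpha> \<in> parts d}"

lemma sum_mset_mono_type: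
  assumes "supp \<alpha> \<subseteq> {..<n}"
  shows "sum_mset (mono_type \<alpha>) = (\<Sum>i<n. expo \<alpha> i)"
proof -
  have "sum_mset (mono_type \<alpha>) = (\<Sum>i\<in>supp \<alpha>. expo \<alpha> i)"
    by (simp add: mono_type_def sum_unfold_sum_mset)
  also have "\<dots> = (\<Sum>i<n. expo \<alpha> i)"
    using assms by (intro sum.mono_neutral_left) (auto simp: in_keys_iff)
  finally show ?thesis .
qed

lemma in_exps_iff:
  "\<alpha> \<in> exps n d \<longleftrightarrow> supp \<alpha> \<subseteq> {..<n} \<and> (\<Sum>i<n. expo \<alpha> i) = d"
  by (auto simp: exps_def parts_def sum_mset_mono_type)

lemma lookup_outside: "supp \<alpha> \<subseteq> {..<n::nat} \<Longrightarrow> n \<le> i \<Longrightarrow> expo \<alpha> i = 0"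
  unfolding subset_iff in_keys_iff lessThan_iff by (metis not_le)

lemma lookup_le_exps: "\<alpha> \<in> exps n d \<Longrightarrow> expo \<alpha> i \<le> d"
proof (cases "i < n")
  case True
  assume "\<alpha> \<in> exps n d"
  then show ?thesis using True member_le_sum[of i "{..<n}" "expo \<alpha>"] by (simp add: in_exps_iff)
next
  case False
  assume "\<alpha> \<in> exps n d"
  then have "expo \<alpha> i = 0" using False lookup_outside[of \<alpha> n i] by (simp add: exps_def)
  then show ?thesis by simp
qed

lemma finite_exps [simp]: "finite (exps n d)"
proof (rule inj_on_finite)
  let ?f = "\<lambda>\<alpha>. restrict (expo \<alpha>) {..<n}"
  show "inj_on ?f (exps n d)"
  proof (rule inj_onI, rule poly_mapping_eqI)
    fix \<alpha> \<beta> i assume a: "\<alpha> \<in> exps n d" "\<beta> \<in> exps n d" "?f \<alpha> = ?f \<beta>"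
    show "expo \<alpha> i = expo \<beta> i"
    proof (cases "i < n")
      case True
      then show ?thesis using fun_cong[OF a(3), of i] by simp
    next
      case False
      then show ?thesis using a(1,2) lookup_outside[of \<alpha> n i] lookup_outside[of \<beta> n i] by (simp add: exps_def)
    qed
  qed
  show "?f ` exps n d \<subseteq> (\<Pi>\<^sub>E i\<in>{..<n}. {..d})"
    by (intro image_subsetI PiE_I) (auto simp: lookup_le_exps)
  show "finite (\<Pi>\<^sub>E i\<in>{..<n}. {..d})"
    by (intro finite_PiE) auto
qed

definition monomial_at :: "nat \<Rightarrow> (nat \<Rightarrow> 'a::field) \<Rightarrow> (nat \<Rightarrow>\<^sub>0 nat) \<Rightarrow> 'a" where
  "monomial_at n x \<alpha> = (\<Prod>i<n. x i ^ expo \<alpha> i)"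

definition eval_coords :: "nat \<Rightarrow> nat \<Rightarrow> (nat multiset \<Rightarrow> 'a) \<Rightarrow> (nat \<Rightarrow> 'a) \<Rightarrow> 'a::field" where
  "eval_coords n d v x = (\<Sum>\<alpha>\<in>exps n d. v (mono_type \<alpha>) * monomial_at n x \<alpha>)"

lemma eval_vars_sym_series:
  assumes "homogeneous d v"
  shows "eval_vars n x (sym_series v) = eval_coords n d v x"
  unfolding eval_vars_def eval_coords_def sym_series_def monomial_at_def
  using assms by (intro sum.mono_neutral_cong_left[OF finite_exps]) (auto simp: exps_def homogeneous_def)

lemma eval_coords_sum:
  "eval_coords n d (\<lambda>N. \<Sum>M\<in>A. a M * f M N) x = (\<Sum>M\<in>A. a M * eval_coords n d (f M) x)"
  unfolding eval_coords_def sum_distrib_left sum_distrib_right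
  by (subst sum.swap) (simp add: mult.assoc)

lemma monomial_at_plus_single:
  assumes "i < n"
  shows "monomial_at n x (\<alpha> + Poly_Mapping.single i r) = x i ^ r * monomial_at n x \<alpha>"
proof -
  have "monomial_at n x (\<alpha> + Poly_Mapping.single i r) = (\<Prod>j<n. x j ^ expo \<alpha> j * (if j = i then x i ^ r else 1))"
    unfolding monomial_at_def
    by (intro prod.cong) (auto simp: lookup_add lookup_single when_def power_add)
  then show ?thesis using assms by (simp add: prod.distrib monomial_at_def mult.commute)
qed

text \<open>The pairs of a monomial and a variable of exponent at least \<open>r\<close> correspond to the pairs of a monomial of degree \<open>d\<close>
  and any variable.\<close>

lemma eval_coords_raise:
  assumes "r > 0"
  shows "eval_coords n (d + r) (raise r v) x = (\<Sum>i<n. x i ^ r) * eval_coords n d v x"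
proof -
  let ?S = "Poly_Mapping.single"
  let ?g = "\<lambda>\<alpha> i. v (mono_type (\<alpha> - ?S i r)) * monomial_at n x \<alpha>"
  let ?I = "\<lambda>\<alpha>. {i\<in>{..<n}. r \<le> expo \<alpha> i}" and ?A = "\<lambda>i. {\<alpha>\<in>exps n (d + r). r \<le> expo \<alpha> i}"
  have "eval_coords n (d + r) (raise r v) x
      = (\<Sum>\<alpha>\<in>exps n (d + r). \<Sum>i\<in>?I \<alpha>. ?g \<alpha> i)"
    unfolding eval_coords_def
  proof (rule sum.cong[OF refl])
    fix \<alpha> assume "\<alpha> \<in> exps n (d + r)"
    then have "{i. r \<le> expo \<alpha> i} = ?I \<alpha>"
      using assms lookup_outside[of \<alpha> n] by (auto simp: exps_def) (metis le_zero_eq not_less not_le)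
    then show "raise r v (mono_type \<alpha>) * monomial_at n x \<alpha>
       = (\<Sum>i\<in>?I \<alpha>. ?g \<alpha> i)"
      by (simp add: raise_mono_type[OF assms] sum_distrib_right)
  qed
  also have "\<dots> = (\<Sum>i<n. \<Sum>\<alpha>\<in>?A i. ?g \<alpha> i)"
    by (rule sum.swap_restrict) auto
  also have "\<dots> = (\<Sum>i<n. \<Sum>\<beta>\<in>exps n d. x i ^ r * (v (mono_type \<beta>) * monomial_at n x \<beta>))"
  proof (rule sum.cong[OF refl])
    fix i assume i: "i \<in> {..<n}"
    show "(\<Sum>\<alpha>\<in>?A i. ?g \<alpha> i)
       = (\<Sum>\<beta>\<in>exps n d. x i ^ r * (v (mono_type \<beta>) * monomial_at n x \<beta>))"
    proof (rule sum.reindex_bij_witness[of _ "\<lambda>\<beta>. \<beta> + ?S i r" "\<lambda>\<alpha>. \<alpha> - ?S i r"])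
      fix \<alpha> assume a: "\<alpha> \<in> ?A i"
      then have eq: "\<alpha> - ?S i r + ?S i r = \<alpha>"
        using minus_single_plus_single[of r \<alpha> i] by (simp add: add.commute)
      then show "\<alpha> - ?S i r + ?S i r = \<alpha>" .
      have l: "expo (\<alpha> - ?S i r) j = expo \<alpha> j - (if j = i then r else 0)" for j
        by (simp add: lookup_minus lookup_single when_def)
      have "(\<Sum>j<n. expo \<alpha> j) = (\<Sum>j<n. expo (\<alpha> - ?S i r) j + (if j = i then r else 0))"
        using a by (intro sum.cong) (auto simp: l)
      also have "\<dots> = (\<Sum>j<n. expo (\<alpha> - ?S i r) j) + r"
        using i by (simp add: sum.distrib)
      finally have "(\<Sum>j<n. expo (\<alpha> - ?S i r) j) = d" using a by (simp add: in_exps_iff)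
      moreover have "supp (\<alpha> - ?S i r) \<subseteq> supp \<alpha>" by (auto simp: in_keys_iff l)
      ultimately show "\<alpha> - ?S i r \<in> exps n d" using a by (auto simp: in_exps_iff)
      show "x i ^ r * (v (mono_type (\<alpha> - ?S i r)) * monomial_at n x (\<alpha> - ?S i r)) = ?g \<alpha> i"
        using monomial_at_plus_single[of i n x "\<alpha> - ?S i r" r] i by (simp add: eq mult.left_commute)
    next
      fix \<beta> assume b: "\<beta> \<in> exps n d"
      show "\<beta> + ?S i r - ?S i r = \<beta>" by simp
      have l: "expo (\<beta> + ?S i r) j = expo \<beta> j + (if j = i then r else 0)" for j
        by (simp add: lookup_add lookup_single when_def)
      show "\<beta> + ?S i r \<in> ?A i"
      proof -
        have "supp (\<beta> + ?S i r) \<subseteq> insert i (supp \<beta>)"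
          by (auto simp: in_keys_iff l split: if_splits)
        then show ?thesis using b i by (auto simp: in_exps_iff l sum.distrib)
      qed
    qed
  qed
  also have "\<dots> = (\<Sum>i<n. x i ^ r) * eval_coords n d v x"
    by (simp only: eval_coords_def sum_product)
  finally show ?thesis .
qed

lemma eval_coords_psum_coords:
  "0 \<notin> set \<rho> \<Longrightarrow> eval_coords n (sum_list \<rho>) (psum_coords \<rho>) x = (\<Prod>r\<leftarrow>\<rho>. \<Sum>i<n. x i ^ r)"
proof (induction \<rho>)
  case Nil
  have "exps n 0 = {0}"
  proof -
    have "\<alpha> = 0" if "\<alpha> \<in> exps n 0" for \<alpha>
      using lookup_le_exps[OF that] by (intro poly_mapping_eqI) simp
    moreover have "0 \<in> exps n 0" by (simp add: in_exps_iff)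
    ultimately show ?thesis by blast
  qed
  then show ?case by (simp add: eval_coords_def mono_type_def monomial_at_def)
next
  case (Cons r \<rho>)
  then show ?case
    using eval_coords_raise[of r n "sum_list \<rho>" "psum_coords \<rho>" x] by (simp add: add.commute)
qed

lemma eval_coords_pvec:
  "0 \<notin># M \<Longrightarrow> eval_coords n (sum_mset M) (pvec M) x = psum_prod n M x"
  using eval_coords_psum_coords[of "part_list M" n x]
  by (simp add: pvec_def psum_prod_def) (metis mset_part_list mset_map prod_mset_prod_list)

section \<open>Macdonald's operator in coordinates\<close>

definition psum_coeffs :: "(nat multiset \<Rightarrow> 'a) \<Rightarrow> nat multiset \<Rightarrow> 'a::field_char_0" where
  "psum_coeffs v M = (if 0 \<in># M then 0 else power_sum_coeffs (sym_series v) (part_list M))"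

lemma psum_coeffs_unique:
  assumes "homogeneous d a" and "\<And>N. v N = (\<Sum>M\<in>parts d. a M * pvec M N)"
  shows "psum_coeffs v = a"
  using assms(1)
  by (auto simp: fun_eq_iff psum_coeffs_def power_sum_coeffs_sym_series[OF assms] is_partition_part_list
      homogeneous_def parts_def)

lemma psum_expansion:
  assumes "homogeneous d v"
  shows "homogeneous d (psum_coeffs v)" and "v N = (\<Sum>M\<in>parts d. psum_coeffs v M * pvec M N)"
  using power_sum_basis[OF assms] psum_coeffs_unique by metis+

lemma homogeneous_pvec_sum: "homogeneous d (\<lambda>N. \<Sum>M\<in>parts d. a M * pvec M N)"
  unfolding homogeneous_def
proof (intro allI impI)
  fix N assume "(\<Sum>M\<in>parts d. a M * pvec M N) \<noteq> 0"
  then obtain M where "M \<in> parts d" "pvec M N \<noteq> (0::'a)"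
    by (metis (no_types, lifting) mult_not_zero sum.not_neutral_contains_not_neutral)
  then show "N \<in> parts d" using pvec_support(1)[of M N] by (auto simp: parts_def)
qed

text \<open>The operator on symmetric functions that induces \<open>mac_op\<close> in every number of variables, by \<open>mac_op_eval_coords\<close>.\<close>

definition coord_op :: "'a \<Rightarrow> 'a \<Rightarrow> nat \<Rightarrow> (nat multiset \<Rightarrow> 'a) \<Rightarrow> nat multiset \<Rightarrow> 'a::field_char_0" where
  "coord_op q t d v N = (\<Sum>L\<in>parts d. (\<Sum>M\<in>parts d. psum_coeffs v M * trans_coeff q t M L) * pvec L N)"

lemma homogeneous_coord_op: "homogeneous d (coord_op q t d v)"
  unfolding coord_op_def[abs_def] by (rule homogeneous_pvec_sum)

lemma psum_coeffs_coord_op: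
  assumes "homogeneous d v" and "L \<in> parts d"
  shows "psum_coeffs (coord_op q t d v) L = (\<Sum>M\<in>parts d. psum_coeffs v M * trans_coeff q t M L)"
proof -
  have "psum_coeffs (coord_op q t d v) = (\<lambda>L. if L \<in> parts d then \<Sum>M\<in>parts d. psum_coeffs v M * trans_coeff q t M L else 0)"
    by (rule psum_coeffs_unique[of d]) (auto simp: homogeneous_def coord_op_def intro!: sum.cong)
  then show ?thesis using assms(2) by simp
qed

lemma eval_coords_expansion:
  assumes "homogeneous d v"
  shows "eval_coords n d v x = (\<Sum>M\<in>parts d. psum_coeffs v M * psum_prod n M x)"
proof -
  have "eval_coords n d v x = eval_coords n d (\<lambda>N. \<Sum>M\<in>parts d. psum_coeffs v M * pvec M N) x"
    using psum_expansion(2)[OF assms] by (intro arg_cong[of _ _ "\<lambda>v. eval_coords n d v x"] ext)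
  also have "\<dots> = (\<Sum>M\<in>parts d. psum_coeffs v M * psum_prod n M x)"
    unfolding eval_coords_sum by (intro sum.cong refl) (auto simp: parts_def eval_coords_pvec)
  finally show ?thesis .
qed

lemma mac_op_sum: "mac_op n q t (\<lambda>x. \<Sum>M\<in>A. a M * F M x) x = (\<Sum>M\<in>A. a M * mac_op n q t (F M) x)"
  unfolding mac_op_def sum_distrib_left by (subst sum.swap) (simp add: mult.left_commute)

lemma mac_op_eval_coords:
  fixes x :: "nat \<Rightarrow> 'a::field_char_0"
  assumes v: "homogeneous d v" and x: "good_point n x" and t: "t \<noteq> 0"
  shows "(t - 1) * mac_op n q t (eval_coords n d v) x + eval_coords n d v x
    = t ^ n * eval_coords n d (coord_op q t d v) x"
proof -
  have "eval_coords n d v = (\<lambda>x. \<Sum>M\<in>parts d. psum_coeffs v M * psum_prod n M x)"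
    by (intro ext eval_coords_expansion v)
  then have "(t - 1) * mac_op n q t (eval_coords n d v) x + eval_coords n d v x
    = (\<Sum>M\<in>parts d. psum_coeffs v M * ((t - 1) * mac_op n q t (psum_prod n M) x + psum_prod n M x))"
    by (simp add: mac_op_sum distrib_left sum.distrib sum_distrib_left mult.left_commute)
  also have "\<dots> = (\<Sum>M\<in>parts d. psum_coeffs v M * (t ^ n * (\<Sum>N\<in>parts d. trans_coeff q t M N * psum_prod n N x)))"
    using x t by (intro sum.cong refl) (auto simp: parts_def mac_op_psum_prod)
  also have "\<dots> = t ^ n * (\<Sum>L\<in>parts d. (\<Sum>M\<in>parts d. psum_coeffs v M * trans_coeff q t M L) * psum_prod n L x)"
    unfolding sum_distrib_left sum_distrib_right by (subst sum.swap) (simp add: mult.left_commute mult.assoc)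
  also have "\<dots> = t ^ n * eval_coords n d (coord_op q t d v) x"
    by (simp add: eval_coords_expansion[OF homogeneous_coord_op] psum_coeffs_coord_op[OF v])
  finally show ?thesis .
qed

section \<open>Leading terms\<close>

text \<open>Unlike the leading coefficient, \<open>a\<close> may vanish here, so that sums and products need no case distinctions.\<close>

definition lead_at :: "'a::comm_ring_1 poly \<Rightarrow> nat \<Rightarrow> 'a \<Rightarrow> bool" where
  "lead_at p m a \<longleftrightarrow> degree p \<le> m \<and> coeff p m = a"

lemma lead_at_mult:
  assumes "lead_at p m a" and "lead_at p' m' a'"
  shows "lead_at (p * p') (m + m') (a * a')"
proof -
  have "coeff (p * p') (m + m') = (\<Sum>i\<le>m + m'. if i = m then a * a' else 0)"
    unfolding coeff_mult
  proof (rule sum.cong[OF refl])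
    fix i assume "i \<in> {..m + m'}"
    consider "i < m" | "i = m" | "i > m" by linarith
    then show "coeff p i * coeff p' (m + m' - i) = (if i = m then a * a' else 0)"
      using assms by cases (auto simp: lead_at_def coeff_eq_0)
  qed
  moreover have "degree (p * p') \<le> m + m'"
    using degree_mult_le[of p p'] assms by (auto simp: lead_at_def)
  ultimately show ?thesis by (simp add: lead_at_def)
qed

lemma lead_at_prod:
  "finite A \<Longrightarrow> (\<And>i. i \<in> A \<Longrightarrow> lead_at (p i) (m i) (a i)) \<Longrightarrow> lead_at (\<Prod>i\<in>A. p i) (\<Sum>i\<in>A. m i) (\<Prod>i\<in>A. a i)"
  by (induction A rule: finite_induct) (auto simp: lead_at_mult, simp add: lead_at_def)

lemma lead_at_sum:
  "finite A \<Longrightarrow> (\<And>i. i \<in> A \<Longrightarrow> lead_at (p i) m (a i)) \<Longrightarrow> lead_at (\<Sum>i\<in>A. p i) m (\<Sum>i\<in>A. a i)"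
  by (auto simp: lead_at_def coeff_sum intro!: degree_sum_le)

lemma lead_at_cancel:
  fixes p w :: "'a::idom poly"
  assumes "lead_at p m 1" and "lead_at (p * w) (m + m') a"
  shows "lead_at w m' a"
proof -
  have "degree w \<le> m'"
  proof (cases "w = 0")
    case False
    have "degree p = m" "p \<noteq> 0" using assms(1) by (auto simp: lead_at_def intro!: antisym le_degree)
    then show ?thesis using assms(2) False by (auto simp: lead_at_def degree_mult_eq)
  qed simp
  then have "lead_at (p * w) (m + m') (1 * coeff w m')"
    using assms(1) by (intro lead_at_mult) (auto simp: lead_at_def)
  then show ?thesis using assms(2) \<open>degree w \<le> m'\<close> by (auto simp: lead_at_def)
qed

text \<open>The degree in \<open>y\<close> of a monomial on the curve \<open>x i = y ^ c i\<close>.\<close>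

definition exp_weight :: "nat \<Rightarrow> (nat \<Rightarrow> nat) \<Rightarrow> (nat \<Rightarrow>\<^sub>0 nat) \<Rightarrow> nat" where
  "exp_weight n c \<alpha> = (\<Sum>i<n. c i * expo \<alpha> i)"

lemma coeff_sum_monom:
  "finite A \<Longrightarrow> coeff (\<Sum>\<alpha>\<in>A. monom (f \<alpha>) (g \<alpha>)) m = (\<Sum>\<alpha>\<in>{\<alpha>\<in>A. g \<alpha> = m}. f \<alpha>)"
  by (simp add: coeff_sum sum.inter_filter)

text \<open>On the curve \<open>x i = y ^ c i\<close> everything becomes a rational function of \<open>y\<close>. As \<open>c\<close> decreases, the factor of
  \<open>shift_coeff n t x i\<close> that belongs to \<open>j\<close> tends to \<open>t\<close> for \<open>j > i\<close> and to \<open>1\<close> for \<open>j < i\<close> when \<open>y\<close> grows.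
  Hence the operator does not raise the degree in \<open>y\<close>, and it multiplies the term of top degree by the sum shown.
  The curve is only evaluated at natural numbers, which suffices in characteristic \<open>0\<close>.\<close>

lemma mac_op_leading:
  fixes v w :: "nat multiset \<Rightarrow> 'a::field_char_0"
  assumes c: "\<And>i j. i < j \<Longrightarrow> j < n \<Longrightarrow> c j < c i"
    and eq: "\<And>x. good_point n x \<Longrightarrow> mac_op n q t (eval_coords n d v) x = eval_coords n d w x"
    and m: "\<And>\<alpha>. \<alpha> \<in> exps n d \<Longrightarrow> v (mono_type \<alpha>) \<noteq> 0 \<Longrightarrow> exp_weight n c \<alpha> \<le> m"
  shows "\<And>m'. m < m' \<Longrightarrow> (\<Sum>\<alpha>\<in>{\<alpha>\<in>exps n d. exp_weight n c \<alpha> = m'}. w (mono_type \<alpha>)) = 0"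
    and "(\<Sum>\<alpha>\<in>{\<alpha>\<in>exps n d. exp_weight n c \<alpha> = m}. w (mono_type \<alpha>))
      = (\<Sum>\<alpha>\<in>{\<alpha>\<in>exps n d. exp_weight n c \<alpha> = m}.
           v (mono_type \<alpha>) * (\<Sum>i<n. t ^ (n - 1 - i) * q ^ expo \<alpha> i))"
proof -
  define W where "W = (\<Sum>\<alpha>\<in>exps n d. monom (w (mono_type \<alpha>)) (exp_weight n c \<alpha>))"
  define V where "V i = (\<Sum>\<alpha>\<in>exps n d. monom (v (mono_type \<alpha>) * q ^ expo \<alpha> i) (exp_weight n c \<alpha>))" for i
  define D where "D i j = (if i < j then monom 1 (c i) - monom 1 (c j) else monom 1 (c j) - monom (1::'a) (c i))" for i j
  define E where "E i j = (if i < j then monom t (c i) - monom 1 (c j) else monom 1 (c j) - monom t (c i))" for i j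
  define e where "e i j = (if i < j then c i else c j)" for i j
  define Q where "Q i = (\<Prod>j\<in>{..<n}-{i}. D i j)" for i
  define P where "P i = (\<Prod>j\<in>{..<n}-{i}. E i j)" for i
  let ?s = "\<lambda>i. \<Sum>j\<in>{..<n}-{i}. e i j"
  let ?P = "\<Sum>i<n. P i * (\<Prod>l\<in>{..<n}-{i}. Q l) * V i" and ?Q = "\<Prod>i<n. Q i"
  let ?A = "\<lambda>m. {\<alpha>\<in>exps n d. exp_weight n c \<alpha> = m}"
  \<comment> \<open>Distinct weights give distinct coordinates only for \<open>k \<ge> 2\<close>.\<close>
  have good: "good_point n (\<lambda>i. of_nat k ^ c i :: 'a)" if "k \<ge> 2" for k
  proof -
    have "(of_nat k ^ c i :: 'a) \<noteq> of_nat k ^ c j" if "i < n" "j < n" "i \<noteq> j" for i j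
    proof -
      have "c i \<noteq> c j" using c[of i j] c[of j i] that by (metis less_irrefl_nat linorder_neqE_nat)
      then have "k ^ c i \<noteq> k ^ c j" using \<open>k \<ge> 2\<close> by (simp add: power_inject_exp)
      then show ?thesis by (metis of_nat_eq_iff of_nat_power)
    qed
    then show ?thesis using that by (auto simp: good_point_def inj_on_def)
  qed
  have curve: "poly (?Q * W) (of_nat k) = poly ?P (of_nat k)"
    if k: "k \<ge> 2" for k
  proof -
    let ?y = "of_nat k :: 'a" and ?x = "\<lambda>i. of_nat k ^ c i :: 'a"
    have x: "?x i \<noteq> ?x j" if "i < n" "j < n" "i \<noteq> j" for i j
      using good[OF k] that by (auto simp: good_point_def inj_on_def)
    have ED: "poly (E i j) ?y = (t * ?x i - ?x j) / (?x i - ?x j) * poly (D i j) ?y \<and> poly (D i j) ?y \<noteq> 0"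
      if "i < n" "j < n" "i \<noteq> j" for i j
      using x[OF that] by (auto simp: E_def D_def poly_monom field_simps)
    have P: "poly (P i) ?y = shift_coeff n t ?x i * poly (Q i) ?y" if "i < n" for i
      unfolding P_def Q_def shift_coeff_def poly_prod prod.distrib[symmetric]
      using ED that by (intro prod.cong refl) auto
    have mono: "monomial_at n ?x \<alpha> = ?y ^ exp_weight n c \<alpha>" for \<alpha>
      by (simp add: monomial_at_def exp_weight_def power_sum power_mult)
    have W: "poly W ?y = eval_coords n d w ?x"
      by (simp add: W_def poly_sum poly_monom eval_coords_def mono)
    have V: "poly (V i) ?y = eval_coords n d v (?x(i := q * ?x i))" if "i < n" for i
    proof -
      have "monomial_at n (?x(i := q * ?x i)) \<alpha> = q ^ expo \<alpha> i * monomial_at n ?x \<alpha>" for \<alpha>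
      proof -
        have "monomial_at n (?x(i := q * ?x i)) \<alpha> = (\<Prod>j<n. ?x j ^ expo \<alpha> j * (if j = i then q ^ expo \<alpha> i else 1))"
          unfolding monomial_at_def by (intro prod.cong) (auto simp: power_mult_distrib)
        then show ?thesis using that by (simp add: prod.distrib monomial_at_def mult.commute)
      qed
      then show ?thesis by (simp add: V_def poly_sum poly_monom eval_coords_def mono mult.assoc)
    qed
    have "poly ?P ?y
       = (\<Sum>i<n. poly ?Q ?y * (shift_coeff n t ?x i * eval_coords n d v (?x(i := q * ?x i))))"
      unfolding poly_sum poly_mult
    proof (rule sum.cong[OF refl])
      fix i assume i: "i \<in> {..<n}"
      have "poly ?Q ?y = poly (Q i) ?y * poly (\<Prod>l\<in>{..<n}-{i}. Q l) ?y"
        using i by (subst prod.remove[of _ i]) auto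
      then show "poly (P i) ?y * poly (\<Prod>l\<in>{..<n}-{i}. Q l) ?y * poly (V i) ?y
         = poly ?Q ?y * (shift_coeff n t ?x i * eval_coords n d v (?x(i := q * ?x i)))"
        using i by (simp add: P V)
    qed
    also have "\<dots> = poly ?Q ?y * mac_op n q t (eval_coords n d v) ?x"
      by (simp only: mac_op_def sum_distrib_left)
    also have "\<dots> = poly (?Q * W) ?y"
      by (simp only: eq[OF good[OF k]] W poly_mult)
    finally show ?thesis by simp
  qed
  have polyeq: "?Q * W = ?P"
  proof (rule ccontr)
    assume ne: "\<not> ?thesis"
    let ?p = "?Q * W - ?P"
    have "of_nat ` {2..} \<subseteq> {y. poly ?p y = 0}" using curve by auto
    moreover have "infinite (of_nat ` {2..} :: 'a set)"
      by (subst finite_image_iff) (auto simp: inj_on_def infinite_Ici)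
    moreover have "finite {y. poly ?p y = 0}" using ne by (intro poly_roots_finite) auto
    ultimately show False using finite_subset by blast
  qed
  \<comment> \<open>The factors are oriented so that every denominator is monic.\<close>
  have lead_D: "lead_at (D i j) (e i j) 1" and lead_E: "lead_at (E i j) (e i j) (if i < j then t else 1)"
    if "i < n" "j < n" "i \<noteq> j" for i j
  proof -
    show "lead_at (D i j) (e i j) 1"
    proof (cases "i < j")
      case True
      then have "c j < c i" using c that by blast
      then show ?thesis using True
        by (auto simp: lead_at_def D_def e_def intro!: degree_diff_le degree_monom_le order.trans[OF degree_monom_le])
    next
      case False
      then have "c i < c j" using c that by (metis linorder_neqE_nat)
      then show ?thesis using False
        by (auto simp: lead_at_def D_def e_def intro!: degree_diff_le degree_monom_le order.trans[OF degree_monom_le])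
    qed
    show "lead_at (E i j) (e i j) (if i < j then t else 1)"
    proof (cases "i < j")
      case True
      then have "c j < c i" using c that by blast
      then show ?thesis using True
        by (auto simp: lead_at_def E_def e_def intro!: degree_diff_le degree_monom_le order.trans[OF degree_monom_le])
    next
      case False
      then have "c i < c j" using c that by (metis linorder_neqE_nat)
      then show ?thesis using False
        by (auto simp: lead_at_def E_def e_def intro!: degree_diff_le degree_monom_le order.trans[OF degree_monom_le])
    qed
  qed
  have lead_Q: "lead_at (Q i) (?s i) 1" if "i < n" for i
    using lead_at_prod[of "{..<n}-{i}" "D i" "e i" "\<lambda>_. 1"] lead_D that by (simp add: Q_def)
  have lead_P: "lead_at (P i) (?s i) (t ^ (n - 1 - i))" if "i < n" for i
  proof -
    have "lead_at (P i) (?s i) (\<Prod>j\<in>{..<n}-{i}. if i < j then t else 1)"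
      unfolding P_def using lead_E that by (intro lead_at_prod) auto
    also have "(\<Prod>j\<in>{..<n}-{i}. if i < j then t else 1) = (\<Prod>j\<in>{i<..<n}. t)"
      by (intro prod.mono_neutral_cong_right) auto
    finally show ?thesis by simp
  qed
  have lead_V: "lead_at (V i) m (coeff (V i) m)" for i
  proof -
    have "degree (V i) \<le> m" unfolding V_def
    proof (rule degree_sum_le)
      fix \<alpha> assume "\<alpha> \<in> exps n d"
      then show "degree (monom (v (mono_type \<alpha>) * q ^ expo \<alpha> i) (exp_weight n c \<alpha>)) \<le> m"
        using m[of \<alpha>] degree_monom_le[of "v (mono_type \<alpha>) * q ^ expo \<alpha> i" "exp_weight n c \<alpha>"]
        by (cases "v (mono_type \<alpha>) = 0") auto
    qed simp
    then show ?thesis by (simp add: lead_at_def)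
  qed
  have "lead_at ?P ((\<Sum>i<n. ?s i) + m) (\<Sum>i<n. t ^ (n - 1 - i) * coeff (V i) m)"
  proof (rule lead_at_sum)
    fix i assume i: "i \<in> {..<n}"
    have "lead_at (P i * (\<Prod>l\<in>{..<n}-{i}. Q l) * V i) (?s i + (\<Sum>l\<in>{..<n}-{i}. ?s l) + m)
       (t ^ (n - 1 - i) * (\<Prod>l\<in>{..<n}-{i}. 1) * coeff (V i) m)"
      using i by (intro lead_at_mult lead_at_prod lead_P lead_Q lead_V) auto
    moreover have "(\<Sum>i<n. ?s i) = ?s i + (\<Sum>l\<in>{..<n}-{i}. ?s l)"
      using i by (subst sum.remove[of _ i]) auto
    ultimately show "lead_at (P i * (\<Prod>l\<in>{..<n}-{i}. Q l) * V i) ((\<Sum>i<n. ?s i) + m) (t ^ (n - 1 - i) * coeff (V i) m)"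
      by simp
  qed simp
  then have lead_QW: "lead_at (?Q * W) ((\<Sum>i<n. ?s i) + m) (\<Sum>i<n. t ^ (n - 1 - i) * coeff (V i) m)"
    by (simp only: polyeq)
  have "lead_at ?Q (\<Sum>i<n. ?s i) 1"
    using lead_at_prod[of "{..<n}" Q ?s "\<lambda>_. 1"] lead_Q by simp
  then have lead_W: "lead_at W m (\<Sum>i<n. t ^ (n - 1 - i) * coeff (V i) m)"
    using lead_QW by (rule lead_at_cancel)
  have coeff_W: "coeff W m' = (\<Sum>\<alpha>\<in>?A m'. w (mono_type \<alpha>))" for m'
    by (simp add: W_def coeff_sum_monom)
  show "(\<Sum>\<alpha>\<in>?A m'. w (mono_type \<alpha>)) = 0" if "m < m'" for m'
    using lead_W that by (simp add: coeff_W[symmetric] lead_at_def coeff_eq_0)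
  have "(\<Sum>i<n. t ^ (n - 1 - i) * coeff (V i) m) = (\<Sum>\<alpha>\<in>?A m.
           v (mono_type \<alpha>) * (\<Sum>i<n. t ^ (n - 1 - i) * q ^ expo \<alpha> i))"
    unfolding V_def by (simp only: coeff_sum_monom finite_exps sum_distrib_left, subst sum.swap)
       (simp add: mult.left_commute)
  then show "(\<Sum>\<alpha>\<in>?A m. w (mono_type \<alpha>))
      = (\<Sum>\<alpha>\<in>?A m.
           v (mono_type \<alpha>) * (\<Sum>i<n. t ^ (n - 1 - i) * q ^ expo \<alpha> i))"
    using lead_W by (simp add: coeff_W[symmetric] lead_at_def)
qed

section \<open>Dominance and dominant exponents\<close>

text \<open>Among the monomials of a given type, the one with weakly decreasing exponents.\<close>

definition top_exp :: "nat multiset \<Rightarrow> nat \<Rightarrow>\<^sub>0 nat" where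
  "top_exp N = Poly_Mapping.nth (part_list N)"

lemma mono_type_top_exp [simp]: "0 \<notin># N \<Longrightarrow> mono_type (top_exp N) = N"
  by (simp add: top_exp_def mono_type_nth)

lemma lookup_top_exp_outside: "size N \<le> i \<Longrightarrow> expo (top_exp N) i = 0"
  by (simp add: top_exp_def nth_default_beyond)

lemma top_exp_in_exps:
  assumes "N \<in> parts d" and "size N \<le> n"
  shows "top_exp N \<in> exps n d"
proof -
  have "i < n" if "i \<in> supp (top_exp N)" for i
    using that lookup_top_exp_outside[of N i] assms(2) by (metis in_keys_iff le_trans linorder_not_le)
  then show ?thesis using assms(1) by (auto simp: exps_def parts_def)
qed

lemma size_le_exps: "\<alpha> \<in> exps n d \<Longrightarrow> size (mono_type \<alpha>) \<le> n"
  by (auto simp: mono_type_def exps_def dest: card_mono[OF finite_lessThan])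

lemma size_le_parts: "N \<in> parts d \<Longrightarrow> size N \<le> d"
  using size_le_sum_mset[of N] by (auto simp: parts_def)

lemma mono_type_exps: "\<alpha> \<in> exps n d \<Longrightarrow> mono_type \<alpha> \<in> parts d"
  by (simp add: exps_def)

lemma decreasing_eq_top_exp:
  assumes \<alpha>: "\<alpha> \<in> exps n d"
    and dec: "\<And>i j. i < j \<Longrightarrow> j < n \<Longrightarrow> expo \<alpha> j \<le> expo \<alpha> i"
  shows "\<alpha> = top_exp (mono_type \<alpha>)"
proof -
  let ?l = "expo \<alpha>"
  define L where "L = map ?l [0..<n]"
  define F where "F = filter (\<lambda>a. a \<noteq> 0) L"
  have sorted: "sorted_wrt (\<ge>) L" using dec by (auto simp: L_def sorted_wrt_iff_nth_less)
  have "mset F = filter_mset (\<lambda>a. a \<noteq> 0) (image_mset ?l (mset_set {..<n}))"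
    by (simp add: F_def L_def atLeast0LessThan[symmetric])
  also have "\<dots> = mono_type \<alpha>"
    using \<alpha> by (intro mono_type_superset[symmetric]) (auto simp: exps_def)
  finally have F: "mset F = mono_type \<alpha>" .
  have "is_partition F" using sorted_wrt_filter[OF sorted] by (simp add: is_partition_def F_def)
  then have pl: "part_list (mono_type \<alpha>) = F" using part_list_mset F by metis
  have F': "F = takeWhile (\<lambda>a. 0 < a) L"
    using filter_equals_takeWhile_sorted_rev[of "\<lambda>a. a" L 0] sorted
    by (simp add: F_def sorted_wrt_rev)
  show ?thesis
  proof (rule poly_mapping_eqI)
    fix i
    have "nth_default 0 F i = ?l i"
    proof (cases "i < length F")
      case True
      then have "i < n" using length_takeWhile_le[of "\<lambda>a. 0 < a" L] by (simp add: F' L_def)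
      then show ?thesis using True by (simp add: nth_default_nth F' takeWhile_nth L_def)
    next
      case False
      have "?l i = 0"
      proof (cases "i < n")
        case True
        then have k: "length F < length L" "length F \<le> i" using False by (simp_all add: L_def)
        then have "L ! length F = 0" using nth_length_takeWhile[of "\<lambda>a. 0 < a" L] by (simp add: F')
        then have "?l (length F) = 0" using k by (simp add: L_def)
        then show ?thesis using dec[of "length F" i] k True by (cases "length F = i") auto
      next
        case False
        then show ?thesis using \<alpha> lookup_outside[of \<alpha> n i] by (simp add: exps_def)
      qed
      then show ?thesis using False by (simp add: nth_default_beyond)
    qed
    then show "?l i = expo (top_exp (mono_type \<alpha>)) i"
      by (simp add: top_exp_def pl)
  qed
qed

text \<open>Moving the larger exponent to the larger weight increases the total weight; so only decreasing exponents can have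
  maximal weight.\<close>

lemma exchange_exponents:
  assumes \<alpha>: "\<alpha> \<in> exps n d" and ij: "i < j" "j < n"
    and lt: "expo \<alpha> i < expo \<alpha> j" and c: "c j < c i"
  obtains \<beta> where "\<beta> \<in> exps n d" "mono_type \<beta> = mono_type \<alpha>" "exp_weight n c \<alpha> < exp_weight n c \<beta>"
proof -
  let ?l = "expo \<alpha>"
  define s where "s = id(i := j, j := i)"
  have s: "s (s k) = k" for k using ij by (auto simp: s_def)
  then have inj: "inj s" by (metis injI)
  have s_img: "s ` {..<n} = {..<n}"
  proof -
    have "s ` {..<n} \<subseteq> {..<n}" using ij by (auto simp: s_def)
    moreover from this have "{..<n} \<subseteq> s ` {..<n}" using s by (metis image_eqI image_subset_iff subsetI)
    ultimately show ?thesis by blast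
  qed
  define \<beta> where "\<beta> = Poly_Mapping.map_key s \<alpha>"
  have l: "expo \<beta> k = ?l (s k)" for k
    using inj by (simp add: \<beta>_def map_key.rep_eq)
  have keys: "supp \<beta> \<subseteq> {..<n}"
  proof
    fix k assume "k \<in> supp \<beta>"
    then have "s k \<in> supp \<alpha>" by (simp add: in_keys_iff l)
    then have "s k < n" using \<alpha> by (auto simp: exps_def)
    then show "k \<in> {..<n}" using s s_img by (metis imageI lessThan_iff)
  qed
  have "mono_type \<beta> = filter_mset (\<lambda>a. a \<noteq> 0) (image_mset ?l (image_mset s (mset_set {..<n})))"
  proof -
    have "expo \<beta> = ?l \<circ> s" by (simp add: fun_eq_iff l)
    then show ?thesis by (simp only: mono_type_superset[OF _ keys] multiset.map_comp finite_lessThan)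
  qed
  also have "image_mset s (mset_set {..<n}) = mset_set {..<n}"
    using image_mset_mset_set[of s "{..<n}"] inj s_img by (simp add: inj_on_subset)
  also have "filter_mset (\<lambda>a. a \<noteq> 0) (image_mset ?l (mset_set {..<n})) = mono_type \<alpha>"
    using \<alpha> by (intro mono_type_superset[symmetric]) (auto simp: exps_def)
  finally have type: "mono_type \<beta> = mono_type \<alpha>" .
  have split: "exp_weight n c \<gamma> = c i * expo \<gamma> i + c j * expo \<gamma> j
      + (\<Sum>k\<in>{..<n}-{i,j}. c k * expo \<gamma> k)" for \<gamma>
  proof -
    have "exp_weight n c \<gamma> = c i * expo \<gamma> i + (\<Sum>k\<in>{..<n}-{i}. c k * expo \<gamma> k)"
      unfolding exp_weight_def using ij by (intro sum.remove) auto
    also have "(\<Sum>k\<in>{..<n}-{i}. c k * expo \<gamma> k) = c j * expo \<gamma> j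
      + (\<Sum>k\<in>{..<n}-{i}-{j}. c k * expo \<gamma> k)"
      using ij by (intro sum.remove) auto
    also have "{..<n}-{i}-{j} = {..<n}-{i,j}" by auto
    finally show ?thesis by simp
  qed
  have "(\<Sum>k\<in>{..<n}-{i,j}. c k * expo \<beta> k) = (\<Sum>k\<in>{..<n}-{i,j}. c k * ?l k)"
    by (intro sum.cong) (auto simp: l s_def)
  moreover have "c i * ?l i + c j * ?l j < c i * ?l j + c j * ?l i"
  proof -
    obtain x y where "c i = c j + x" "x > 0" "?l j = ?l i + y" "y > 0"
      using c lt by (metis less_imp_add_positive)
    then show ?thesis by (simp add: algebra_simps)
  qed
  ultimately have "exp_weight n c \<alpha> < exp_weight n c \<beta>"
    using ij by (simp add: split l s_def)
  moreover have "\<beta> \<in> exps n d" using keys type \<alpha> by (simp add: exps_def)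
  ultimately show ?thesis using that type by blast
qed

lemma digit_sum:
  assumes "\<And>i. i < n \<Longrightarrow> a i < (B::nat)"
  shows "(\<Sum>i<n. a i * B ^ i) < B ^ n"
  using assms
proof (induction n)
  case (Suc n)
  have "(\<Sum>i<Suc n. a i * B ^ i) < B ^ n + a n * B ^ n" using Suc by simp
  also have "\<dots> = Suc (a n) * B ^ n" by simp
  also have "\<dots> \<le> B * B ^ n" using Suc.prems[of n] by (intro mult_le_mono1) simp
  finally show ?case by simp
qed simp

lemma digits_unique:
  assumes "\<And>i. i < n \<Longrightarrow> a i < (B::nat)" and "\<And>i. i < n \<Longrightarrow> b i < B"
    and "(\<Sum>i<n. a i * B ^ i) = (\<Sum>i<n. b i * B ^ i)" and "i < n"
  shows "a i = b i"
  using assms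
proof (induction n arbitrary: i)
  case (Suc n)
  let ?A = "\<Sum>i<n. a i * B ^ i" and ?C = "\<Sum>i<n. b i * B ^ i"
  have lt: "?A < B ^ n" "?C < B ^ n" using Suc.prems by (auto intro!: digit_sum)
  have eq: "?A + a n * B ^ n = ?C + b n * B ^ n" using Suc.prems(3) by simp
  have "(?A + a n * B ^ n) mod B ^ n = ?A" "(?C + b n * B ^ n) mod B ^ n = ?C" using lt by simp_all
  then have AC: "?A = ?C" using eq by metis
  have "B > 0" using Suc.prems(1)[of n] by simp
  then have "a n = b n" using eq AC by simp
  then show ?case using Suc.IH[of i] Suc.prems AC by (cases "i = n") auto
qed simp

text \<open>Take \<open>c i = B ^ (n - 1 - i)\<close> for a large base \<open>B\<close>, and add \<open>B ^ n\<close> for \<open>i < j\<close>. The first summands read the exponents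
  as digits, which makes weights injective and keeps their contribution below \<open>B ^ n\<close>; the second summands let the partial
  sum up to \<open>j\<close> decide first.\<close>

lemma dominance_weight:
  assumes "j \<le> n"
  obtains c where "\<And>i k. i < k \<Longrightarrow> k < n \<Longrightarrow> c k < (c i :: nat)"
    and "inj_on (exp_weight n c) (exps n d)"
    and "\<And>\<alpha> \<beta>. \<alpha> \<in> exps n d \<Longrightarrow> \<beta> \<in> exps n d \<Longrightarrow> exp_weight n c \<alpha> \<le> exp_weight n c \<beta> \<Longrightarrow>
       (\<Sum>i<j. expo \<alpha> i) \<le> (\<Sum>i<j. expo \<beta> i)"
proof -
  \<comment> \<open>Exponents are at most \<open>d\<close>; base \<open>d + 1\<close> would not make the weights strictly decreasing for \<open>d = 0\<close>.\<close>
  define B where "B = d + 2"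
  define c where "c i = (if i < j then B ^ n else 0) + B ^ (n - Suc i)" for i
  define low where "low \<alpha> = (\<Sum>i<n. expo \<alpha> (n - Suc i) * B ^ i)" for \<alpha> :: "nat \<Rightarrow>\<^sub>0 nat"
  have digit: "expo \<alpha> i < B" if "\<alpha> \<in> exps n d" for \<alpha> i
    using lookup_le_exps[OF that, of i] by (simp add: B_def)
  have low: "low \<alpha> < B ^ n" if "\<alpha> \<in> exps n d" for \<alpha>
    unfolding low_def using digit[OF that] by (rule digit_sum)
  have low_alt: "low \<alpha> = (\<Sum>i<n. expo \<alpha> i * B ^ (n - Suc i))" for \<alpha>
    using sum.nat_diff_reindex[of "\<lambda>i. expo \<alpha> i * B ^ (n - Suc i)" n]
    by (simp add: low_def)
  have wt: "exp_weight n c \<alpha> = B ^ n * (\<Sum>i<j. expo \<alpha> i) + low \<alpha>" for \<alpha>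
  proof -
    have "exp_weight n c \<alpha> = (\<Sum>i<n. if i < j then B ^ n * expo \<alpha> i else 0) + low \<alpha>"
      unfolding exp_weight_def low_alt sum.distrib[symmetric]
      by (intro sum.cong) (auto simp: c_def algebra_simps)
    also have "(\<Sum>i<n. if i < j then B ^ n * expo \<alpha> i else 0) = (\<Sum>i<j. B ^ n * expo \<alpha> i)"
      using assms by (intro sum.mono_neutral_cong_right) auto
    finally show ?thesis by (simp add: sum_distrib_left)
  qed
  show ?thesis
  proof (rule that[of c])
    fix i k assume "i < k" "k < n"
    then have "B ^ (n - Suc k) < B ^ (n - Suc i)" by (intro power_strict_increasing) (auto simp: B_def)
    then show "c k < c i" using \<open>i < k\<close> by (auto simp: c_def)
  next
    show "inj_on (exp_weight n c) (exps n d)"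
    proof (rule inj_onI)
      fix \<alpha> \<beta> assume a: "\<alpha> \<in> exps n d" "\<beta> \<in> exps n d" "exp_weight n c \<alpha> = exp_weight n c \<beta>"
      have "exp_weight n c \<gamma> mod B ^ n = low \<gamma>" if "\<gamma> \<in> exps n d" for \<gamma>
        using low[OF that] by (simp add: wt)
      then have "exp_weight n c \<alpha> mod B ^ n = low \<alpha>" "exp_weight n c \<beta> mod B ^ n = low \<beta>"
        using a(1,2) by blast+
      then have "low \<alpha> = low \<beta>" using a(3) by metis
      then have *: "expo \<alpha> (n - Suc i) = expo \<beta> (n - Suc i)" if "i < n" for i
        unfolding low_def using digit a that
        by (intro digits_unique[of n "\<lambda>i. expo \<alpha> (n - Suc i)" B "\<lambda>i. expo \<beta> (n - Suc i)"]) auto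
      show "\<alpha> = \<beta>"
      proof (rule poly_mapping_eqI)
        fix i
        show "expo \<alpha> i = expo \<beta> i"
        proof (cases "i < n")
          case True
          then show ?thesis using *[of "n - Suc i"] by (simp add: Suc_diff_Suc)
        next
          case False
          then show ?thesis using a(1,2) lookup_outside[of \<alpha> n i] lookup_outside[of \<beta> n i] by (simp add: exps_def)
        qed
      qed
    qed
  next
    fix \<alpha> \<beta> assume a: "\<alpha> \<in> exps n d" "\<beta> \<in> exps n d" "exp_weight n c \<alpha> \<le> exp_weight n c \<beta>"
    let ?p = "\<lambda>\<alpha>. \<Sum>i<j. expo \<alpha> i"
    have "B ^ n * ?p \<alpha> < B ^ n * Suc (?p \<beta>)"
      using a low[of \<beta>] by (simp add: wt)
    then have "?p \<alpha> < Suc (?p \<beta>)" by (simp only: mult_less_cancel1)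
    then show "?p \<alpha> \<le> ?p \<beta>" by simp
  qed
qed

text \<open>Dominance order, on multisets.\<close>

definition mdom :: "nat multiset \<Rightarrow> nat multiset \<Rightarrow> bool" where
  "mdom M N \<longleftrightarrow> dominated (part_list M) (part_list N)"

lemma sum_list_take_eq: "sum_list (take j xs) = (\<Sum>i<j. nth_default 0 xs i)" for xs :: "nat list"
proof (induction j)
  case (Suc j)
  show ?case
  proof (cases "j < length xs")
    case True
    then show ?thesis using Suc by (simp add: take_Suc_conv_app_nth nth_default_nth)
  next
    case False
    then show ?thesis using Suc by (simp add: nth_default_beyond)
  qed
qed simp

lemma mdom_iff:
  "mdom M N \<longleftrightarrow> sum_mset M = sum_mset N \<and>
     (\<forall>j. (\<Sum>i<j. expo (top_exp M) i) \<le> (\<Sum>i<j. expo (top_exp N) i))"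
  by (simp add: mdom_def dominated_def sum_list_take_eq top_exp_def)

lemma mdom_refl: "mdom M M" and mdom_trans: "mdom L M \<Longrightarrow> mdom M N \<Longrightarrow> mdom L N"
  by (auto simp: mdom_iff intro: order.trans)

lemma mdom_antisym:
  assumes "mdom M N" "mdom N M" "0 \<notin># M" "0 \<notin># N"
  shows "M = N"
proof -
  have eq: "(\<Sum>i<j. expo (top_exp M) i) = (\<Sum>i<j. expo (top_exp N) i)" for j
    using assms(1,2) by (auto simp: mdom_iff intro: antisym)
  have "expo (top_exp M) i = expo (top_exp N) i" for i
    using eq[of "Suc i"] eq[of i] by simp
  then have "top_exp M = top_exp N" by (intro poly_mapping_eqI)
  then show ?thesis using assms(3,4) by (metis mono_type_top_exp)
qed

definition mdom_strict :: "nat multiset \<Rightarrow> nat multiset \<Rightarrow> bool" where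
  "mdom_strict M N \<longleftrightarrow> mdom M N \<and> M \<noteq> N"

lemma transp_mdom_strict: "transp_on (parts d) mdom_strict"
  by (rule transp_onI) (metis mdom_strict_def mdom_trans mdom_antisym parts_def mem_Collect_eq)

lemma asymp_mdom_strict: "asymp_on (parts d) mdom_strict"
  by (rule asymp_onI) (auto simp: mdom_strict_def parts_def dest: mdom_antisym)

section \<open>The eigenvalues\<close>

definition eigval :: "nat \<Rightarrow> 'a \<Rightarrow> 'a \<Rightarrow> nat multiset \<Rightarrow> 'a::field_char_0" where
  "eigval n q t N = (\<Sum>i<n. t ^ (n - 1 - i) * q ^ expo (top_exp N) i)"

text \<open>The eigenvalue of \<open>coord_op\<close>. It is independent of the number of variables, because zero parts contribute nothing.\<close>

definition stable_eigval :: "'a \<Rightarrow> 'a \<Rightarrow> nat multiset \<Rightarrow> 'a::field_char_0" where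
  "stable_eigval q t N = 1 + (t - 1) * (\<Sum>i<size N. inverse t ^ Suc i * (q ^ expo (top_exp N) i - 1))"

lemma eigval_stable:
  assumes "size N \<le> n" and t: "t \<noteq> 0"
  shows "(t - 1) * eigval n q t N + 1 = t ^ n * stable_eigval q t N"
proof -
  let ?l = "expo (top_exp N)"
  have "(\<Sum>i<n. t ^ (n - 1 - i)) = (\<Sum>i<n. t ^ i)"
    using sum.nat_diff_reindex[of "\<lambda>i. t ^ i" n] by simp
  then have 1: "(t - 1) * (\<Sum>i<n. t ^ (n - 1 - i)) + 1 = t ^ n"
    by (simp only: power_diff_1_eq[symmetric]) simp
  have "(\<Sum>i<size N. inverse t ^ Suc i * (q ^ ?l i - 1)) = (\<Sum>i<n. inverse t ^ Suc i * (q ^ ?l i - 1))"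
    using assms(1) by (intro sum.mono_neutral_left) (auto simp: lookup_top_exp_outside)
  then have "t ^ n * (\<Sum>i<size N. inverse t ^ Suc i * (q ^ ?l i - 1)) = (\<Sum>i<n. (t ^ n * inverse t ^ Suc i) * (q ^ ?l i - 1))"
    by (simp add: sum_distrib_left mult.assoc)
  also have "\<dots> = (\<Sum>i<n. t ^ (n - 1 - i) * (q ^ ?l i - 1))"
  proof (rule sum.cong[OF refl])
    fix i assume "i \<in> {..<n}"
    then have "t ^ n = t ^ (n - 1 - i) * t ^ Suc i" by (simp flip: power_add power_Suc)
    then have "t ^ n * inverse t ^ Suc i = t ^ (n - 1 - i)"
      using t by (simp only: mult.assoc power_mult_distrib[symmetric]) simp
    then show "t ^ n * inverse t ^ Suc i * (q ^ ?l i - 1) = t ^ (n - 1 - i) * (q ^ ?l i - 1)" by simp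
  qed
  also have "\<dots> = eigval n q t N - (\<Sum>i<n. t ^ (n - 1 - i))"
    by (simp add: eigval_def right_diff_distrib sum_subtractf)
  finally have 2: "t ^ n * (\<Sum>i<size N. inverse t ^ Suc i * (q ^ ?l i - 1)) = eigval n q t N - (\<Sum>i<n. t ^ (n - 1 - i))" .
  have "t ^ n * stable_eigval q t N = t ^ n + (t - 1) * (t ^ n * (\<Sum>i<size N. inverse t ^ Suc i * (q ^ ?l i - 1)))"
    by (simp add: stable_eigval_def algebra_simps)
  also have "\<dots> = ((t - 1) * (\<Sum>i<n. t ^ (n - 1 - i)) + 1) + (t - 1) * (eigval n q t N - (\<Sum>i<n. t ^ (n - 1 - i)))"
    by (simp only: 1 2)
  finally show ?thesis by (simp add: algebra_simps)
qed

text \<open>\<open>N\<close> is the type of the monomial of maximal weight in \<open>v\<close>. It has decreasing exponents by \<open>exchange_exponents\<close>, and no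
  other monomial has the same weight, so that \<open>mac_op_leading\<close> speaks about single coefficients.\<close>

lemma mac_op_dominant:
  fixes v w :: "nat multiset \<Rightarrow> 'a::field_char_0"
  assumes c: "\<And>i j. i < j \<Longrightarrow> j < n \<Longrightarrow> c j < c i" and inj: "inj_on (exp_weight n c) (exps n d)"
    and eq: "\<And>x. good_point n x \<Longrightarrow> mac_op n q t (eval_coords n d v) x = eval_coords n d w x"
    and ex: "\<exists>\<alpha>\<in>exps n d. v (mono_type \<alpha>) \<noteq> 0"
  obtains N where "N \<in> parts d" "size N \<le> n" "v N \<noteq> 0" "w N = eigval n q t N * v N"
    and "\<And>\<beta>. \<beta> \<in> exps n d \<Longrightarrow> w (mono_type \<beta>) \<noteq> 0 \<Longrightarrow> exp_weight n c \<beta> \<le> exp_weight n c (top_exp N)"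
proof -
  let ?wt = "exp_weight n c"
  define S where "S = {\<alpha>\<in>exps n d. v (mono_type \<alpha>) \<noteq> 0}"
  have "finite (?wt ` S)" "?wt ` S \<noteq> {}" using ex by (auto simp: S_def)
  then obtain \<alpha> where \<alpha>: "\<alpha> \<in> S" and "?wt \<alpha> = Max (?wt ` S)" by (metis (no_types, lifting) Max_in imageE)
  then have max: "?wt \<beta> \<le> ?wt \<alpha>" if "\<beta> \<in> S" for \<beta> using that \<open>finite (?wt ` S)\<close> by simp
  have \<alpha>_exps: "\<alpha> \<in> exps n d" and nz: "v (mono_type \<alpha>) \<noteq> 0" using \<alpha> by (auto simp: S_def)
  have top: "\<alpha> = top_exp (mono_type \<alpha>)"
  proof (rule decreasing_eq_top_exp[OF \<alpha>_exps])
    fix i j assume ij: "i < j" "j < n"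
    show "expo \<alpha> j \<le> expo \<alpha> i"
    proof (rule ccontr)
      assume "\<not> ?thesis"
      then obtain \<beta> where "\<beta> \<in> exps n d" "mono_type \<beta> = mono_type \<alpha>" "?wt \<alpha> < ?wt \<beta>"
        using exchange_exponents[OF \<alpha>_exps ij _ c[OF ij]] by (metis not_le)
      then show False using max[of \<beta>] nz by (simp add: S_def)
    qed
  qed
  have single: "{\<beta>\<in>exps n d. ?wt \<beta> = ?wt \<gamma>} = {\<gamma>}" if "\<gamma> \<in> exps n d" for \<gamma>
    using inj that by (auto dest: inj_onD)
  note lead = mac_op_leading[OF c eq, where m = "?wt \<alpha>"]
  show ?thesis
  proof (rule that[of "mono_type \<alpha>"])
    show "mono_type \<alpha> \<in> parts d" "size (mono_type \<alpha>) \<le> n" "v (mono_type \<alpha>) \<noteq> 0"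
      using \<alpha>_exps nz by (auto simp: mono_type_exps size_le_exps)
    have "(\<Sum>\<beta>\<in>{\<beta>\<in>exps n d. ?wt \<beta> = ?wt \<alpha>}. w (mono_type \<beta>)) = (\<Sum>\<beta>\<in>{\<beta>\<in>exps n d. ?wt \<beta> = ?wt \<alpha>}.
           v (mono_type \<beta>) * (\<Sum>i<n. t ^ (n - 1 - i) * q ^ expo \<beta> i))"
      by (rule lead(2)) (use max in \<open>auto simp: S_def\<close>)
    then show "w (mono_type \<alpha>) = eigval n q t (mono_type \<alpha>) * v (mono_type \<alpha>)"
      by (simp add: single[OF \<alpha>_exps] eigval_def top[symmetric] mult.commute)
    fix \<beta> assume \<beta>: "\<beta> \<in> exps n d" "w (mono_type \<beta>) \<noteq> 0"
    show "?wt \<beta> \<le> ?wt (top_exp (mono_type \<alpha>))"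
    proof (rule ccontr)
      assume "\<not> ?thesis"
      then have "?wt \<alpha> < ?wt \<beta>" by (simp add: top[symmetric])
      then have "(\<Sum>\<gamma>\<in>{\<gamma>\<in>exps n d. ?wt \<gamma> = ?wt \<beta>}. w (mono_type \<gamma>)) = 0"
        by (intro lead(1)) (use max in \<open>auto simp: S_def\<close>)
      then show False using \<beta> by (simp add: single)
    qed
  qed
qed

lemma mac_op_eigenvalue:
  fixes v :: "nat multiset \<Rightarrow> 'a::field_char_0"
  assumes eq: "\<And>x. good_point n x \<Longrightarrow> mac_op n q t (eval_coords n d v) x = e * eval_coords n d v x"
    and ex: "M \<in> parts d" "size M \<le> n" "v M \<noteq> 0"
  obtains N where "N \<in> parts d" "size N \<le> n" "v N \<noteq> 0" "e = eigval n q t N"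
proof -
  obtain c :: "nat \<Rightarrow> nat" where c: "\<And>i k. i < k \<Longrightarrow> k < n \<Longrightarrow> c k < c i" and inj: "inj_on (exp_weight n c) (exps n d)"
    using dominance_weight[of 0 n d] by auto
  have eq': "mac_op n q t (eval_coords n d v) x = eval_coords n d (\<lambda>N. e * v N) x" if "good_point n x" for x
    using eq[OF that] by (simp add: eval_coords_def sum_distrib_left mult.assoc)
  have "\<exists>\<alpha>\<in>exps n d. v (mono_type \<alpha>) \<noteq> 0"
    using ex top_exp_in_exps[of M d n] by (intro bexI[of _ "top_exp M"]) (auto simp: parts_def)
  from mac_op_dominant[OF c inj eq' this]
  obtain N where "N \<in> parts d" "size N \<le> n" "v N \<noteq> 0" "e * v N = eigval n q t N * v N" by blast
  then show ?thesis using that by simp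
qed

section \<open>Triangularity with respect to monomial symmetric functions\<close>

definition unit_vec :: "nat multiset \<Rightarrow> nat multiset \<Rightarrow> 'a::field_char_0" where
  "unit_vec M N = (if N = M then 1 else 0)"

lemma homogeneous_unit_vec: "M \<in> parts d \<Longrightarrow> homogeneous d (unit_vec M)"
  by (simp add: homogeneous_def unit_vec_def)

lemma psum_coeffs_sum:
  assumes "\<And>i. i \<in> A \<Longrightarrow> homogeneous d (f i)"
  shows "psum_coeffs (\<lambda>N. \<Sum>i\<in>A. a i * f i N) = (\<lambda>M. \<Sum>i\<in>A. a i * psum_coeffs (f i) M)"
proof (rule psum_coeffs_unique[of d])
  show "homogeneous d (\<lambda>M. \<Sum>i\<in>A. a i * psum_coeffs (f i) M)"
    unfolding homogeneous_def
  proof (intro allI impI)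
    fix M assume "(\<Sum>i\<in>A. a i * psum_coeffs (f i) M) \<noteq> 0"
    then obtain i where "i \<in> A" "psum_coeffs (f i) M \<noteq> 0"
      by (metis (no_types, lifting) mult_not_zero sum.not_neutral_contains_not_neutral)
    then show "M \<in> parts d" using psum_expansion(1)[OF assms] by (auto simp: homogeneous_def)
  qed
  fix N
  have "(\<Sum>i\<in>A. a i * f i N) = (\<Sum>i\<in>A. a i * (\<Sum>M\<in>parts d. psum_coeffs (f i) M * pvec M N))"
    using psum_expansion(2)[OF assms] by (intro sum.cong refl) simp
  also have "\<dots> = (\<Sum>M\<in>parts d. (\<Sum>i\<in>A. a i * psum_coeffs (f i) M) * pvec M N)"
    unfolding sum_distrib_left sum_distrib_right by (subst sum.swap) (simp add: mult.assoc)
  finally show "(\<Sum>i\<in>A. a i * f i N) = (\<Sum>M\<in>parts d. (\<Sum>i\<in>A. a i * psum_coeffs (f i) M) * pvec M N)" .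
qed

lemma homogeneous_unit_expansion:
  assumes "homogeneous d v"
  shows "v = (\<lambda>N. \<Sum>M\<in>parts d. v M * unit_vec M N)"
proof
  fix N
  have "(\<Sum>M\<in>parts d. v M * unit_vec M N) = (\<Sum>M\<in>parts d. if N = M then v M else 0)"
    by (intro sum.cong) (auto simp: unit_vec_def)
  then show "v N = (\<Sum>M\<in>parts d. v M * unit_vec M N)"
    using assms by (auto simp: sum.delta homogeneous_def)
qed

lemma coord_op_linear:
  assumes "homogeneous d v"
  shows "coord_op q t d v N = (\<Sum>M\<in>parts d. v M * coord_op q t d (unit_vec M) N)"
proof -
  have p: "psum_coeffs v = (\<lambda>L. \<Sum>M\<in>parts d. v M * psum_coeffs (unit_vec M) L)"
    by (subst homogeneous_unit_expansion[OF assms], rule psum_coeffs_sum[of _ d], rule homogeneous_unit_vec)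
  have "coord_op q t d v N = (\<Sum>L\<in>parts d. \<Sum>K\<in>parts d. \<Sum>M\<in>parts d. v M * psum_coeffs (unit_vec M) K * trans_coeff q t K L * pvec L N)"
    by (simp add: coord_op_def p sum_distrib_right)
  also have "\<dots> = (\<Sum>L\<in>parts d. \<Sum>M\<in>parts d. \<Sum>K\<in>parts d. v M * psum_coeffs (unit_vec M) K * trans_coeff q t K L * pvec L N)"
    by (intro sum.cong refl sum.swap)
  also have "\<dots> = (\<Sum>M\<in>parts d. \<Sum>L\<in>parts d. \<Sum>K\<in>parts d. v M * psum_coeffs (unit_vec M) K * trans_coeff q t K L * pvec L N)"
    by (rule sum.swap)
  also have "\<dots> = (\<Sum>M\<in>parts d. v M * coord_op q t d (unit_vec M) N)"
    by (simp add: coord_op_def sum_distrib_right sum_distrib_left mult.assoc)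
  finally show ?thesis .
qed

lemma mac_op_coord_op:
  fixes v :: "nat multiset \<Rightarrow> 'a::field_char_0"
  assumes "homogeneous d v" and "good_point n x" and "t \<noteq> 0" and "t \<noteq> 1"
  shows "mac_op n q t (eval_coords n d v) x = eval_coords n d (\<lambda>N. (t ^ n * coord_op q t d v N - v N) / (t - 1)) x"
proof -
  have "eval_coords n d (\<lambda>N. (t ^ n * coord_op q t d v N - v N) / (t - 1)) x
      = (t ^ n * eval_coords n d (coord_op q t d v) x - eval_coords n d v x) / (t - 1)"
    by (simp add: eval_coords_def sum_divide_distrib sum_distrib_left sum_subtractf[symmetric] field_simps)
  also have "\<dots> = (t - 1) * mac_op n q t (eval_coords n d v) x / (t - 1)"
    using mac_op_eval_coords[OF assms(1-3), of q] by (simp add: algebra_simps)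
  finally show ?thesis using assms(4) by simp
qed

text \<open>Apply \<open>mac_op_dominant\<close> to a single monomial symmetric function, in \<open>d\<close> variables. For every \<open>j\<close> the weights of
  \<open>dominance_weight\<close> bound the partial sums up to \<open>j\<close> of all partitions that occur in the image; together this is dominance.\<close>

lemma coord_op_triangular:
  fixes q t :: "'a::field_char_0"
  assumes L: "L \<in> parts d" and t: "t \<noteq> 0" "t \<noteq> 1"
  shows "coord_op q t d (unit_vec L) L = stable_eigval q t L"
    and "coord_op q t d (unit_vec L) N \<noteq> 0 \<Longrightarrow> N = L \<or> (N \<in> parts d \<and> mdom_strict N L)"
proof -
  let ?v = "unit_vec L :: nat multiset \<Rightarrow> 'a"
  let ?w = "\<lambda>N. (t ^ d * coord_op q t d ?v N - ?v N) / (t - 1)"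
  have size: "size N \<le> d" if "N \<in> parts d" for N using that by (rule size_le_parts)
  have eq: "mac_op d q t (eval_coords d d ?v) x = eval_coords d d ?w x" if "good_point d x" for x
    using mac_op_coord_op[OF homogeneous_unit_vec[OF L] that t] .
  have ex: "\<exists>\<alpha>\<in>exps d d. ?v (mono_type \<alpha>) \<noteq> 0"
    using L size[OF L] by (intro bexI[of _ "top_exp L"] top_exp_in_exps) (auto simp: unit_vec_def parts_def)
  have dom: "?w L = eigval d q t L \<and> (\<forall>N\<in>parts d. ?w N \<noteq> 0 \<longrightarrow>
      (\<Sum>i<j. expo (top_exp N) i) \<le> (\<Sum>i<j. expo (top_exp L) i))" if j: "j \<le> d" for j
  proof -
    obtain c where c: "\<And>i k. i < k \<Longrightarrow> k < d \<Longrightarrow> c k < (c i :: nat)" "inj_on (exp_weight d c) (exps d d)"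
      and le: "\<And>\<alpha> \<beta>. \<alpha> \<in> exps d d \<Longrightarrow> \<beta> \<in> exps d d \<Longrightarrow> exp_weight d c \<alpha> \<le> exp_weight d c \<beta> \<Longrightarrow>
       (\<Sum>i<j. expo \<alpha> i) \<le> (\<Sum>i<j. expo \<beta> i)"
      using dominance_weight[OF j, of d] by blast
    obtain N where N: "N \<in> parts d" "?v N \<noteq> 0" "?w N = eigval d q t N * ?v N"
      and max: "\<And>\<beta>. \<beta> \<in> exps d d \<Longrightarrow> ?w (mono_type \<beta>) \<noteq> 0 \<Longrightarrow> exp_weight d c \<beta> \<le> exp_weight d c (top_exp N)"
      using mac_op_dominant[OF c eq ex] by blast
    have [simp]: "N = L" using N(2) by (simp add: unit_vec_def split: if_splits)
    have "(\<Sum>i<j. expo (top_exp K) i) \<le> (\<Sum>i<j. expo (top_exp L) i)"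
      if K: "K \<in> parts d" "?w K \<noteq> 0" for K
      using max[of "top_exp K"] K L size
      by (intro le) (auto simp: top_exp_in_exps parts_def)
    then show ?thesis using N(3) by (simp add: unit_vec_def)
  qed
  have "?w L = eigval d q t L" using dom[of d] by simp
  then have "t ^ d * coord_op q t d ?v L = (t - 1) * eigval d q t L + 1"
    using t(2) by (simp add: unit_vec_def field_simps)
  then show "coord_op q t d ?v L = stable_eigval q t L"
    using eigval_stable[OF size[OF L] t(1), of q] t(1) by simp
  assume nz: "coord_op q t d ?v N \<noteq> 0"
  then have N: "N \<in> parts d" using homogeneous_coord_op[of d q t ?v] by (simp add: homogeneous_def)
  show "N = L \<or> (N \<in> parts d \<and> mdom_strict N L)"
  proof (cases "N = L")
    case False
    then have "?w N \<noteq> 0" using nz t by (simp add: unit_vec_def)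
    have "(\<Sum>i<j. expo (top_exp N) i) \<le> (\<Sum>i<j. expo (top_exp L) i)" for j
    proof (cases "j \<le> d")
      case True
      then show ?thesis using dom N \<open>?w N \<noteq> 0\<close> by blast
    next
      case False
      have "(\<Sum>i<j. expo (top_exp K) i) = d" if K: "K \<in> parts d" for K
      proof -
        have "top_exp K \<in> exps j d" using K size[OF K] False by (intro top_exp_in_exps) auto
        then show ?thesis by (simp add: in_exps_iff)
      qed
      then show ?thesis using N L by simp
    qed
    then show ?thesis using False N L by (auto simp: mdom_strict_def mdom_iff parts_def)
  qed simp
qed

section \<open>Generic parameters\<close>

text \<open>The eigenvalues of Macdonald's operator in each number of variables separate partitions. This alone implies that
  \<open>q\<close> and \<open>t\<close> are nonzero and not roots of unity, and it is inherited by \<open>inverse q\<close> and \<open>inverse t\<close>.\<close>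

locale generic_qt =
  fixes q t :: "'a::field_char_0"
  assumes generic: "(\<Sum>i<n. t ^ i * q ^ f i) = (\<Sum>i<n. t ^ i * q ^ g i) \<Longrightarrow> i < n \<Longrightarrow> f i = (g i :: nat)"
begin

lemma q_power_inj: "q ^ a = q ^ b \<Longrightarrow> a = b"
  using generic[of "\<lambda>_. a" 1 "\<lambda>_. b" 0] by simp

lemma q_nonzero: "q \<noteq> 0"
  using q_power_inj[of 1 2] by auto

lemma q_power_ne_1: "r > 0 \<Longrightarrow> q ^ r \<noteq> 1"
  using q_power_inj[of r 0] by auto

lemma t_power_ne_1:
  assumes "r > 0"
  shows "t ^ r \<noteq> 1"
proof
  assume t: "t ^ r = 1"
  have "(\<Sum>i<r. t ^ i * q ^ (if i = 0 then 1 else 0)) = (\<Sum>i<r. t ^ i) + (q - 1)"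
  proof -
    have "(\<Sum>i<r. t ^ i * q ^ (if i = 0 then 1 else 0)) = (\<Sum>i<r. t ^ i + (if i = 0 then q - 1 else 0))"
      by (intro sum.cong) auto
    then show ?thesis using assms by (simp add: sum.distrib)
  qed
  then have "(\<Sum>i<Suc r. t ^ i * q ^ (if i = 0 then 1 else 0)) = (\<Sum>i<Suc r. t ^ i * q ^ (if i = r then 1 else 0))"
    using assms t by simp
  then show False using generic[of "\<lambda>i. if i = 0 then 1 else 0" "Suc r" "\<lambda>i. if i = r then 1 else 0" 0] assms by simp
qed

lemma t_ne_1: "t \<noteq> 1"
  using t_power_ne_1[of 1] by simp

lemma t_nonzero: "t \<noteq> 0"
proof
  assume "t = 0"
  then have "(\<Sum>i<2. t ^ i * q ^ (if i = 0 then 0 else 1)) = (\<Sum>i<2. t ^ i * q ^ (if i = 0 then 0 else 2))"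
    by (simp add: numeral_2_eq_2)
  then show False
    using generic[of "\<lambda>i. if i = 0 then 0 else 1" 2 "\<lambda>i. if i = 0 then 0 else 2" 1] by simp
qed

lemma eigval_inj:
  assumes eq: "eigval n q t M = eigval n q t N" and size: "size M \<le> n" "size N \<le> n" and pos: "0 \<notin># M" "0 \<notin># N"
  shows "M = N"
proof -
  have e: "eigval n q t K = (\<Sum>i<n. t ^ i * q ^ expo (top_exp K) (n - Suc i))" for K
    unfolding eigval_def
    using sum.nat_diff_reindex[of "\<lambda>i. t ^ (n - 1 - i) * q ^ expo (top_exp K) i" n, symmetric]
    by (auto intro: sum.cong)
  have *: "expo (top_exp M) (n - Suc i) = expo (top_exp N) (n - Suc i)" if "i < n" for i
    using generic[of "\<lambda>i. expo (top_exp M) (n - Suc i)" n "\<lambda>i. expo (top_exp N) (n - Suc i)" i]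
      that eq by (simp add: e)
  have "expo (top_exp M) i = expo (top_exp N) i" for i
  proof (cases "i < n")
    case True
    then show ?thesis using *[of "n - Suc i"] by (simp add: Suc_diff_Suc)
  next
    case False
    then show ?thesis using size by (simp add: lookup_top_exp_outside)
  qed
  then have "top_exp M = top_exp N" by (intro poly_mapping_eqI)
  then show ?thesis using pos by (metis mono_type_top_exp)
qed

lemma stable_eigval_inj:
  assumes "stable_eigval q t M = stable_eigval q t N" and "M \<in> parts d" and "N \<in> parts d"
  shows "M = N"
proof (rule eigval_inj)
  have "(t - 1) * eigval d q t M = (t - 1) * eigval d q t N"
    using eigval_stable[OF size_le_parts[OF assms(2)] t_nonzero, of q]
      eigval_stable[OF size_le_parts[OF assms(3)] t_nonzero, of q] assms(1) by (metis add_right_cancel)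
  then show "eigval d q t M = eigval d q t N" using t_ne_1 by simp
qed (use assms size_le_parts[OF assms(2)] size_le_parts[OF assms(3)] in \<open>auto simp: parts_def\<close>)

lemma qt_norm_mset_nonzero: "0 \<notin># M \<Longrightarrow> qt_norm_mset q t M \<noteq> 0"
proof -
  assume M: "0 \<notin># M"
  have "(1 - q ^ r) / (1 - t ^ r) \<noteq> 0" if "r \<in># M" for r
  proof -
    have "r > 0" using M that by (metis neq0_conv)
    then show ?thesis using q_power_ne_1[of r] t_power_ne_1[of r] by simp
  qed
  then show ?thesis using zee_pos[OF M] by (auto simp: qt_norm_mset_def prod_mset_zero_iff)
qed

end

section \<open>The inner product\<close>

text \<open>The inner product \<open>qt_inner\<close> in degree \<open>d\<close>, as a function of monomial coordinates.\<close>

definition form :: "'a \<Rightarrow> 'a \<Rightarrow> nat \<Rightarrow> (nat multiset \<Rightarrow> 'a) \<Rightarrow> (nat multiset \<Rightarrow> 'a) \<Rightarrow> 'a::field_char_0" where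
  "form q t d v w = (\<Sum>M\<in>parts d. psum_coeffs v M * psum_coeffs w M * qt_norm_mset q t M)"

lemma z_number_eq_zee: "z_number \<rho> = zee (mset \<rho>)"
  by (simp add: z_number_def zee_def count_mset)

lemma qt_norm_eq: "qt_norm q t \<rho> = qt_norm_mset q t (mset \<rho>)"
  by (simp add: qt_norm_def qt_norm_mset_def z_number_eq_zee flip: mset_map prod_mset_prod_list)

lemma power_sum_coeffs_eq:
  assumes "homogeneous d v"
  shows "power_sum_coeffs (sym_series v) \<rho> = (if is_partition \<rho> then psum_coeffs v (mset \<rho>) else 0)"
  using power_sum_coeffs_sym_series[OF psum_expansion[OF assms]] by simp

lemma qt_inner_sym_series:
  assumes v: "homogeneous d v" and w: "homogeneous e w"
  shows "qt_inner q t (sym_series v) (sym_series w) = form q t d v w"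
proof -
  let ?f = "\<lambda>M. psum_coeffs v M * psum_coeffs w M * qt_norm_mset q t M"
  let ?S = "{\<rho>. power_sum_coeffs (sym_series v) \<rho> \<noteq> 0}"
  have S: "is_partition \<rho>" "psum_coeffs v (mset \<rho>) \<noteq> 0" if "\<rho> \<in> ?S" for \<rho>
    using that by (auto simp: power_sum_coeffs_eq[OF v] split: if_splits)
  have "qt_inner q t (sym_series v) (sym_series w) = (\<Sum>\<rho>\<in>?S. ?f (mset \<rho>))"
    unfolding qt_inner_def
    by (intro sum.cong refl) (auto simp: power_sum_coeffs_eq[OF v] power_sum_coeffs_eq[OF w] qt_norm_eq split: if_splits)
  also have "\<dots> = (\<Sum>M\<in>mset ` ?S. ?f M)"
    by (subst sum.reindex) (auto intro!: inj_onI, metis S(1) mem_Collect_eq part_list_mset)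
  also have "\<dots> = form q t d v w"
    unfolding form_def
  proof (rule sum.mono_neutral_left)
    show "mset ` ?S \<subseteq> parts d"
      using S(2) psum_expansion(1)[OF v] by (auto simp: homogeneous_def)
    show "\<forall>M\<in>parts d - mset ` ?S. ?f M = 0"
    proof
      fix M assume M: "M \<in> parts d - mset ` ?S"
      then have "is_partition (part_list M)" by (intro is_partition_part_list) (auto simp: parts_def)
      moreover have "part_list M \<notin> ?S" using M by (metis DiffD2 image_eqI mset_part_list)
      ultimately have "psum_coeffs v M = 0" by (simp add: power_sum_coeffs_eq[OF v])
      then show "?f M = 0" by simp
    qed
  qed simp
  finally show ?thesis .
qed

lemma form_commute: "form q t d v w = form q t d w v"
  by (simp add: form_def mult.commute mult.left_commute)

lemma form_degree_mismatch:
  assumes "homogeneous d v" and "homogeneous e w" and "d \<noteq> e"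
  shows "form q t d v w = 0"
  unfolding form_def using psum_expansion(1)[OF assms(2)] assms(3)
  by (intro sum.neutral) (auto simp: homogeneous_def parts_def)

lemma form_sum_left:
  assumes "\<And>i. i \<in> A \<Longrightarrow> homogeneous d (f i)"
  shows "form q t d (\<lambda>N. \<Sum>i\<in>A. a i * f i N) w = (\<Sum>i\<in>A. a i * form q t d (f i) w)"
  by (simp only: form_def psum_coeffs_sum[OF assms] sum_distrib_left sum_distrib_right mult.assoc)
     (rule sum.swap)

lemma form_scale_left:
  assumes "homogeneous d v"
  shows "form q t d (\<lambda>N. c * v N) w = c * form q t d v w"
  using form_sum_left[of "{()}" d "\<lambda>_. v" q t "\<lambda>_. c" w] assms by simp

lemma form_diff_left:
  assumes "homogeneous d v" and "homogeneous d v'"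
  shows "form q t d (\<lambda>N. v N - v' N) w = form q t d v w - form q t d v' w"
  using form_sum_left[of "{True, False}" d "\<lambda>b. if b then v else v'" q t "\<lambda>b. if b then 1 else -1" w] assms
  by simp

lemma form_pvec:
  assumes "M \<in> parts d"
  shows "form q t d v (pvec M) = psum_coeffs v M * qt_norm_mset q t M"
proof -
  have "psum_coeffs (pvec M) = (\<lambda>N. if N = M then 1 else (0::'a))"
    by (rule psum_coeffs_unique[of d])
       (use assms in \<open>auto simp: homogeneous_def if_distrib[of "\<lambda>c. c * _"] cong: if_cong\<close>)
  then have "form q t d v (pvec M) = (\<Sum>N\<in>parts d. if N = M then psum_coeffs v M * qt_norm_mset q t M else 0)"
    unfolding form_def by (intro sum.cong) auto
  then show ?thesis using assms by simp
qed

section \<open>Existence and uniqueness of Macdonald's symmetric functions\<close>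

text \<open>The shape that \<open>macdonald_family\<close> demands of its members.\<close>

definition unitriangular :: "nat multiset \<Rightarrow> (nat multiset \<Rightarrow> 'a::field_char_0) \<Rightarrow> bool" where
  "unitriangular L v \<longleftrightarrow> v L = 1 \<and> (\<forall>N. v N \<noteq> 0 \<longrightarrow> N = L \<or> (N \<in> parts (sum_mset L) \<and> mdom_strict N L))"

lemma homogeneous_unitriangular: "0 \<notin># L \<Longrightarrow> unitriangular L v \<Longrightarrow> homogeneous (sum_mset L) v"
  by (auto simp: unitriangular_def homogeneous_def parts_def)

lemma unitriangular_span:
  fixes V :: "nat multiset \<Rightarrow> nat multiset \<Rightarrow> 'a::field_char_0"
  assumes V: "\<And>L. L \<in> parts d \<Longrightarrow> unitriangular L (V L)"
    and J: "J \<subseteq> parts d" "\<And>M N. M \<in> J \<Longrightarrow> N \<in> parts d \<Longrightarrow> mdom_strict N M \<Longrightarrow> N \<in> J"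
    and w: "\<And>N. w N \<noteq> 0 \<Longrightarrow> N \<in> J"
  shows "\<exists>a. w = (\<lambda>N. \<Sum>L\<in>J. a L * V L N)"
proof -
  have "\<exists>a. (\<forall>j. a j \<noteq> 0 \<longrightarrow> j \<in> J) \<and> (\<forall>N. w N = (\<Sum>L\<in>J. a L * V L N))"
  proof (rule triangular_span[where R = mdom_strict])
    show "finite J" "transp_on J mdom_strict" "asymp_on J mdom_strict"
      using J(1) finite_subset[OF J(1)] transp_on_subset[OF transp_mdom_strict] asymp_on_subset[OF asymp_mdom_strict]
      by auto
    fix L assume L: "L \<in> J"
    then have L': "L \<in> parts d" "sum_mset L = d" using J(1) by (auto simp: parts_def)
    show "V L L \<noteq> 0" using V[OF L'(1)] by (simp add: unitriangular_def)
    show "N = L \<or> N \<in> J \<and> mdom_strict N L" if "V L N \<noteq> 0" for N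
      using V[OF L'(1)] that J(2)[OF L] L'(2) by (auto simp: unitriangular_def)
  qed (use w in auto)
  then show ?thesis by (auto simp: fun_eq_iff)
qed

text \<open>Translation between sums over partitions given as lists and coordinates on multisets.\<close>

lemma unitriangular_series_iff:
  fixes f :: "'a::field_char_0 series"
  assumes \<nu>: "is_partition \<nu>"
  shows "(\<exists>c. f = (\<lambda>\<alpha>. monomial_sym \<nu> \<alpha> +
           (\<Sum>\<mu> | is_partition \<mu> \<and> dominated \<mu> \<nu> \<and> \<mu> \<noteq> \<nu>. c \<mu> * monomial_sym \<mu> \<alpha>)))
     \<longleftrightarrow> (\<exists>v. f = sym_series v \<and> unitriangular (mset \<nu>) v)"
proof -
  let ?S = "{\<mu>. is_partition \<mu> \<and> dominated \<mu> \<nu> \<and> \<mu> \<noteq> \<nu>}"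
  have pl: "part_list (mset \<nu>) = \<nu>" using part_list_mset[OF \<nu>] .
  have pos: "0 \<notin># mset \<nu>" using \<nu> by (simp add: is_partition_def)
  have mono: "monomial_sym \<mu> \<alpha> = (if mset \<mu> = mono_type \<alpha> then 1 else 0 :: 'a)" for \<mu> \<alpha>
    by (auto simp: monomial_sym_def mono_type_def)
  have mem: "part_list N \<in> ?S \<longleftrightarrow> N \<in> parts (sum_mset (mset \<nu>)) \<and> mdom_strict N (mset \<nu>)" if "0 \<notin># N" for N
  proof -
    have "part_list N = \<nu> \<longleftrightarrow> N = mset \<nu>" using pl by (metis mset_part_list)
    moreover have "dominated (part_list N) \<nu> \<Longrightarrow> sum_mset N = sum_mset (mset \<nu>)"
      by (simp add: dominated_def sum_mset_sum_list)
    ultimately show ?thesis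
      using that is_partition_part_list[OF that] by (auto simp: mdom_strict_def mdom_def pl parts_def)
  qed
  have fin: "finite ?S"
  proof (rule inj_on_finite[of mset])
    show "inj_on mset ?S" by (rule inj_onI) (metis (no_types, lifting) mem_Collect_eq part_list_mset)
    show "mset ` ?S \<subseteq> parts (sum_list \<nu>)"
      by (auto simp: parts_def is_partition_def dominated_def sum_mset_sum_list)
  qed simp
  have sum: "(\<Sum>\<mu>\<in>?S. c \<mu> * monomial_sym \<mu> \<alpha>) = (if part_list (mono_type \<alpha>) \<in> ?S then c (part_list (mono_type \<alpha>)) else (0::'a))"
    for c \<alpha>
  proof -
    have "(\<Sum>\<mu>\<in>?S. c \<mu> * monomial_sym \<mu> \<alpha>) = (\<Sum>\<mu>\<in>?S. if \<mu> = part_list (mono_type \<alpha>) then c (part_list (mono_type \<alpha>)) else (0::'a))"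
    proof (rule sum.cong[OF refl])
      fix \<mu> assume "\<mu> \<in> ?S"
      then have "mset \<mu> = mono_type \<alpha> \<longleftrightarrow> \<mu> = part_list (mono_type \<alpha>)" using part_list_mset[of \<mu>] by auto
      then show "c \<mu> * monomial_sym \<mu> \<alpha> = (if \<mu> = part_list (mono_type \<alpha>) then c (part_list (mono_type \<alpha>)) else (0::'a))"
        by (auto simp: mono)
    qed
    then show ?thesis using fin by simp
  qed
  show ?thesis
  proof
    assume "\<exists>c. f = (\<lambda>\<alpha>. monomial_sym \<nu> \<alpha> + (\<Sum>\<mu>\<in>?S. c \<mu> * monomial_sym \<mu> \<alpha>))"
    then obtain c where f: "f = (\<lambda>\<alpha>. monomial_sym \<nu> \<alpha> + (\<Sum>\<mu>\<in>?S. c \<mu> * monomial_sym \<mu> \<alpha>))" by blast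
    define v where "v N = (if N = mset \<nu> then 1 else if N \<in> parts (sum_mset (mset \<nu>)) \<and> mdom_strict N (mset \<nu>) then c (part_list N) else 0)" for N
    have "f = sym_series v"
      unfolding f sum
      by (rule ext, simp only: sym_series_def v_def mono mem[OF zero_notin_mono_type])
         (auto simp: mdom_strict_def)
    moreover have "unitriangular (mset \<nu>) v" by (simp add: unitriangular_def v_def)
    ultimately show "\<exists>v. f = sym_series v \<and> unitriangular (mset \<nu>) v" by blast
  next
    assume "\<exists>v. f = sym_series v \<and> unitriangular (mset \<nu>) v"
    then obtain v where v: "f = sym_series v" "unitriangular (mset \<nu>) v" by blast
    have "f = (\<lambda>\<alpha>. monomial_sym \<nu> \<alpha> + (\<Sum>\<mu>\<in>?S. v (mset \<mu>) * monomial_sym \<mu> \<alpha>))"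
    proof
      fix \<alpha>
      show "f \<alpha> = monomial_sym \<nu> \<alpha> + (\<Sum>\<mu>\<in>?S. v (mset \<mu>) * monomial_sym \<mu> \<alpha>)"
        unfolding sum using v(2)
        by (simp only: v(1) sym_series_def mono mem[OF zero_notin_mono_type] mset_part_list)
           (auto simp: unitriangular_def mdom_strict_def)
    qed
    then show "\<exists>c. f = (\<lambda>\<alpha>. monomial_sym \<nu> \<alpha> + (\<Sum>\<mu>\<in>?S. c \<mu> * monomial_sym \<mu> \<alpha>))"
      by (rule exI[of _ "\<lambda>\<mu>. v (mset \<mu>)"])
  qed
qed

lemma macdonald_family_iff:
  fixes q t :: "'a::field_char_0"
  shows "macdonald_family q t P \<longleftrightarrow>
    (\<forall>\<nu>. is_partition \<nu> \<longrightarrow> (\<exists>v. P \<nu> = sym_series v \<and> unitriangular (mset \<nu>) v)) \<and>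
    (\<forall>\<mu> \<nu>. is_partition \<mu> \<longrightarrow> is_partition \<nu> \<longrightarrow> \<mu> \<noteq> \<nu> \<longrightarrow> qt_inner q t (P \<mu>) (P \<nu>) = 0)"
  unfolding macdonald_family_def by (simp add: unitriangular_series_iff cong: imp_cong)

context generic_qt
begin

text \<open>This is \<open>trans_coeff_selfadjoint\<close>, since the power sum products are orthogonal.\<close>

lemma coord_op_selfadjoint:
  assumes v: "homogeneous d v" and w: "homogeneous d w"
  shows "form q t d (coord_op q t d v) w = form q t d v (coord_op q t d w)"
proof -
  have "form q t d (coord_op q t d v) w
      = (\<Sum>L\<in>parts d. \<Sum>M\<in>parts d. psum_coeffs v M * psum_coeffs w L * (trans_coeff q t M L * qt_norm_mset q t L))"
    unfolding form_def by (simp add: psum_coeffs_coord_op[OF v] sum_distrib_right sum_distrib_left mult_ac cong: sum.cong)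
  also have "\<dots> = (\<Sum>M\<in>parts d. \<Sum>L\<in>parts d. psum_coeffs v M * psum_coeffs w L * (trans_coeff q t M L * qt_norm_mset q t L))"
    by (rule sum.swap)
  also have "\<dots> = (\<Sum>M\<in>parts d. \<Sum>L\<in>parts d. psum_coeffs v M * psum_coeffs w L * (trans_coeff q t L M * qt_norm_mset q t M))"
    by (intro sum.cong refl) (simp add: trans_coeff_selfadjoint[OF _ _ t_nonzero t_power_ne_1])
  also have "\<dots> = form q t d v (coord_op q t d w)"
    unfolding form_def by (simp add: psum_coeffs_coord_op[OF w] sum_distrib_left sum_distrib_right mult_ac cong: sum.cong)
  finally show ?thesis .
qed

lemma eigenvector_exists:
  assumes L: "L \<in> parts d"
  shows "\<exists>v. unitriangular L v \<and> (\<forall>N. coord_op q t d v N = stable_eigval q t L * v N)"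
proof -
  obtain v where v: "v L = 1" "\<And>N. v N \<noteq> 0 \<Longrightarrow> N = L \<or> (N \<in> parts d \<and> mdom_strict N L)"
    "\<And>N. (\<Sum>M\<in>parts d. v M * coord_op q t d (unit_vec M) N) = coord_op q t d (unit_vec L) L * v N"
  proof (rule triangular_eigenvector[OF finite_parts transp_mdom_strict asymp_mdom_strict _ L])
    show "N = M \<or> N \<in> parts d \<and> mdom_strict N M" if "M \<in> parts d" "coord_op q t d (unit_vec M) N \<noteq> 0" for M N
      using coord_op_triangular(2)[OF that(1) t_nonzero t_ne_1 that(2)] .
    show "coord_op q t d (unit_vec M) M \<noteq> coord_op q t d (unit_vec L) L" if "M \<in> parts d" "M \<noteq> L" for M
      using stable_eigval_inj[OF _ that(1) L] that
      by (simp add: coord_op_triangular(1)[OF _ t_nonzero t_ne_1] L) blast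
  qed blast
  have "homogeneous d v" using v(2) L by (auto simp: homogeneous_def)
  then have "coord_op q t d v N = stable_eigval q t L * v N" for N
    using v(3)[of N] by (simp add: coord_op_linear coord_op_triangular(1)[OF L t_nonzero t_ne_1])
  moreover have "unitriangular L v" using v L by (simp add: unitriangular_def parts_def)
  ultimately show ?thesis by blast
qed

text \<open>The coordinates of Macdonald's functions, by \<open>macdonald_P_eq\<close>.\<close>

definition mac_vec :: "nat multiset \<Rightarrow> nat multiset \<Rightarrow> 'a" where
  "mac_vec L = (SOME v. unitriangular L v \<and> (\<forall>N. coord_op q t (sum_mset L) v N = stable_eigval q t L * v N))"

lemma mac_vec:
  assumes "0 \<notin># L"
  shows "unitriangular L (mac_vec L)"
    and "coord_op q t (sum_mset L) (mac_vec L) = (\<lambda>N. stable_eigval q t L * mac_vec L N)"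
proof -
  have "L \<in> parts (sum_mset L)" using assms by (simp add: parts_def)
  then have "unitriangular L (mac_vec L) \<and> (\<forall>N. coord_op q t (sum_mset L) (mac_vec L) N = stable_eigval q t L * mac_vec L N)"
    unfolding mac_vec_def by (rule someI_ex[OF eigenvector_exists])
  then show "unitriangular L (mac_vec L)"
    "coord_op q t (sum_mset L) (mac_vec L) = (\<lambda>N. stable_eigval q t L * mac_vec L N)" by auto
qed

lemma homogeneous_mac_vec: "L \<in> parts d \<Longrightarrow> homogeneous d (mac_vec L)"
  using homogeneous_unitriangular[OF _ mac_vec(1)] by (auto simp: parts_def)

text \<open>Eigenvectors of a self-adjoint operator with different eigenvalues.\<close>

lemma mac_vec_orthogonal:
  assumes "L \<in> parts d" and "M \<in> parts d" and "L \<noteq> M"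
  shows "form q t d (mac_vec L) (mac_vec M) = 0"
proof -
  have L: "0 \<notin># L" "sum_mset L = d" and M: "0 \<notin># M" "sum_mset M = d" using assms by (auto simp: parts_def)
  note hom = homogeneous_mac_vec[OF assms(1)] homogeneous_mac_vec[OF assms(2)]
  have "stable_eigval q t L * form q t d (mac_vec L) (mac_vec M) = form q t d (coord_op q t d (mac_vec L)) (mac_vec M)"
    using mac_vec(2)[OF L(1)] by (simp add: L(2) form_scale_left[OF hom(1)])
  also have "\<dots> = form q t d (mac_vec L) (coord_op q t d (mac_vec M))"
    by (rule coord_op_selfadjoint[OF hom])
  also have "\<dots> = stable_eigval q t M * form q t d (mac_vec L) (mac_vec M)"
    using mac_vec(2)[OF M(1)] by (simp add: M(2) form_commute[of q t d "mac_vec L"] form_scale_left[OF hom(2)])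
  finally show ?thesis using stable_eigval_inj[OF _ assms(1,2)] assms(3) by auto
qed

text \<open>The field need not be ordered, so nonvanishing of the norm needs an argument: a Macdonald function of norm zero would be
  orthogonal to an orthogonal basis, hence to all power sum products, hence zero.\<close>

lemma form_mac_vec_nonzero:
  assumes L: "L \<in> parts d"
  shows "form q t d (mac_vec L) (mac_vec L) \<noteq> 0"
proof
  assume z: "form q t d (mac_vec L) (mac_vec L) = 0"
  have "psum_coeffs (mac_vec L) M = 0" if M: "M \<in> parts d" for M
  proof -
    have "\<exists>a. pvec M = (\<lambda>N. \<Sum>K\<in>parts d. a K * mac_vec K N)"
      using pvec_support(1)[of M] M mac_vec(1)
      by (intro unitriangular_span[of d]) (auto simp: parts_def)
    then obtain a where a: "pvec M = (\<lambda>N. \<Sum>K\<in>parts d. a K * mac_vec K N)" by blast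
    have "form q t d (mac_vec L) (pvec M) = (\<Sum>K\<in>parts d. a K * form q t d (mac_vec K) (mac_vec L))"
      by (simp only: a form_commute[of q t d "mac_vec L"] form_sum_left[OF homogeneous_mac_vec])
    also have "\<dots> = 0"
      using z mac_vec_orthogonal[OF _ L] by (intro sum.neutral) auto
    finally show ?thesis using M qt_norm_mset_nonzero[of M] by (auto simp: form_pvec parts_def)
  qed
  then have "mac_vec L L = 0"
    using psum_expansion(2)[OF homogeneous_mac_vec[OF L], of L] by simp
  then show False using mac_vec(1)[of L] L by (auto simp: unitriangular_def parts_def)
qed

text \<open>The difference \<open>u\<close> of two candidates with index \<open>L\<close> lies in the span of the functions with smaller index. It is orthogonal
  to all of them, because by triangularity this span is the same for both families, and so it vanishes by
  \<open>form_mac_vec_nonzero\<close>.\<close>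

lemma mac_vec_unique:
  assumes V: "\<And>L. L \<in> parts d \<Longrightarrow> unitriangular L (V L)"
    and orth: "\<And>L M. L \<in> parts d \<Longrightarrow> M \<in> parts d \<Longrightarrow> L \<noteq> M \<Longrightarrow> form q t d (V L) (V M) = 0"
    and L: "L \<in> parts d"
  shows "V L = mac_vec L"
proof -
  have sum_d: "sum_mset K = d" "0 \<notin># K" if "K \<in> parts d" for K using that by (auto simp: parts_def)
  have hom: "homogeneous d (V K)" if "K \<in> parts d" for K
    using homogeneous_unitriangular[OF sum_d(2)[OF that] V[OF that]] sum_d(1)[OF that] by simp
  define u where "u N = V L N - mac_vec L N" for N
  define I where "I = {K\<in>parts d. mdom_strict K L}"
  have down: "N \<in> I" if "M \<in> I" "N \<in> parts d" "mdom_strict N M" for M N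
    using that L transp_onD[OF transp_mdom_strict, of N d M L] by (auto simp: I_def)
  have "\<exists>a. u = (\<lambda>N. \<Sum>K\<in>I. a K * mac_vec K N)"
  proof (rule unitriangular_span[of d mac_vec I])
    show "unitriangular K (mac_vec K)" if "K \<in> parts d" for K using sum_d[OF that] by (intro mac_vec)
    show "N \<in> I" if "u N \<noteq> 0" for N
    proof -
      have "V L N \<noteq> 0 \<or> mac_vec L N \<noteq> 0" using that by (auto simp: u_def)
      moreover have "N \<noteq> L" using that V[OF L] mac_vec(1)[OF sum_d(2)[OF L]] by (auto simp: u_def unitriangular_def)
      ultimately show ?thesis
        using V[OF L] mac_vec(1)[OF sum_d(2)[OF L]] sum_d(1)[OF L] by (auto simp: I_def unitriangular_def)
    qed
  qed (use down in \<open>auto simp: I_def\<close>)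
  then obtain a where a: "u = (\<lambda>N. \<Sum>K\<in>I. a K * mac_vec K N)" by blast
  have "a K = 0" if K: "K \<in> I" for K
  proof -
    have K': "K \<in> parts d" "K \<noteq> L" using K by (auto simp: I_def mdom_strict_def)
    \<comment> \<open>\<open>mac_vec K\<close> is a combination of the \<open>V M\<close> below \<open>L\<close>, and these are orthogonal to \<open>V L\<close>.\<close>
    define J where "J = {M\<in>parts d. M = K \<or> mdom_strict M K}"
    have "\<exists>b. mac_vec K = (\<lambda>N. \<Sum>M\<in>J. b M * V M N)"
    proof (rule unitriangular_span[of d V J])
      show "N \<in> J" if "mac_vec K N \<noteq> 0" for N
        using mac_vec(1)[OF sum_d(2)[OF K'(1)]] that sum_d(1)[OF K'(1)] K'(1) by (auto simp: J_def unitriangular_def)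
      show "N \<in> J" if "M \<in> J" "N \<in> parts d" "mdom_strict N M" for M N
        using that K'(1) transp_onD[OF transp_mdom_strict, of N d M K] by (auto simp: J_def)
    qed (use V in \<open>auto simp: J_def\<close>)
    then obtain b where b: "mac_vec K = (\<lambda>N. \<Sum>M\<in>J. b M * V M N)" by blast
    have J: "M \<in> parts d" "M \<noteq> L" if "M \<in> J" for M
    proof -
      show "M \<in> parts d" using that by (simp add: J_def)
      have "M \<in> I" using that K down[OF K] by (auto simp: J_def)
      then show "M \<noteq> L" by (simp add: I_def mdom_strict_def)
    qed
    have "form q t d (V L) (mac_vec K) = (\<Sum>M\<in>J. b M * form q t d (V M) (V L))"
      unfolding form_commute[of q t d "V L"] b using J hom by (intro form_sum_left) auto
    also have "\<dots> = 0" using J orth[OF _ L] by (intro sum.neutral) auto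
    finally have "form q t d u (mac_vec K) = 0"
      unfolding u_def[abs_def]
      using mac_vec_orthogonal[OF L K'(1)] K'(2) by (simp add: form_diff_left[OF hom[OF L] homogeneous_mac_vec[OF L]])
    moreover have "form q t d u (mac_vec K) = (\<Sum>M\<in>I. a M * form q t d (mac_vec M) (mac_vec K))"
      unfolding a by (intro form_sum_left homogeneous_mac_vec) (auto simp: I_def)
    moreover have "\<dots> = (\<Sum>M\<in>I. if M = K then a K * form q t d (mac_vec K) (mac_vec K) else 0)"
      using mac_vec_orthogonal[OF _ K'(1)] by (intro sum.cong) (auto simp: I_def)
    ultimately have "a K * form q t d (mac_vec K) (mac_vec K) = 0"
      using K by (simp add: I_def)
    then show ?thesis using form_mac_vec_nonzero[OF K'(1)] by simp
  qed
  then have "u N = 0" for N by (simp add: a)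
  then show ?thesis by (simp add: u_def fun_eq_iff)
qed

lemma macdonald_family_exists: "macdonald_family q t (\<lambda>\<nu>. sym_series (mac_vec (mset \<nu>)))"
  unfolding macdonald_family_iff
proof (intro conjI allI impI)
  fix \<nu> assume "is_partition \<nu>"
  then show "\<exists>v. sym_series (mac_vec (mset \<nu>)) = sym_series v \<and> unitriangular (mset \<nu>) v"
    using mac_vec(1)[of "mset \<nu>"] by (auto simp: is_partition_def)
next
  fix \<mu> \<nu> :: "nat list"
  assume a: "is_partition \<mu>" "is_partition \<nu>" "\<mu> \<noteq> \<nu>"
  let ?M = "mset \<mu>" and ?N = "mset \<nu>"
  have M: "?M \<in> parts (sum_mset ?M)" and N: "?N \<in> parts (sum_mset ?N)" using a by (auto simp: is_partition_def parts_def)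
  have ne: "?M \<noteq> ?N" using a by (metis part_list_mset)
  have "qt_inner q t (sym_series (mac_vec ?M)) (sym_series (mac_vec ?N)) = form q t (sum_mset ?M) (mac_vec ?M) (mac_vec ?N)"
    by (rule qt_inner_sym_series[OF homogeneous_mac_vec[OF M] homogeneous_mac_vec[OF N]])
  also have "\<dots> = 0"
  proof (cases "sum_mset ?M = sum_mset ?N")
    case True
    then show ?thesis using mac_vec_orthogonal[OF M _ ne] N by simp
  next
    case False
    then show ?thesis by (rule form_degree_mismatch[OF homogeneous_mac_vec[OF M] homogeneous_mac_vec[OF N]])
  qed
  finally show "qt_inner q t (sym_series (mac_vec ?M)) (sym_series (mac_vec ?N)) = 0" .
qed

lemma macdonald_family_unique:
  assumes P: "macdonald_family q t P" and \<nu>: "is_partition \<nu>"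
  shows "P \<nu> = sym_series (mac_vec (mset \<nu>))"
proof -
  have "\<forall>L. \<exists>v. 0 \<notin># L \<longrightarrow> P (part_list L) = sym_series v \<and> unitriangular L v"
    using P is_partition_part_list by (metis macdonald_family_iff mset_part_list)
  then obtain V where V: "\<And>L. 0 \<notin># L \<Longrightarrow> P (part_list L) = sym_series (V L)" "\<And>L. 0 \<notin># L \<Longrightarrow> unitriangular L (V L)"
    by metis
  let ?d = "sum_mset (mset \<nu>)"
  have "V (mset \<nu>) = mac_vec (mset \<nu>)"
  proof (rule mac_vec_unique)
    show "mset \<nu> \<in> parts ?d" using \<nu> by (simp add: parts_def is_partition_def)
    show "unitriangular L (V L)" if "L \<in> parts ?d" for L using that V(2) by (simp add: parts_def)
    fix L M assume LM: "L \<in> parts ?d" "M \<in> parts ?d" "L \<noteq> M"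
    have hom: "homogeneous ?d (V K)" if "K \<in> parts ?d" for K
      using homogeneous_unitriangular[OF _ V(2), of K] that by (simp add: parts_def)
    have "qt_inner q t (P (part_list L)) (P (part_list M)) = 0"
      using P LM is_partition_part_list unfolding macdonald_family_iff parts_def
      by (metis (no_types, lifting) mem_Collect_eq mset_part_list)
    then show "form q t ?d (V L) (V M) = 0"
      using LM V(1) qt_inner_sym_series[OF hom[OF LM(1)] hom[OF LM(2)], of q t] by (simp add: parts_def)
  qed
  then show ?thesis using V(1)[of "mset \<nu>"] \<nu> by (simp add: part_list_mset is_partition_def)
qed

theorem macdonald_P_eq: "is_partition \<nu> \<Longrightarrow> macdonald_P q t \<nu> = sym_series (mac_vec (mset \<nu>))"
  unfolding macdonald_P_def
  by (rule the_equality) (use macdonald_family_exists macdonald_family_unique in blast)+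

end

section \<open>Inverting the parameters\<close>

text \<open>Multiplication by \<open>t ^ (n - 1) * q ^ K\<close> turns negative exponents into the exponents \<open>K - f i\<close> in reversed order.\<close>

lemma (in generic_qt) generic_qt_inverse: "generic_qt (inverse q) (inverse t)"
proof
  fix n i f g
  assume eq: "(\<Sum>i<n. inverse t ^ i * inverse q ^ f i) = (\<Sum>i<n. inverse t ^ i * inverse q ^ g i)" and i: "i < n"
  define K where "K = (\<Sum>i<n. f i + g i)"
  have K: "f i \<le> K" "g i \<le> K" if "i < n" for i
    using member_le_sum[of i "{..<n}" "\<lambda>i. f i + g i"] that by (auto simp: K_def)
  have reverse: "t ^ (n - 1) * q ^ K * (\<Sum>i<n. inverse t ^ i * inverse q ^ h i)
     = (\<Sum>i<n. t ^ i * q ^ (K - h (n - Suc i)))" if "\<And>i. i < n \<Longrightarrow> h i \<le> K" for h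
  proof -
    have "t ^ (n - 1) * q ^ K * (\<Sum>i<n. inverse t ^ i * inverse q ^ h i)
      = (\<Sum>i<n. (t ^ (n - 1) * inverse t ^ i) * (q ^ K * inverse q ^ h i))"
      by (simp add: sum_distrib_left mult_ac)
    also have "\<dots> = (\<Sum>i<n. t ^ (n - Suc i) * q ^ (K - h i))"
      using that q_nonzero t_nonzero
      by (intro sum.cong refl arg_cong2[of _ _ _ _ "(*)"]) (auto simp: power_diff divide_inverse power_inverse)
    also have "\<dots> = (\<Sum>i<n. t ^ (n - Suc (n - Suc i)) * q ^ (K - h (n - Suc i)))"
      by (rule sum.nat_diff_reindex[symmetric])
    also have "\<dots> = (\<Sum>i<n. t ^ i * q ^ (K - h (n - Suc i)))"
      by (intro sum.cong) auto
    finally show ?thesis .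
  qed
  have "(\<Sum>i<n. t ^ i * q ^ (K - f (n - Suc i))) = (\<Sum>i<n. t ^ i * q ^ (K - g (n - Suc i)))"
    using reverse[of f] reverse[of g] K eq by simp
  then have "K - f (n - Suc (n - Suc i)) = K - g (n - Suc (n - Suc i))"
    using generic[of "\<lambda>i. K - f (n - Suc i)" n "\<lambda>i. K - g (n - Suc i)" "n - Suc i"] i by simp
  then show "f i = g i" using K[OF i] i by (simp add: Suc_diff_Suc)
qed

lemma (in generic_qt) qt_norm_mset_inverse:
  assumes "0 \<notin># M"
  shows "qt_norm_mset (inverse q) (inverse t) M = (t * inverse q) ^ sum_mset M * qt_norm_mset q t M"
proof -
  have "(\<Prod>r\<in>#M. (1 - inverse q ^ r) / (1 - inverse t ^ r)) = (\<Prod>r\<in>#M. (t * inverse q) ^ r * ((1 - q ^ r) / (1 - t ^ r)))"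
  proof (intro arg_cong[of _ _ prod_mset] image_mset_cong)
    fix r assume "r \<in># M"
    then have "r > 0" using assms by (metis neq0_conv)
    then have "1 - t ^ r \<noteq> 0" "t ^ r \<noteq> 0" "q ^ r \<noteq> 0"
      using t_power_ne_1[of r] t_nonzero q_nonzero by auto
    moreover from this have "1 - inverse t ^ r = - (1 - t ^ r) / t ^ r" "1 - inverse q ^ r = - (1 - q ^ r) / q ^ r"
      by (simp_all add: field_simps power_inverse)
    ultimately show "(1 - inverse q ^ r) / (1 - inverse t ^ r) = (t * inverse q) ^ r * ((1 - q ^ r) / (1 - t ^ r))"
      by (simp add: power_mult_distrib power_inverse) (simp add: field_simps)
  qed
  then have "(\<Prod>r\<in>#M. (1 - inverse q ^ r) / (1 - inverse t ^ r))
      = (t * inverse q) ^ sum_mset M * (\<Prod>r\<in>#M. (1 - q ^ r) / (1 - t ^ r))"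
    by (simp only: prod_mset.distrib prod_mset_power_sum_mset)
  then show ?thesis by (simp only: qt_norm_mset_def mult_ac)
qed

text \<open>In degree \<open>d\<close>, inverting both parameters scales the inner product by \<open>(t / q) ^ d\<close>, which does not affect
  orthogonality.\<close>

lemma (in generic_qt) macdonald_family_inverse:
  assumes P: "macdonald_family q t P"
  shows "macdonald_family (inverse q) (inverse t) P"
  unfolding macdonald_family_iff
proof (intro conjI allI impI)
  show "\<exists>v. P \<nu> = sym_series v \<and> unitriangular (mset \<nu>) v" if "is_partition \<nu>" for \<nu>
    using P that by (simp add: macdonald_family_iff)
  fix \<mu> \<nu> :: "nat list"
  assume a: "is_partition \<mu>" "is_partition \<nu>" "\<mu> \<noteq> \<nu>"
  then obtain v w where v: "P \<mu> = sym_series v" "unitriangular (mset \<mu>) v"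
    and w: "P \<nu> = sym_series w" "unitriangular (mset \<nu>) w"
    using P by (metis macdonald_family_iff)
  have v': "homogeneous (sum_mset (mset \<mu>)) v" and w': "homogeneous (sum_mset (mset \<nu>)) w"
    using v w a by (auto intro!: homogeneous_unitriangular simp: is_partition_def)
  let ?d = "sum_mset (mset \<mu>)"
  have "form (inverse q) (inverse t) ?d v w = (t * inverse q) ^ ?d * form q t ?d v w"
    unfolding form_def sum_distrib_left
    by (intro sum.cong refl) (simp add: qt_norm_mset_inverse parts_def)
  moreover have "qt_inner q t (P \<mu>) (P \<nu>) = 0"
    using P a unfolding macdonald_family_iff by blast
  then have "form q t ?d v w = 0"
    by (simp add: v(1) w(1) qt_inner_sym_series[OF v' w'])
  ultimately show "qt_inner (inverse q) (inverse t) (P \<mu>) (P \<nu>) = 0"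
    by (simp add: v(1) w(1) qt_inner_sym_series[OF v' w'])
qed

lemma (in generic_qt) macdonald_P_inverse: "macdonald_P (inverse q) (inverse t) = macdonald_P q t"
proof -
  interpret inv: generic_qt "inverse q" "inverse t" by (rule generic_qt_inverse)
  have "macdonald_family (inverse q) (inverse t) P \<longleftrightarrow> macdonald_family q t P" for P
    using macdonald_family_inverse[of P] inv.macdonald_family_inverse[of P] by auto
  then show ?thesis by (simp add: macdonald_P_def[abs_def])
qed

section \<open>Inverting the variables\<close>

text \<open>Inverting the variables exchanges the parameters with their inverses, up to one factor \<open>inverse t\<close> from each of the
  \<open>n - 1\<close> quotients in a shift coefficient; the power of the product of the variables contributes \<open>inverse q ^ m\<close>.\<close>

lemma mac_op_inverse:
  fixes x :: "nat \<Rightarrow> 'a::field_char_0"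
  assumes x: "good_point n x" and q: "q \<noteq> 0" and t: "t \<noteq> 0"
  shows "mac_op n (inverse q) (inverse t) (\<lambda>x. (\<Prod>i<n. x i) ^ m * G (\<lambda>i. inverse (x i))) x
     = inverse q ^ m * inverse t ^ (n - 1) * ((\<Prod>i<n. x i) ^ m * mac_op n q t G (\<lambda>i. inverse (x i)))"
proof -
  have nz: "x i \<noteq> 0" if "i < n" for i using x that by (auto simp: good_point_def)
  have "shift_coeff n (inverse t) x i * ((\<Prod>j<n. (x(i := inverse q * x i)) j) ^ m * G (\<lambda>j. inverse ((x(i := inverse q * x i)) j)))
    = inverse q ^ m * inverse t ^ (n - 1) * ((\<Prod>i<n. x i) ^ m *
       (shift_coeff n t (\<lambda>j. inverse (x j)) i * G ((\<lambda>j. inverse (x j))(i := q * inverse (x i)))))"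
    if i: "i < n" for i
  proof -
    have "(\<Prod>j<n. (x(i := inverse q * x i)) j) = (\<Prod>j<n. x j * (if j = i then inverse q else 1))"
      by (intro prod.cong) auto
    then have 1: "(\<Prod>j<n. (x(i := inverse q * x i)) j) = inverse q * (\<Prod>j<n. x j)"
      using i by (simp add: prod.distrib)
    have 2: "(\<lambda>j. inverse ((x(i := inverse q * x i)) j)) = (\<lambda>j. inverse (x j))(i := q * inverse (x i))"
      using q by (auto simp: fun_eq_iff)
    have "shift_coeff n (inverse t) x i = (\<Prod>j\<in>{..<n}-{i}. inverse t * ((t * inverse (x i) - inverse (x j)) / (inverse (x i) - inverse (x j))))"
      unfolding shift_coeff_def
    proof (rule prod.cong[OF refl])
      fix j assume j: "j \<in> {..<n}-{i}"
      then have "x i - x j \<noteq> 0" "x j - x i \<noteq> 0" using x i by (auto simp: good_point_def inj_on_def)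
      then show "(inverse t * x i - x j) / (x i - x j) = inverse t * ((t * inverse (x i) - inverse (x j)) / (inverse (x i) - inverse (x j)))"
        using nz[of i] nz[of j] i j t by (simp add: divide_simps) (simp add: algebra_simps)
    qed
    also have "\<dots> = inverse t ^ (n - 1) * shift_coeff n t (\<lambda>j. inverse (x j)) i"
      using i by (simp only: prod.distrib shift_coeff_def) simp
    finally have 3: "shift_coeff n (inverse t) x i = inverse t ^ (n - 1) * shift_coeff n t (\<lambda>j. inverse (x j)) i" .
    show ?thesis by (simp only: 1 2 3 power_mult_distrib mult_ac)
  qed
  then show ?thesis
    unfolding mac_op_def sum_distrib_left by (intro sum.cong refl) auto
qed

text \<open>The complement of \<open>N\<close>, padded with zeros to \<open>n\<close> parts, in the rectangle with \<open>n\<close> rows of length \<open>m\<close>.\<close>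

definition complement :: "nat \<Rightarrow> nat \<Rightarrow> nat multiset \<Rightarrow> nat multiset" where
  "complement n m N = filter_mset (\<lambda>a. a \<noteq> 0) (image_mset (\<lambda>a. m - a) (N + replicate_mset (n - size N) 0))"

lemma zero_notin_complement [simp]: "0 \<notin># complement n m N"
  by (simp add: complement_def)

lemma complement_le: "a \<in># complement n m N \<Longrightarrow> a \<le> m"
  by (auto simp: complement_def split: if_splits)

lemma size_complement: "size N \<le> n \<Longrightarrow> size (complement n m N) \<le> n"
  unfolding complement_def
  by (rule order.trans[OF size_filter_mset_lesseq]) simp

lemma mono_type_complement:
  assumes \<alpha>: "supp \<alpha> \<subseteq> {..<n}" and p: "bij_betw p {..<n} {..<n}"
    and \<gamma>: "\<And>i. expo \<gamma> i = (if i < n then m - expo \<alpha> (p i) else 0)"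
  shows "mono_type \<gamma> = complement n m (mono_type \<alpha>)"
proof -
  let ?l = "expo \<alpha>"
  have "{..<n} = supp \<alpha> \<union> ({..<n} - supp \<alpha>)" using \<alpha> by blast
  then have "mset_set {..<n} = mset_set (supp \<alpha>) + mset_set ({..<n} - supp \<alpha>)"
    by (metis Diff_disjoint finite_keys finite_Diff finite_lessThan mset_set_Union)
  then have "image_mset ?l (mset_set {..<n}) = mono_type \<alpha> + image_mset ?l (mset_set ({..<n} - supp \<alpha>))"
    by (simp add: mono_type_def)
  also have "image_mset ?l (mset_set ({..<n} - supp \<alpha>)) = image_mset (\<lambda>_. 0) (mset_set ({..<n} - supp \<alpha>))"
    by (intro image_mset_cong) (auto simp: in_keys_iff)
  also have "\<dots> = replicate_mset (n - size (mono_type \<alpha>)) 0"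
    using \<alpha> by (simp add: image_mset_const_eq mono_type_def card_Diff_subset)
  finally have pad: "image_mset ?l (mset_set {..<n}) = mono_type \<alpha> + replicate_mset (n - size (mono_type \<alpha>)) 0" .
  have "supp \<gamma> \<subseteq> {..<n}" by (auto simp: in_keys_iff \<gamma> split: if_splits)
  then have "mono_type \<gamma> = filter_mset (\<lambda>a. a \<noteq> 0) (image_mset (expo \<gamma>) (mset_set {..<n}))"
    by (intro mono_type_superset) auto
  also have "image_mset (expo \<gamma>) (mset_set {..<n}) = image_mset (\<lambda>i. m - ?l (p i)) (mset_set {..<n})"
    by (intro image_mset_cong) (auto simp: \<gamma>)
  also have "\<dots> = image_mset (\<lambda>a. m - a) (image_mset ?l (image_mset p (mset_set {..<n})))"
    by (simp add: multiset.map_comp comp_def)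
  also have "image_mset p (mset_set {..<n}) = mset_set {..<n}"
    using p by (simp add: image_mset_mset_set bij_betw_def)
  finally show ?thesis by (simp only: pad complement_def)
qed

definition flip :: "nat \<Rightarrow> nat \<Rightarrow> (nat \<Rightarrow>\<^sub>0 nat) \<Rightarrow> (nat \<Rightarrow>\<^sub>0 nat)" where
  "flip n m \<alpha> = Poly_Mapping.nth (map (\<lambda>i. m - expo \<alpha> i) [0..<n])"

lemma lookup_flip: "expo (flip n m \<alpha>) i = (if i < n then m - expo \<alpha> i else 0)"
  by (simp add: flip_def nth_default_def)

lemma keys_flip: "supp (flip n m \<alpha>) \<subseteq> {..<n}"
  by (auto simp: in_keys_iff lookup_flip split: if_splits)

lemma mono_type_flip:
  "supp \<alpha> \<subseteq> {..<n} \<Longrightarrow> mono_type (flip n m \<alpha>) = complement n m (mono_type \<alpha>)"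
  by (rule mono_type_complement[where p = "\<lambda>i. i"]) (auto simp: lookup_flip bij_betw_def)

lemma flip_flip:
  assumes "supp \<alpha> \<subseteq> {..<n}" and "\<And>i. expo \<alpha> i \<le> m"
  shows "flip n m (flip n m \<alpha>) = \<alpha>"
  using assms lookup_outside[OF assms(1)] by (intro poly_mapping_eqI) (simp add: lookup_flip)

lemma lookup_le_mono_type:
  assumes "\<And>a. a \<in># mono_type \<alpha> \<Longrightarrow> a \<le> m"
  shows "expo \<alpha> i \<le> m"
  using assms by (cases "i \<in> supp \<alpha>") (auto simp: mono_type_def in_keys_iff)

lemma mono_type_le_lookup:
  assumes "\<And>i. expo \<alpha> i \<le> m" and "a \<in># mono_type \<alpha>"
  shows "a \<le> m"
  using assms by (auto simp: mono_type_def)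

definition complement_coords :: "nat \<Rightarrow> nat \<Rightarrow> (nat multiset \<Rightarrow> 'a) \<Rightarrow> nat multiset \<Rightarrow> 'a::zero" where
  "complement_coords n m v N = (if \<forall>a\<in>#N. a \<le> m then v (complement n m N) else 0)"

lemma eval_complement_coords:
  fixes x :: "nat \<Rightarrow> 'a::field_char_0"
  assumes v: "\<And>N a. size N \<le> n \<Longrightarrow> v N \<noteq> 0 \<Longrightarrow> a \<in># N \<Longrightarrow> a \<le> m" and d: "d \<le> n * m"
    and x: "\<And>i. i < n \<Longrightarrow> x i \<noteq> 0"
  shows "eval_coords n (n * m - d) (complement_coords n m v) x = (\<Prod>i<n. x i) ^ m * eval_coords n d v (\<lambda>i. inverse (x i))"
proof -
  let ?g = "\<lambda>\<alpha>. v (mono_type \<alpha>) * ((\<Prod>i<n. x i) ^ m * monomial_at n (\<lambda>i. inverse (x i)) \<alpha>)"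
  let ?h = "\<lambda>\<beta>. complement_coords n m v (mono_type \<beta>) * monomial_at n x \<beta>" and ?d = "n * m - d"
  define B where "B e = {\<alpha>\<in>exps n e. \<forall>i. expo \<alpha> i \<le> m}" for e
  have flip_B: "flip n m \<alpha> \<in> B (n * m - e)" if "\<alpha> \<in> B e" for \<alpha> e
  proof -
    have "(\<Sum>i<n. m - expo \<alpha> i) + (\<Sum>i<n. expo \<alpha> i) = n * m"
      using that by (simp add: B_def sum.distrib[symmetric])
    then have "(\<Sum>i<n. expo (flip n m \<alpha>) i) = n * m - e"
      using that by (simp add: lookup_flip B_def in_exps_iff)
    then show ?thesis using keys_flip by (simp add: B_def in_exps_iff lookup_flip)
  qed
  have "(\<Prod>i<n. x i) ^ m * eval_coords n d v (\<lambda>i. inverse (x i))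
     = (\<Sum>\<alpha>\<in>exps n d. ?g \<alpha>)"
    by (simp add: eval_coords_def sum_distrib_left mult_ac)
  also have "\<dots> = (\<Sum>\<alpha>\<in>B d. ?g \<alpha>)"
  proof (rule sum.mono_neutral_right)
    show "\<forall>\<alpha>\<in>exps n d - B d. ?g \<alpha> = 0"
    proof
      fix \<alpha> assume \<alpha>: "\<alpha> \<in> exps n d - B d"
      have "v (mono_type \<alpha>) = 0"
      proof (rule ccontr)
        assume "v (mono_type \<alpha>) \<noteq> 0"
        then have "expo \<alpha> i \<le> m" for i
          using v[of "mono_type \<alpha>"] size_le_exps[of \<alpha> n d] \<alpha> by (intro lookup_le_mono_type) auto
        then show False using \<alpha> by (simp add: B_def)
      qed
      then show "?g \<alpha> = 0" by simp
    qed
  qed (auto simp: B_def)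
  also have "\<dots> = (\<Sum>\<beta>\<in>B ?d. ?h \<beta>)"
  proof (rule sum.reindex_bij_witness[of _ "flip n m" "flip n m"])
    fix \<alpha> assume \<alpha>: "\<alpha> \<in> B d"
    then have keys: "supp \<alpha> \<subseteq> {..<n}" and le: "\<And>i. expo \<alpha> i \<le> m" by (auto simp: B_def exps_def)
    show "flip n m (flip n m \<alpha>) = \<alpha>" by (rule flip_flip[OF keys le])
    show "flip n m \<alpha> \<in> B ?d" by (rule flip_B[OF \<alpha>])
    have "complement_coords n m v (mono_type (flip n m \<alpha>)) = v (mono_type \<alpha>)"
      using mono_type_flip[of "flip n m \<alpha>" n m, OF keys_flip] flip_flip[OF keys le] mono_type_le_lookup[of "flip n m \<alpha>" m]
      by (auto simp: complement_coords_def lookup_flip)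
    moreover have "monomial_at n x (flip n m \<alpha>) = (\<Prod>i<n. x i) ^ m * monomial_at n (\<lambda>i. inverse (x i)) \<alpha>"
      unfolding monomial_at_def prod_power_distrib prod.distrib[symmetric]
      using x le by (intro prod.cong refl) (auto simp: lookup_flip power_diff divide_inverse power_inverse)
    ultimately show "?h (flip n m \<alpha>)
       = ?g \<alpha>" by simp
  next
    fix \<beta> assume \<beta>: "\<beta> \<in> B ?d"
    then show "flip n m (flip n m \<beta>) = \<beta>" by (intro flip_flip) (auto simp: B_def exps_def)
    show "flip n m \<beta> \<in> B d" using flip_B[OF \<beta>] d by simp
  qed
  also have "\<dots> = eval_coords n ?d (complement_coords n m v) x"
    unfolding eval_coords_def
  proof (rule sum.mono_neutral_left)
    show "\<forall>\<beta>\<in>exps n ?d - B ?d. ?h \<beta> = 0"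
    proof
      fix \<beta> assume "\<beta> \<in> exps n ?d - B ?d"
      then have "\<not> (\<forall>a\<in>#mono_type \<beta>. a \<le> m)" using lookup_le_mono_type[of \<beta> m] by (auto simp: B_def)
      then show "?h \<beta> = 0" by (auto simp: complement_coords_def)
    qed
  qed (auto simp: B_def)
  finally show ?thesis ..
qed

section \<open>Complementation of Macdonald polynomials\<close>

lemma lookup_top_exp_le: "0 \<notin># M \<Longrightarrow> (\<And>a. a \<in># M \<Longrightarrow> a \<le> m) \<Longrightarrow> expo (top_exp M) i \<le> m"
  by (rule lookup_le_mono_type) simp

lemma keys_top_exp: "0 \<notin># M \<Longrightarrow> size M \<le> n \<Longrightarrow> supp (top_exp M) \<subseteq> {..<n}"
  using top_exp_in_exps[of M "sum_mset M" n] by (simp add: exps_def parts_def)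

lemma complement_complement:
  assumes "0 \<notin># M" and "size M \<le> n" and "\<And>a. a \<in># M \<Longrightarrow> a \<le> m"
  shows "complement n m (complement n m M) = M"
  using mono_type_flip[of "flip n m (top_exp M)" n m, OF keys_flip] mono_type_flip[OF keys_top_exp[OF assms(1,2)], of m]
    flip_flip[OF keys_top_exp[OF assms(1,2)] lookup_top_exp_le[OF assms(1,3)]] assms(1)
  by simp

lemma top_exp_decreasing: "i \<le> j \<Longrightarrow> expo (top_exp M) j \<le> expo (top_exp M) i"
  using sorted_part_list[of M]
  by (cases "i = j") (auto simp: top_exp_def nth_default_def sorted_wrt_iff_nth_less)

lemma lookup_top_exp_complement:
  assumes M: "0 \<notin># M" and size: "size M \<le> n" and le: "\<And>a. a \<in># M \<Longrightarrow> a \<le> m" and i: "i < n"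
  shows "expo (top_exp (complement n m M)) i = m - expo (top_exp M) (n - Suc i)"
proof -
  define \<gamma> where "\<gamma> = Poly_Mapping.nth (map (\<lambda>i. m - expo (top_exp M) (n - Suc i)) [0..<n])"
  have l: "expo \<gamma> i = (if i < n then m - expo (top_exp M) (n - Suc i) else 0)" for i
    by (simp add: \<gamma>_def nth_default_def)
  have "bij_betw (\<lambda>i. n - Suc i) {..<n} {..<n}"
    by (rule bij_betw_byWitness[where f' = "\<lambda>i. n - Suc i"]) auto
  then have type: "mono_type \<gamma> = complement n m M"
    using mono_type_complement[OF keys_top_exp[OF M size] _ l] M by simp
  have "supp \<gamma> \<subseteq> {..<n}" by (auto simp: in_keys_iff l split: if_splits)
  then have "\<gamma> \<in> exps n (sum_mset (complement n m M))" by (simp add: exps_def parts_def type)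
  then have "\<gamma> = top_exp (mono_type \<gamma>)"
    by (rule decreasing_eq_top_exp) (auto simp: l intro!: diff_le_mono2 top_exp_decreasing)
  then show ?thesis using l[of i] i type by simp
qed

lemma sum_mset_le_mult: "(\<And>a. a \<in># M \<Longrightarrow> a \<le> m) \<Longrightarrow> sum_mset M \<le> size M * (m :: nat)"
  by (induction M) (auto simp: add_le_mono)

context generic_qt
begin

lemma eigval_complement:
  assumes M: "0 \<notin># M" "size M \<le> n" "\<And>a. a \<in># M \<Longrightarrow> a \<le> m"
  shows "inverse q ^ m * inverse t ^ (n - 1) * eigval n q t M = eigval n (inverse q) (inverse t) (complement n m M)"
proof -
  let ?l = "expo (top_exp M)"
  have "inverse q ^ m * inverse t ^ (n - 1) * eigval n q t M = (\<Sum>i<n. (inverse t ^ (n - 1) * t ^ (n - 1 - i)) * (inverse q ^ m * q ^ ?l i))"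
    by (simp add: eigval_def sum_distrib_left mult_ac)
  also have "\<dots> = (\<Sum>i<n. inverse t ^ i * inverse q ^ (m - ?l i))"
  proof (intro sum.cong refl arg_cong2[of _ _ _ _ "(*)"])
    fix i assume "i \<in> {..<n}"
    then have "n - 1 = i + (n - 1 - i)" by simp
    then have "inverse t ^ (n - 1) = inverse t ^ i * inverse t ^ (n - 1 - i)" by (metis power_add)
    then show "inverse t ^ (n - 1) * t ^ (n - 1 - i) = inverse t ^ i"
      using t_nonzero by (simp add: power_inverse)
    have "m = (m - ?l i) + ?l i" using lookup_top_exp_le[OF M(1,3), of i] by simp
    then have "inverse q ^ m = inverse q ^ (m - ?l i) * inverse q ^ ?l i" by (metis power_add)
    then show "inverse q ^ m * q ^ ?l i = inverse q ^ (m - ?l i)"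
      using q_nonzero by (simp add: power_inverse)
  qed
  also have "\<dots> = (\<Sum>i<n. inverse t ^ (n - Suc i) * inverse q ^ (m - ?l (n - Suc i)))"
    by (rule sum.nat_diff_reindex[symmetric])
  also have "\<dots> = eigval n (inverse q) (inverse t) (complement n m M)"
    unfolding eigval_def by (intro sum.cong refl) (simp add: lookup_top_exp_complement[OF M])
  finally show ?thesis .
qed

lemma mac_op_mac_vec:
  assumes M: "0 \<notin># M" "size M \<le> n" and x: "good_point n x"
  shows "mac_op n q t (eval_coords n (sum_mset M) (mac_vec M)) x = eigval n q t M * eval_coords n (sum_mset M) (mac_vec M) x"
proof -
  let ?F = "eval_coords n (sum_mset M) (mac_vec M)"
  have "(t - 1) * mac_op n q t ?F x + ?F x = t ^ n * eval_coords n (sum_mset M) (coord_op q t (sum_mset M) (mac_vec M)) x"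
    using M by (intro mac_op_eval_coords homogeneous_mac_vec x t_nonzero) (simp add: parts_def)
  also have "\<dots> = t ^ n * stable_eigval q t M * ?F x"
    by (simp add: mac_vec(2)[OF M(1)] eval_coords_def sum_distrib_left mult.assoc)
  also have "t ^ n * stable_eigval q t M = (t - 1) * eigval n q t M + 1"
    using eigval_stable[OF M(2) t_nonzero] by simp
  finally have "(t - 1) * mac_op n q t ?F x = (t - 1) * (eigval n q t M * ?F x)"
    by (simp add: algebra_simps)
  then show ?thesis using t_ne_1 by simp
qed

text \<open>Dominance bounds the largest part.\<close>

lemma unitriangular_part_le:
  assumes v: "unitriangular M v" and M: "0 \<notin># M" "\<And>a. a \<in># M \<Longrightarrow> a \<le> m" and N: "v N \<noteq> 0" "a \<in># N"
  shows "a \<le> m"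
proof -
  have dom: "mdom N M" and N0: "0 \<notin># N"
    using v N(1) M(1) by (auto simp: unitriangular_def mdom_strict_def mdom_refl parts_def)
  have "expo (top_exp N) 0 \<le> expo (top_exp M) 0"
    using dom unfolding mdom_iff by (metis One_nat_def lessThan_0 lessThan_Suc sum.empty sum.insert finite.emptyI empty_iff add_0_right)
  then have "expo (top_exp N) i \<le> m" for i
    using top_exp_decreasing[of 0 i N] lookup_top_exp_le[OF M, of 0] by simp
  then show ?thesis using mono_type_le_lookup[of "top_exp N" m a] N(2) N0 by simp
qed

text \<open>Both sides are eigenfunctions, in \<open>n\<close> variables, of the operator with inverted parameters for the same eigenvalue, by
  \<open>mac_op_inverse\<close> and \<open>eigval_complement\<close>; the left-hand side because its Macdonald function is also the one for the inverted
  parameters. Both have coefficient \<open>1\<close> at the complement. If they differed, \<open>mac_op_eigenvalue\<close> would find this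
  eigenvalue at another partition that occurs in their difference \<open>u\<close>.\<close>

theorem macdonald_P_complement:
  assumes M: "0 \<notin># M" "size M \<le> n" "\<And>a. a \<in># M \<Longrightarrow> a \<le> m" and x: "good_point n x"
  shows "eval_vars n x (macdonald_P q t (part_list (complement n m M)))
    = (\<Prod>i<n. x i) ^ m * eval_vars n (\<lambda>i. inverse (x i)) (macdonald_P q t (part_list M))"
proof -
  interpret inv: generic_qt "inverse q" "inverse t" by (rule generic_qt_inverse)
  let ?N = "complement n m M" and ?d = "sum_mset M"
  let ?e = "eigval n (inverse q) (inverse t) ?N"
  let ?D = "mac_op n (inverse q) (inverse t)" and ?F = "eval_coords n ?d (mac_vec M)"
  define d' where "d' = n * m - ?d"
  define v where "v = complement_coords n m (mac_vec M)"
  have "?d \<le> n * m" using sum_mset_le_mult[of M m] M(2,3) by (meson le_trans mult_le_mono1)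
  have N: "0 \<notin># ?N" "size ?N \<le> n" using M(2) by (auto simp: size_complement)
  have "flip n m (top_exp M) \<in> exps n d'"
  proof -
    have "top_exp M \<in> exps n ?d" using M by (intro top_exp_in_exps) (auto simp: parts_def)
    moreover have "(\<Sum>i<n. m - expo (top_exp M) i) + (\<Sum>i<n. expo (top_exp M) i) = n * m"
      using lookup_top_exp_le[OF M(1,3)] by (simp add: sum.distrib[symmetric])
    ultimately show ?thesis using keys_flip by (simp add: in_exps_iff lookup_flip d'_def)
  qed
  then have N_parts: "?N \<in> parts d'"
    using mono_type_flip[OF keys_top_exp[OF M(1,2)], of m] M(1) mono_type_exps by fastforce
  then have N_sum: "sum_mset ?N = d'" by (simp add: parts_def)
  have v_eval: "eval_coords n d' v y = (\<Prod>i<n. y i) ^ m * ?F (\<lambda>i. inverse (y i))"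
    if "\<And>i. i < n \<Longrightarrow> y i \<noteq> 0" for y
    unfolding v_def d'_def
    using unitriangular_part_le[OF mac_vec(1)[OF M(1)] M(1,3)] \<open>?d \<le> n * m\<close> that
    by (intro eval_complement_coords) blast+
  define u where "u K = v K - inv.mac_vec ?N K" for K
  have u_eval: "eval_coords n d' u y = eval_coords n d' v y - eval_coords n d' (inv.mac_vec ?N) y" for y
    by (simp add: eval_coords_def u_def left_diff_distrib sum_subtractf)
  have eigen: "?D (eval_coords n d' u) y = ?e * eval_coords n d' u y"
    if y: "good_point n y" for y
  proof -
    have y': "good_point n (\<lambda>i. inverse (y i))" using y by (auto simp: good_point_def inj_on_def)
    have ynz: "y i \<noteq> 0" if "i < n" for i using y that by (simp add: good_point_def)
    have "?D (eval_coords n d' v) y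
      = ?D (\<lambda>y. (\<Prod>i<n. y i) ^ m * ?F (\<lambda>i. inverse (y i))) y"
      unfolding mac_op_def
      using ynz q_nonzero by (intro sum.cong refl arg_cong2[of _ _ _ _ "(*)"] v_eval) auto
    also have "\<dots> = inverse q ^ m * inverse t ^ (n - 1) * eigval n q t M
        * ((\<Prod>i<n. y i) ^ m * ?F (\<lambda>i. inverse (y i)))"
      unfolding mac_op_inverse[OF y q_nonzero t_nonzero] mac_op_mac_vec[OF M(1,2) y'] by (simp only: mult_ac)
    also have "(\<Prod>i<n. y i) ^ m * ?F (\<lambda>i. inverse (y i)) = eval_coords n d' v y"
      by (rule v_eval[OF ynz, symmetric])
    finally have "?D (eval_coords n d' v) y = ?e * eval_coords n d' v y"
      by (simp only: eigval_complement[OF M])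
    moreover have "?D (eval_coords n d' (inv.mac_vec ?N)) y = ?e * eval_coords n d' (inv.mac_vec ?N) y"
      using inv.mac_op_mac_vec[OF N y] by (simp only: N_sum)
    moreover have "?D (eval_coords n d' u) y
      = ?D (eval_coords n d' v) y - ?D (eval_coords n d' (inv.mac_vec ?N)) y"
      by (simp add: mac_op_def u_eval right_diff_distrib sum_subtractf)
    ultimately show ?thesis by (simp add: u_eval right_diff_distrib)
  qed
  have u_N: "u ?N = 0"
  proof -
    have "v ?N = mac_vec M M"
      using complement_le[of _ n m M] complement_complement[OF M] by (simp add: v_def complement_coords_def)
    then show ?thesis
      using mac_vec(1)[OF M(1)] inv.mac_vec(1)[OF N(1)] by (simp add: u_def unitriangular_def)
  qed
  have "u K = 0" if K: "K \<in> parts d'" "size K \<le> n" for K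
  proof (rule ccontr)
    assume "u K \<noteq> 0"
    then obtain L where L: "L \<in> parts d'" "size L \<le> n" "u L \<noteq> 0" "?e = eigval n (inverse q) (inverse t) L"
      using mac_op_eigenvalue[OF eigen K] by blast
    then have "?N = L" using N by (intro inv.eigval_inj[of n]) (auto simp: parts_def)
    then show False using L(3) u_N by simp
  qed
  then have "eval_coords n d' u x = 0"
    unfolding eval_coords_def by (intro sum.neutral ballI) (simp add: mono_type_exps size_le_exps)
  then have "eval_coords n d' (inv.mac_vec ?N) x = eval_coords n d' v x"
    by (simp add: u_eval)
  also have "\<dots> = (\<Prod>i<n. x i) ^ m * ?F (\<lambda>i. inverse (x i))"
    using x by (intro v_eval) (simp add: good_point_def)
  finally have main: "eval_coords n d' (inv.mac_vec ?N) x = (\<Prod>i<n. x i) ^ m * ?F (\<lambda>i. inverse (x i))" .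
  have "macdonald_P q t (part_list ?N) = sym_series (inv.mac_vec ?N)"
    using inv.macdonald_P_eq[OF is_partition_part_list[OF N(1)]] by (simp add: macdonald_P_inverse)
  moreover have "macdonald_P q t (part_list M) = sym_series (mac_vec M)"
    using macdonald_P_eq[OF is_partition_part_list[OF M(1)]] by simp
  ultimately show ?thesis
    using main eval_vars_sym_series[OF inv.homogeneous_mac_vec[OF N_parts]]
      eval_vars_sym_series[OF homogeneous_mac_vec[of M ?d]] M(1)
    by (simp add: parts_def)
qed

section \<open>Principal specialisation\<close>

lemma eval_vars_reverse_scale:
  assumes M: "0 \<notin># M"
  shows "eval_vars n (\<lambda>i. c * x (n - Suc i)) (macdonald_P q t (part_list M))
    = c ^ sum_mset M * eval_vars n x (macdonald_P q t (part_list M))"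
proof -
  let ?d = "sum_mset M"
  have hom: "homogeneous ?d (mac_vec M)" using M by (intro homogeneous_mac_vec) (simp add: parts_def)
  have P: "macdonald_P q t (part_list M) = sym_series (mac_vec M)"
    using macdonald_P_eq[OF is_partition_part_list[OF M]] by simp
  have "psum_prod n N (\<lambda>i. c * x (n - Suc i)) = c ^ sum_mset N * psum_prod n N x" for N
  proof -
    have "(\<Sum>i<n. (c * x (n - Suc i)) ^ r) = c ^ r * (\<Sum>i<n. x i ^ r)" for r
      using sum.nat_diff_reindex[of "\<lambda>i. x i ^ r" n] by (simp add: power_mult_distrib sum_distrib_left[symmetric])
    then show ?thesis
      by (simp add: psum_prod_def prod_mset.distrib prod_mset_power_sum_mset)
  qed
  then show ?thesis
    unfolding P eval_vars_sym_series[OF hom] eval_coords_expansion[OF hom] sum_distrib_left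
    by (intro sum.cong refl) (simp add: parts_def mult_ac)
qed

lemma good_point_powers: "good_point n (\<lambda>i. t ^ i)"
proof -
  have "i = j" if "t ^ i = t ^ j" "i \<le> j" for i j
  proof (rule ccontr)
    assume "i \<noteq> j"
    have "t ^ j = t ^ i * t ^ (j - i)" using that(2) by (simp flip: power_add)
    then have "t ^ (j - i) = 1" using that(1) t_nonzero by simp
    then show False using t_power_ne_1[of "j - i"] that(2) \<open>i \<noteq> j\<close> by simp
  qed
  then show ?thesis
    using t_nonzero unfolding good_point_def inj_on_def by (metis linear power_eq_0_iff)
qed

text \<open>At \<open>x i = t ^ i\<close>, inverting the variables amounts to reversing their order and scaling them by \<open>inverse t ^ (n - 1)\<close>.\<close>

theorem principal_specialisation_complement:
  assumes M: "0 \<notin># M" "size M \<le> n" "\<And>a. a \<in># M \<Longrightarrow> a \<le> m" and n: "n > 0"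
  shows "eval_vars n (\<lambda>i. t ^ i) (macdonald_P q t (part_list (complement n m M)))
    = t powi (((int n - 1) * (int m * int n - 2 * int (sum_mset M))) div 2)
       * eval_vars n (\<lambda>i. t ^ i) (macdonald_P q t (part_list M))"
proof -
  let ?P = "macdonald_P q t (part_list M)" and ?s = "\<Sum>i<n. i"
  have "eval_vars n (\<lambda>i. t ^ i) (macdonald_P q t (part_list (complement n m M)))
    = (\<Prod>i<n. t ^ i) ^ m * eval_vars n (\<lambda>i. inverse (t ^ i)) ?P"
    by (rule macdonald_P_complement[OF M good_point_powers])
  also have "eval_vars n (\<lambda>i. inverse (t ^ i)) ?P = eval_vars n (\<lambda>i. inverse t ^ (n - 1) * t ^ (n - Suc i)) ?P"
    unfolding eval_vars_def
  proof (intro sum.cong refl arg_cong2[of _ _ _ _ "(*)"] prod.cong)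
    fix i :: nat and \<alpha> :: "nat \<Rightarrow>\<^sub>0 nat"
    assume "i \<in> {..<n}"
    then have "n - 1 = i + (n - Suc i)" by simp
    then have "inverse t ^ (n - 1) = inverse t ^ i * inverse t ^ (n - Suc i)" by (metis power_add)
    then have "inverse (t ^ i) = inverse t ^ (n - 1) * t ^ (n - Suc i)"
      using t_nonzero by (simp add: power_inverse)
    then show "inverse (t ^ i) ^ expo \<alpha> i = (inverse t ^ (n - 1) * t ^ (n - Suc i)) ^ expo \<alpha> i"
      by simp
  qed
  also have "\<dots> = (inverse t ^ (n - 1)) ^ sum_mset M * eval_vars n (\<lambda>i. t ^ i) ?P"
    by (rule eval_vars_reverse_scale[OF M(1)])
  finally have "eval_vars n (\<lambda>i. t ^ i) (macdonald_P q t (part_list (complement n m M)))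
     = (\<Prod>i<n. t ^ i) ^ m * (inverse t ^ (n - 1)) ^ sum_mset M * eval_vars n (\<lambda>i. t ^ i) ?P" by simp
  moreover have "(\<Prod>i<n. t ^ i) ^ m * (inverse t ^ (n - 1)) ^ sum_mset M
      = t powi (int (?s * m) - int ((n - 1) * sum_mset M))"
    using t_nonzero
    by (simp add: power_int_diff power_int_of_nat power_sum power_mult power_inverse divide_inverse flip: of_nat_mult)
  moreover have "int (?s * m) - int ((n - 1) * sum_mset M) = ((int n - 1) * (int m * int n - 2 * int (sum_mset M))) div 2"
  proof -
    have "2 * ?s = n * (n - 1)"
    proof (induction n)
      case (Suc n)
      then show ?case by (cases n) simp_all
    qed simp
    then have "2 * int ?s = int n * (int n - 1)"
      using n by (metis of_nat_mult of_nat_numeral of_nat_diff of_nat_1 Suc_leI One_nat_def)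
    then have "2 * (int (?s * m) - int ((n - 1) * sum_mset M)) = (int n - 1) * (int m * int n - 2 * int (sum_mset M))"
    proof -
      have "2 * (int (?s * m) - int ((n - 1) * sum_mset M)) = int m * (2 * int ?s) - 2 * ((int n - 1) * int (sum_mset M))"
        using n by (simp only: of_nat_mult of_nat_diff Suc_leI One_nat_def of_nat_1) (simp add: algebra_simps)
      then show ?thesis unfolding \<open>2 * int ?s = int n * (int n - 1)\<close> by (simp add: algebra_simps)
    qed
    then show ?thesis by simp
  qed
  ultimately show ?thesis by simp
qed

end

section \<open>Staircases\<close>

lemma mset_staircase:
  "mset (staircase w s k g) = replicate_mset g (w * k) + (\<Sum>j\<in>{1..<k}. replicate_mset s (w * j))"
proof -
  have "mset (concat (map (\<lambda>j. replicate s (w * j)) (rev [1..<k]))) = (\<Sum>j\<in>{1..<k}. replicate_mset s (w * j))"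
    by (induction k) (auto simp: atLeastLessThanSuc)
  then show ?thesis by (simp add: staircase_def)
qed

lemma sorted_wrt_replicate: "sorted_wrt (\<ge>) (replicate n (a::nat))"
  by (induction n) auto

lemma le_staircase: "a \<in> set (staircase w s k g) \<Longrightarrow> a \<le> w * k"
  by (auto simp: staircase_def split: if_splits)

lemma is_partition_staircase:
  assumes "k > 0" and "w > 0"
  shows "is_partition (staircase w s k g)"
proof -
  have "sorted_wrt (\<ge>) (concat (map (\<lambda>j. replicate s (w * j)) (rev [1..<k])))
    \<and> (\<forall>a\<in>set (concat (map (\<lambda>j. replicate s (w * j)) (rev [1..<k]))). a \<le> w * (k - 1))"
  proof (induction k)
    case (Suc k)
    then show ?case by (auto simp: sorted_wrt_append sorted_wrt_replicate intro: order.trans)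
  qed simp
  moreover have "w * (k - 1) \<le> w * k" by simp
  ultimately have "sorted_wrt (\<ge>) (staircase w s k g)"
    by (auto simp: staircase_def sorted_wrt_append sorted_wrt_replicate intro: order.trans)
  then show ?thesis using assms by (auto simp: is_partition_def staircase_def)
qed

lemma length_staircase: "length (staircase w s k g) = g + s * (k - 1)"
proof -
  have "size (mset (staircase w s k g)) = g + s * (k - 1)"
    unfolding mset_staircase by (simp add: size_multiset_sum)
  then show ?thesis by simp
qed

lemma sum_mset_sum: "sum_mset (\<Sum>j\<in>A. f j) = (\<Sum>j\<in>A. sum_mset (f j))"
  by (induction A rule: infinite_finite_induct) auto

lemma sum_mset_staircase: "2 * sum_mset (mset (staircase w s k g)) = 2 * (w * k * g) + s * w * (k * (k - 1))"
proof -
  have "2 * (\<Sum>j\<in>{1..<k}. j) = k * (k - 1)"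
    by (induction k) (auto simp: atLeastLessThanSuc algebra_simps)
  moreover have "sum_mset (mset (staircase w s k g)) = w * k * g + s * w * (\<Sum>j\<in>{1..<k}. j)"
    by (simp add: mset_staircase sum_mset_sum sum_distrib_left mult_ac)
  ultimately show ?thesis by (simp add: distrib_left)
qed

text \<open>Complementation exchanges the \<open>g\<close> rows of full length with the \<open>h\<close> empty rows, and the steps of height \<open>s\<close> among
  themselves.\<close>

lemma complement_staircase:
  assumes "k > 0" and "w > 0" and n: "n = g + s * (k - 1) + h"
  shows "complement n (w * k) (mset (staircase w s k g)) = mset (staircase w s k h)"
proof -
  have reflect: "(\<Sum>j\<in>{1..<k}. replicate_mset s (w * k - w * j)) = (\<Sum>j\<in>{1..<k}. replicate_mset s (w * j))"
    by (rule sum.reindex_bij_witness[of _ "\<lambda>j. k - j" "\<lambda>j. k - j"]) (auto simp: diff_mult_distrib2)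
  have pad: "n - size (mset (staircase w s k g)) = h" using n by (simp add: length_staircase)
  have rep: "image_mset (\<lambda>a. w * k - a) (replicate_mset i b) = replicate_mset i (w * k - b)" for i b
    by (induction i) auto
  have steps: "image_mset (\<lambda>a. w * k - a) (\<Sum>j\<in>A. replicate_mset s (w * j)) = (\<Sum>j\<in>A. replicate_mset s (w * k - w * j))" for A
    by (induction A rule: infinite_finite_induct) (simp_all add: rep)
  have img: "image_mset (\<lambda>a. w * k - a) (mset (staircase w s k g) + replicate_mset (n - size (mset (staircase w s k g))) 0)
     = replicate_mset g 0 + mset (staircase w s k h)"
  proof -
    have "image_mset (\<lambda>a. w * k - a) (mset (staircase w s k g) + replicate_mset h 0)
       = replicate_mset g (w * k - w * k) + (\<Sum>j\<in>{1..<k}. replicate_mset s (w * k - w * j)) + replicate_mset h (w * k - 0)"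
      by (simp only: mset_staircase[of w s k g] image_mset_union rep steps)
    also have "\<dots> = replicate_mset g 0 + (replicate_mset h (w * k) + (\<Sum>j\<in>{1..<k}. replicate_mset s (w * j)))"
      unfolding reflect by simp
    finally show ?thesis unfolding pad mset_staircase[of w s k h] .
  qed
  have zeros: "filter_mset (\<lambda>a. a \<noteq> 0) (replicate_mset g (0::nat)) = {#}"
    by simp
  have "0 \<notin># mset (staircase w s k h)"
    using is_partition_staircase[OF assms(1,2), of s h] by (simp add: is_partition_def)
  then show ?thesis
    unfolding complement_def img filter_union_mset zeros add_0_left by (rule filter_mset_nonzero)
qed

section \<open>The field of rational functions\<close>

instance fract :: ("{idom, ring_char_0}") field_char_0
proof
  show "inj (of_nat :: nat \<Rightarrow> 'a fract)"
    by (rule injI) (simp add: of_nat_fract eq_fract)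
qed

lemma to_fract_power: "to_fract (x ^ n) = to_fract x ^ n"
  by (induction n) auto

text \<open>Both sums are polynomials in \<open>t\<close> whose coefficient at \<open>t ^ i\<close> is a power of \<open>q\<close>.\<close>

lemma generic_q_t: "generic_qt q_var t_var"
proof
  fix n i :: nat and f g :: "nat \<Rightarrow> nat"
  assume eq: "(\<Sum>i<n. t_var ^ i * q_var ^ f i) = (\<Sum>i<n. t_var ^ i * q_var ^ g i)" and i: "i < n"
  have F: "(\<Sum>i<n. t_var ^ i * q_var ^ h i) = to_fract (\<Sum>i<n. monom (monom 1 (h i)) i)" for h
  proof -
    have tq: "t_var = to_fract (monom 1 1)" "q_var = to_fract [:monom 1 1:]"
      by (simp_all add: t_var_def q_var_def to_fract_def monom_altdef)
    have "monom 1 1 ^ i * [:monom 1 1:] ^ a = monom (monom (1::rat) a) i" for i a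
      by (simp add: monom_power flip: monom_0) (simp add: mult_monom)
    then show ?thesis
      by (simp only: tq to_fract_power[symmetric] to_fract_mult[symmetric] to_fract_sum[symmetric])
  qed
  have coeff: "coeff (\<Sum>i<n. monom (monom 1 (h i)) i) i = monom (1::rat) (h i)" for h
    using i by (simp add: coeff_sum)
  have "(\<Sum>i<n. monom (monom 1 (f i)) i) = (\<Sum>i<n. monom (monom (1::rat) (g i)) i)"
    using eq unfolding F to_fract_eq_iff .
  then have "monom (1::rat) (f i) = monom 1 (g i)"
    using coeff[of f] coeff[of g] by simp
  then show "f i = g i" by (metis degree_monom_eq zero_neq_one)
qed

theorem proposition5p1:
  fixes k w s n g :: nat
  assumes "k > 0" and "w > 0" and "s > 0" and "n > 0"
    and "g \<le> s"
    and "0 \<le> int n - int s * (int k - 1) - int g"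
    and "int n - int s * (int k - 1) - int g \<le> int s"
  shows "eval_vars n (\<lambda>i. t_var ^ i)
           (macdonald_P q_var t_var (staircase w s k (n - s * (k - 1) - g)))
       = t_var powi
           ((int w * int k * (int n - 1) * (int n - int s * (int k - 1) - 2 * int g)) div 2)
         * eval_vars n (\<lambda>i. t_var ^ i) (macdonald_P q_var t_var (staircase w s k g))"
proof -
  interpret generic_qt q_var t_var by (rule generic_q_t)
  define h where "h = n - s * (k - 1) - g"
  let ?M = "mset (staircase w s k g)"
  have k1: "int k - 1 = int (k - 1)" using assms(1) by (simp add: of_nat_diff)
  have "int (s * (k - 1) + g) \<le> int n" using assms(6) by (simp add: k1)
  then have n: "n = g + s * (k - 1) + h" unfolding h_def by linarith
  have part: "is_partition (staircase w s k j)" for j by (rule is_partition_staircase[OF assms(1,2)])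
  have M: "0 \<notin># ?M" "size ?M \<le> n" "\<And>a. a \<in># ?M \<Longrightarrow> a \<le> w * k"
    using part[of g] n le_staircase by (simp_all add: is_partition_def length_staircase)
  have "int (w * k) * int n - 2 * int (sum_mset ?M) = int w * int k * (int n - int s * (int k - 1) - 2 * int g)"
  proof -
    have "int (2 * sum_mset ?M) = int (2 * (w * k * g) + s * w * (k * (k - 1)))"
      by (simp only: sum_mset_staircase)
    then have "2 * int (sum_mset ?M) = 2 * (int w * int k * int g) + int s * int w * (int k * (int k - 1))"
      by (simp only: of_nat_mult of_nat_add of_nat_numeral k1)
    then show ?thesis by (simp only: of_nat_mult) (simp add: algebra_simps)
  qed
  then have exponent: "(int n - 1) * (int (w * k) * int n - 2 * int (sum_mset ?M))
     = int w * int k * (int n - 1) * (int n - int s * (int k - 1) - 2 * int g)"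
    by (simp only: mult_ac)
  have "part_list (complement n (w * k) ?M) = staircase w s k h"
    by (simp add: complement_staircase[OF assms(1,2) n] part_list_mset[OF part])
  then show ?thesis
    using principal_specialisation_complement[OF M assms(4)]
    by (simp only: exponent part_list_mset[OF part] h_def)
qed

end
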